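(* Let $n\ge 3$. For all $1\le r\le n-1$, each of the groups $\mathcal{TO}_{n,r}$ (isomorphic to $\mathrm{Out}(T_{n,r})$) and $\mathcal O_{n,r}$ (isomorphic to $\mathrm{Out}(G_{n,r})$) contains a subgroup isomorphic to R. Thompson's group $F$.
   Context: Notation. Maps act on the right. $X_n=\{0,\ldots,n-1\}$; $X_n^*$ (resp. $X_n^k$) is the set of finite words (words of length $k$) over $X_n$; $\epsilon$ is the empty word; $\dot{\mathbf r}=\{\dot 0,\ldots,\dot{(r-1)}\}$ is a further ordered alphabet; $X_{n,r}^+=\{\dot a w:\dot a\in\dot{\mathbf r},\,w\in X_n^*\}$, $X_{n,r}^*=X_{n,r}^+\cup\{\epsilon\}$. $\mathfrak C_n=X_n^\omega$ and $\mathfrak C_{n,r}=\{\dot a x:\dot a\in\dot{\mathbf r},\,x\in\mathfrak C_n\}$ are Cantor spaces; $U_\nu$ is the set of infinite words with prefix $\nu$. A complete antichain is a finite set of pairwise prefix-incomparable words $u\in X_{n,r}^+$ whose sets $U_u$ cover $\mathfrak C_{n,r}$; it is listed in lexicographic order. $G_{n,r}$ is the group of all homeomorphisms $g$ of $\mathfrak C_{n,r}$ for which there are complete antichains $\{u_0,\ldots,u_{l-1}\}$, $\{v_0,\ldots,v_{l-1}\}$ of the same size and a bijection $\pi$ between them with $(u_i x)g=(u_i)\pi\, x$ for all $i$ and $x\in\mathfrak C_n$. $T_{n,r}\le G_{n,r}$ consists of those $g$ for which $\pi$ can be taken of the form $(u_i)\pi=v_{(i+j)\bmod l}$ for a fixed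 $j$. The relation $\simeq$ on $\mathfrak C_{n,r}$: $x\simeq y$ iff $x=y$, or $\{x,y\}=\{w\,i\,000\ldots,\;w\,(i-1)(n-1)(n-1)\ldots\}$ with $w\in X_{n,r}^+$ and $0<i\le n-1$, or $\{x,y\}=\{\dot a\,00\ldots,\;\dot{(a-1)}(n-1)(n-1)\ldots\}$ with $0<a\le r-1$, or $\{x,y\}=\{\dot 0\,00\ldots,\;\dot{(r-1)}(n-1)(n-1)\ldots\}$. Transducers over $X_n$. A transducer $\langle X_n,Q,\pi,\lambda\rangle$ has transition function $\pi:X_n\times Q\to Q$ and output function $\lambda:X_n\times Q\to X_n^*$, extended to words by $\pi(wi,q)=\pi(i,\pi(w,q))$, $\lambda(wi,q)=\lambda(w,q)\lambda(i,\pi(w,q))$, such that infinite inputs give infinite outputs; $h_q:\mathfrak C_n\to\mathfrak C_n$ is the continuous map $\delta\mapsto\lambda(\delta,q)$. Fixing an initial state $q_0$ gives an initial transducer, representing $h_{q_0}$; it is minimal if all states are reachable from $q_0$, $h_q\neq h_p$ for distinct states $q,p$, and for every state $q$ and letter $i$, $\lambda(i,q)$ is the greatest common prefix of $\{(i\delta)h_q:\delta\in\mathfrak C_n\}$. A transducer is synchronizing at level $k$ if for each $\Gamma\in X_n^k$ the state $\pi(\Gamma,q)$ does not depend on $q$ (the state forced by $\Gamma$); its core is the sub-transducer on the states forced by words of $X_n^k$. Transducers over $\mathfrak C_{n,r}$. An initial transducer $A_{q_0}$ over $\mathfrak C_{n,r}$ has state set $Q=R\sqcup S$ with $R$ finite,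 $q_0\in R$, and functions $\pi,\lambda$ defined on $(\dot{\mathbf r}\times\{q_0\})\sqcup(X_n\times(Q\setminus\{q_0\}))$, $\pi$ with values in $Q\setminus\{q_0\}$ and $\lambda$ with values in $X_{n,r}^*\sqcup X_n^*$, such that: a transition from a state of $R$ outputs $\epsilon$ if it ends in $R$ and a word of $X_{n,r}^+$ if it ends in $S$; transitions from $S$ end in $S$ with output in $X_n^*$; infinite words read from states of $S$ give infinite output; no state of $R$ lies on a cycle. It represents the map $h_{q_0}:\mathfrak C_{n,r}\to\mathfrak C_{n,r}$. It is minimal if all its states are reachable from $q_0$, distinct states $q,p$ induce distinct maps $\delta\mapsto\lambda(\delta,q)$, $\delta\mapsto\lambda(\delta,p)$ on infinite words, and for every state $q$ and every letter $i$ readable from $q$, $\lambda(i,q)$ is the greatest common prefix of $\{\lambda(i\delta,q):\delta\in\mathfrak C_n\}$; every homeomorphism of $\mathfrak C_{n,r}$ is represented by a unique minimal transducer. It is synchronizing if for some $k$ the state reached by reading a word of length $k$ from any state from which it can be read depends only on the word; its core is then the transducer over $X_n$ formed by the states forced by words of $X_n^k$. Groups. $\mathcal B_{n,r}$ is the group of homeomorphisms $h$ of $\mathfrak C_{n,r}$ such that the minimal transducers of $h$ and $h^{-1}$ are finite and synchronizing; $\mathcal{TB}_{n,r}$ is the subgroup of those $h\in\mathcal B_{n,r}$ preserving $\simeq$. For $h\in\mathcal B_{n,r}$ let $\mathrm{Core}(h)$ be the core of its minimal transducer (a transducer over $X_n$, up to renaming states). $\mathcal O_{n,r}=\{\mathrm{Core}(h):h\in\mathcal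 B_{n,r}\}$, $\mathcal{TO}_{n,r}=\{\mathrm{Core}(h):h\in\mathcal{TB}_{n,r}\}$. The product of $g,h\in\mathcal O_{n,r}$ is the core of the minimal transducer representing $h_{q_1}$ followed by $h_{q_2}$, for any states $q_1$ of $g$ and $q_2$ of $h$ (independent of the choice). With this product $\mathcal O_{n,r}$ is a group isomorphic to $\mathrm{Out}(G_{n,r})$ and $\mathcal{TO}_{n,r}$ is a subgroup isomorphic to $\mathrm{Out}(T_{n,r})$. Thompson's group $F$ is the group of piecewise linear orientation-preserving homeomorphisms of $[0,1]$ with finitely many breakpoints, all at dyadic rationals, and all slopes powers of $2$. *)

theory Defs
  imports "HOL-Analysis.Analysis" "HOL-Library.Omega_Words_Fun" "HOL-Algebra.Group"
begin

section \<open>Words and Cantor spaces\<close>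

text \<open>
  Plain letters form the alphabet \<open>{0, ..., n-1}\<close>, dotted ones the additional root alphabet
  \<open>{0, ..., r-1}\<close>. Finite words are lists; infinite words are functions on \<open>nat\<close>, with
  \<open>\<frown>\<close> the concatenation of a finite and an infinite word.
\<close>

datatype letter = Plain nat | Dot nat

definition alph :: "nat \<Rightarrow> letter set" where
  "alph n = Plain ` {..<n}"

definition dots :: "nat \<Rightarrow> letter set" where
  "dots r = Dot ` {..<r}"

definition rooted_words :: "nat \<Rightarrow> nat \<Rightarrow> letter list set" where
  "rooted_words n r = {a # w | a w. a \<in> dots r \<and> w \<in> lists (alph n)}"

definition cantor :: "nat \<Rightarrow> letter word set" where
  "cantor n = {x. range x \<subseteq> alph n}"

definition rooted_cantor :: "nat \<Rightarrow> nat \<Rightarrow> letter word set" where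
  "rooted_cantor n r = {[a] \<frown> x | a x. a \<in> dots r \<and> x \<in> cantor n}"

definition rooted_cantor_top :: "nat \<Rightarrow> nat \<Rightarrow> letter word topology" where
  "rooted_cantor_top n r =
     subtopology (product_topology (\<lambda>_. discrete_topology UNIV) UNIV) (rooted_cantor n r)"

definition is_prefix :: "letter list \<Rightarrow> letter word \<Rightarrow> bool" where
  "is_prefix u x \<longleftrightarrow> (\<exists>y. x = u \<frown> y)"

text \<open>No \<open>u\<close> qualifies if \<open>W\<close> is a singleton, its common prefixes having unbounded length.\<close>

definition is_gcp :: "letter list \<Rightarrow> letter word set \<Rightarrow> bool" where
  "is_gcp u W \<longleftrightarrow> (\<forall>x\<in>W. is_prefix u x) \<and>
     (\<forall>v. (\<forall>x\<in>W. is_prefix v x) \<longrightarrow> length v \<le> length u)"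

text \<open>The relation \<open>\<simeq>\<close> identifying the two expansions of an \<open>n\<close>-adic point of the circle.\<close>

definition circ_eq :: "nat \<Rightarrow> nat \<Rightarrow> letter word \<Rightarrow> letter word \<Rightarrow> bool" where
  "circ_eq n r x y \<longleftrightarrow> x \<in> rooted_cantor n r \<and> y \<in> rooted_cantor n r \<and>
     (x = y
      \<or> (\<exists>w i. w \<in> rooted_words n r \<and> 0 < i \<and> i \<le> n - 1 \<and>
           {x, y} = {(w @ [Plain i]) \<frown> (\<lambda>_. Plain 0), (w @ [Plain (i - 1)]) \<frown> (\<lambda>_. Plain (n - 1))})
      \<or> (\<exists>a. 0 < a \<and> a \<le> r - 1 \<and>
           {x, y} = {[Dot a] \<frown> (\<lambda>_. Plain 0), [Dot (a - 1)] \<frown> (\<lambda>_. Plain (n - 1))})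
      \<or> {x, y} = {[Dot 0] \<frown> (\<lambda>_. Plain 0), [Dot (r - 1)] \<frown> (\<lambda>_. Plain (n - 1))})"


section \<open>Transducers\<close>

text \<open>The values of the transition and output functions matter only on \<open>tstates\<close> and on the
  letters that can be read from the given state.\<close>

record 'q transducer =
  tstates :: "'q set"
  ttrans :: "letter \<Rightarrow> 'q \<Rightarrow> 'q"
  tout :: "letter \<Rightarrow> 'q \<Rightarrow> letter list"

definition trans_word :: "('q, 'm) transducer_scheme \<Rightarrow> letter list \<Rightarrow> 'q \<Rightarrow> 'q" where
  "trans_word A w q = fold (ttrans A) w q"

primrec out_word :: "('q, 'm) transducer_scheme \<Rightarrow> letter list \<Rightarrow> 'q \<Rightarrow> letter list" where
  "out_word A [] q = []"
| "out_word A (i # w) q = tout A i q @ out_word A w (ttrans A i q)"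

lemma trans_word_snoc: "trans_word A (w @ [i]) q = ttrans A i (trans_word A w q)"
  by (simp add: trans_word_def)

lemma out_word_snoc: "out_word A (w @ [i]) q = out_word A w q @ tout A i (trans_word A w q)"
  by (induction w arbitrary: q) (simp_all add: trans_word_def)

definition infinite_output :: "('q, 'm) transducer_scheme \<Rightarrow> 'q \<Rightarrow> letter word \<Rightarrow> bool" where
  "infinite_output A q \<delta> \<longleftrightarrow> (\<forall>m. \<exists>k. m \<le> length (out_word A (prefix k \<delta>) q))"

text \<open>The map \<open>h\<^sub>q\<close>; well-determined where \<open>infinite_output A q \<delta>\<close> holds.\<close>

definition state_map :: "('q, 'm) transducer_scheme \<Rightarrow> 'q \<Rightarrow> letter word \<Rightarrow> letter word" where
  "state_map A q \<delta> = (THE x. \<forall>k. is_prefix (out_word A (prefix k \<delta>) q) x)"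


subsection \<open>Transducers over a plain alphabet\<close>

definition is_transducer :: "nat \<Rightarrow> 'q transducer \<Rightarrow> bool" where
  "is_transducer n A \<longleftrightarrow>
     (\<forall>q\<in>tstates A. \<forall>i\<in>alph n. ttrans A i q \<in> tstates A \<and> tout A i q \<in> lists (alph n)) \<and>
     (\<forall>q\<in>tstates A. \<forall>\<delta>\<in>cantor n. infinite_output A q \<delta>)"

definition minimal :: "nat \<Rightarrow> 'q transducer \<Rightarrow> 'q \<Rightarrow> bool" where
  "minimal n A q0 \<longleftrightarrow> is_transducer n A \<and> q0 \<in> tstates A \<and>
     (\<forall>q\<in>tstates A. \<exists>w\<in>lists (alph n). trans_word A w q0 = q) \<and>
     (\<forall>q\<in>tstates A. \<forall>p\<in>tstates A. q \<noteq> p \<longrightarrow> (\<exists>\<delta>\<in>cantor n. state_map A q \<delta> \<noteq> state_map A p \<delta>)) \<and>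
     (\<forall>q\<in>tstates A. \<forall>i\<in>alph n. is_gcp (tout A i q) {state_map A q ([i] \<frown> \<delta>) | \<delta>. \<delta> \<in> cantor n})"

definition sync_level :: "nat \<Rightarrow> 'q transducer \<Rightarrow> nat \<Rightarrow> bool" where
  "sync_level n A k \<longleftrightarrow>
     (\<forall>w\<in>lists (alph n). length w = k \<longrightarrow>
        (\<forall>q\<in>tstates A. \<forall>p\<in>tstates A. trans_word A w q = trans_word A w p))"

text \<open>The set of forced states is the same for all synchronizing levels; the least one is used.\<close>

definition core :: "nat \<Rightarrow> 'q transducer \<Rightarrow> 'q transducer" where
  "core n A =
     \<lparr> tstates = {trans_word A w q | w q. w \<in> lists (alph n) \<and>
                    length w = (LEAST k. sync_level n A k) \<and> q \<in> tstates A},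
       ttrans = ttrans A, tout = tout A \<rparr>"

definition transducer_iso :: "nat \<Rightarrow> 'p transducer \<Rightarrow> 'q transducer \<Rightarrow> bool" where
  "transducer_iso n A B \<longleftrightarrow> (\<exists>f. bij_betw f (tstates A) (tstates B) \<and>
     (\<forall>q\<in>tstates A. \<forall>i\<in>alph n. f (ttrans A i q) = ttrans B i (f q) \<and> tout A i q = tout B i (f q)))"

text \<open>A transducer up to renaming of states. States are natural numbers, which loses nothing: all
  states of a minimal transducer are reachable, hence there are countably many of them.\<close>

definition transducer_class :: "nat \<Rightarrow> nat transducer \<Rightarrow> nat transducer set" where
  "transducer_class n A = {B. transducer_iso n A B}"


subsection \<open>Initial transducers over the rooted Cantor space\<close>

text \<open>\<open>rinit\<close> is the initial state \<open>q\<^sub>0\<close>, \<open>rpre\<close> the set \<open>R\<close>, and \<open>tstates A - rpre A\<close> the set \<open>S\<close>.\<close>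

record 'q rtransducer = "'q transducer" +
  rinit :: 'q
  rpre :: "'q set"

definition readable_letters :: "nat \<Rightarrow> nat \<Rightarrow> 'q rtransducer \<Rightarrow> 'q \<Rightarrow> letter set" where
  "readable_letters n r A q = (if q = rinit A then dots r else alph n)"

definition readable_words :: "nat \<Rightarrow> nat \<Rightarrow> 'q rtransducer \<Rightarrow> 'q \<Rightarrow> letter list set" where
  "readable_words n r A q = (if q = rinit A then insert [] (rooted_words n r) else lists (alph n))"

definition readable_inf :: "nat \<Rightarrow> nat \<Rightarrow> 'q rtransducer \<Rightarrow> 'q \<Rightarrow> letter word set" where
  "readable_inf n r A q = (if q = rinit A then rooted_cantor n r else cantor n)"

definition is_rtransducer :: "nat \<Rightarrow> nat \<Rightarrow> 'q rtransducer \<Rightarrow> bool" where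
  "is_rtransducer n r A \<longleftrightarrow>
     rpre A \<subseteq> tstates A \<and> finite (rpre A) \<and> rinit A \<in> rpre A \<and>
     (\<forall>q\<in>tstates A. \<forall>i\<in>readable_letters n r A q. ttrans A i q \<in> tstates A - {rinit A}) \<and>
     (\<forall>q\<in>rpre A. \<forall>i\<in>readable_letters n r A q.
        (if ttrans A i q \<in> rpre A then tout A i q = [] else tout A i q \<in> rooted_words n r)) \<and>
     (\<forall>q\<in>tstates A - rpre A. \<forall>i\<in>alph n.
        ttrans A i q \<in> tstates A - rpre A \<and> tout A i q \<in> lists (alph n)) \<and>
     (\<forall>q\<in>tstates A - rpre A. \<forall>\<delta>\<in>cantor n. infinite_output A q \<delta>) \<and>
     (\<forall>q\<in>rpre A. \<forall>w\<in>readable_words n r A q. w \<noteq> [] \<longrightarrow> trans_word A w q \<noteq> q)"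

definition rminimal :: "nat \<Rightarrow> nat \<Rightarrow> 'q rtransducer \<Rightarrow> bool" where
  "rminimal n r A \<longleftrightarrow> is_rtransducer n r A \<and>
     (\<forall>q\<in>tstates A. \<exists>w\<in>readable_words n r A (rinit A). trans_word A w (rinit A) = q) \<and>
     (\<forall>q\<in>tstates A. \<forall>p\<in>tstates A. q \<noteq> p \<longrightarrow>
        readable_inf n r A q \<noteq> readable_inf n r A p \<or>
        (\<exists>\<delta>\<in>readable_inf n r A q. state_map A q \<delta> \<noteq> state_map A p \<delta>)) \<and>
     (\<forall>q\<in>tstates A. \<forall>i\<in>readable_letters n r A q.
        is_gcp (tout A i q) {state_map A q ([i] \<frown> \<delta>) | \<delta>. \<delta> \<in> cantor n})"

definition represents :: "nat \<Rightarrow> nat \<Rightarrow> 'q rtransducer \<Rightarrow> (letter word \<Rightarrow> letter word) \<Rightarrow> bool" where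
  "represents n r A h \<longleftrightarrow> (\<forall>x\<in>rooted_cantor n r. state_map A (rinit A) x = h x)"

definition rsync_level :: "nat \<Rightarrow> nat \<Rightarrow> 'q rtransducer \<Rightarrow> nat \<Rightarrow> bool" where
  "rsync_level n r A k \<longleftrightarrow>
     (\<forall>w q p. length w = k \<and> q \<in> tstates A \<and> p \<in> tstates A \<and>
        w \<in> readable_words n r A q \<and> w \<in> readable_words n r A p \<longrightarrow>
        trans_word A w q = trans_word A w p)"

definition rcore :: "nat \<Rightarrow> nat \<Rightarrow> 'q rtransducer \<Rightarrow> 'q transducer" where
  "rcore n r A =
     \<lparr> tstates = {trans_word A w q | w q. w \<in> lists (alph n) \<and>
                    length w = (LEAST k. rsync_level n r A k) \<and> q \<in> tstates A - {rinit A}},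
       ttrans = ttrans A, tout = tout A \<rparr>"


section \<open>The groups\<close>

text \<open>Minimal transducers being unique up to renaming of states, the existential quantifier
  refers to the minimal transducer of \<open>h\<close>.\<close>

definition finite_sync :: "nat \<Rightarrow> nat \<Rightarrow> (letter word \<Rightarrow> letter word) \<Rightarrow> bool" where
  "finite_sync n r h \<longleftrightarrow> (\<exists>A :: nat rtransducer. rminimal n r A \<and> represents n r A h \<and>
     finite (tstates A) \<and> (\<exists>k. rsync_level n r A k))"

text \<open>Values of \<open>h\<close> outside \<open>rooted_cantor n r\<close> are irrelevant.\<close>

definition B_maps :: "nat \<Rightarrow> nat \<Rightarrow> (letter word \<Rightarrow> letter word) set" where
  "B_maps n r = {h. homeomorphic_map (rooted_cantor_top n r) (rooted_cantor_top n r) h \<and>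
     finite_sync n r h \<and> finite_sync n r (inv_into (rooted_cantor n r) h)}"

definition TB_maps :: "nat \<Rightarrow> nat \<Rightarrow> (letter word \<Rightarrow> letter word) set" where
  "TB_maps n r = {h \<in> B_maps n r. \<forall>x\<in>rooted_cantor n r. \<forall>y\<in>rooted_cantor n r.
     circ_eq n r x y \<longleftrightarrow> circ_eq n r (h x) (h y)}"

definition Core :: "nat \<Rightarrow> nat \<Rightarrow> (letter word \<Rightarrow> letter word) \<Rightarrow> nat transducer set" where
  "Core n r h = transducer_class n
     (rcore n r (SOME A :: nat rtransducer. rminimal n r A \<and> represents n r A h))"

text \<open>Maps act on the right: in the product, \<open>g\<close> is applied first. The result does not depend on
  the representatives \<open>C\<close>, \<open>D\<close> nor on the states \<open>q1\<close>, \<open>q2\<close>.\<close>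

definition core_mult ::
  "nat \<Rightarrow> nat transducer set \<Rightarrow> nat transducer set \<Rightarrow> nat transducer set" where
  "core_mult n g h = transducer_class n (core n
     (SOME A. \<exists>C\<in>g. \<exists>D\<in>h. \<exists>q1\<in>tstates C. \<exists>q2\<in>tstates D. \<exists>q0. minimal n A q0 \<and>
        (\<forall>\<delta>\<in>cantor n. state_map A q0 \<delta> = state_map D q2 (state_map C q1 \<delta>))))"

definition O_group :: "nat \<Rightarrow> nat \<Rightarrow> nat transducer set monoid" where
  "O_group n r = \<lparr>carrier = Core n r ` B_maps n r, mult = core_mult n, one = Core n r (\<lambda>x. x)\<rparr>"

definition TO_group :: "nat \<Rightarrow> nat \<Rightarrow> nat transducer set monoid" where
  "TO_group n r = \<lparr>carrier = Core n r ` TB_maps n r, mult = core_mult n, one = Core n r (\<lambda>x. x)\<rparr>"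


section \<open>Thompson's group F\<close>

definition dyadic :: "real set" where
  "dyadic = {real_of_int m / 2 ^ k | m k. True}"

text \<open>\<open>P\<close> contains all breakpoints: \<open>f\<close> is affine on every closed subinterval whose interior
  avoids \<open>P\<close>.\<close>

definition thompson_F_maps :: "(real \<Rightarrow> real) set" where
  "thompson_F_maps = {f \<in> extensional {0..1}.
     (\<exists>g. homeomorphism {0..1} {0..1} f g) \<and> strict_mono_on {0..1} f \<and>
     (\<exists>P. finite P \<and> P \<subseteq> dyadic \<and>
       (\<forall>a b. 0 \<le> a \<and> a < b \<and> b \<le> 1 \<and> {a<..<b} \<inter> P = {} \<longrightarrow>
          (\<exists>k::int. \<forall>x\<in>{a..b}. f x = f a + 2 powi k * (x - a))))}"

text \<open>As above, maps act on the right.\<close>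

definition thompson_F :: "(real \<Rightarrow> real) monoid" where
  "thompson_F = \<lparr>carrier = thompson_F_maps, mult = (\<lambda>f g. compose {0..1} g f),
     one = (\<lambda>x\<in>{0..1}. x)\<rparr>"

end

theory Submission
  imports Defs
begin

text \<open>
  Replace the letters \<open>0, 1\<close> of the binary tree by the outermost letters \<open>0, n - 1\<close>: an element \<open>f\<close> of
  \<open>F\<close>, given by a pair of binary trees, becomes a pair of \<open>n\<close>-ary trees in which only outermost
  children are subdivided, hence an order preserving homeomorphism \<open>A\<^sub>f\<close> of the Cantor space. As
  \<open>n \<ge> 3\<close>, the letter \<open>1\<close> is not an outermost one, and there is a unique map \<open>h\<^sub>f\<close> with
  \<open>h\<^sub>f (j x) = j (h\<^sub>f x)\<close> for \<open>j \<noteq> 1\<close> and \<open>h\<^sub>f (1 x) = 1 (A\<^sub>f (h\<^sub>f x))\<close>. It commutes with all \<open>A\<^sub>g\<close>, so that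
  \<open>f \<mapsto> h\<^sub>f\<close> is a homomorphism. A transducer for \<open>h\<^sub>f\<close> forgets its past after reading as many letters as
  the first tree of \<open>f\<close> is deep, so \<open>h\<^sub>f\<close> acting below each root letter is in \<open>TB\<^sub>n\<^sub>,\<^sub>r\<close>; reading zeros leads
  back to the state of \<open>h\<^sub>f\<close>, so its core determines \<open>h\<^sub>f\<close>, and \<open>f\<close>.
\<close>

section \<open>Words and state maps\<close>

text \<open>Why commutation holds: \<open>act g\<close> rewrites only the outermost letters in front
  of the first inner letter of a point, while the lift, \<open>1\<close> being inner, changes only
  what follows that letter. The obstacle is the product of cores. \<open>core_mult\<close> chooses a
  composite transducer by \<open>SOME\<close>, and with it representatives and states, and no group
  law for cores is at hand. Classes of transducers are therefore handled through maps:
  \<open>core_class n \<phi>\<close> collects the cores with a state that induces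
  \<open>\<phi>\<close>, and it is a single class up to renaming as soon as it is nonempty. Whatever
  states were chosen, a long block of zeros brings both factors to their base maps up to fixed
  output words, because the lifts pass zeros through unchanged; cancelling the fixed words
  identifies the result. A second difficulty lies in the action itself: the outermost letters in
  front of an inner letter may be too few to give a cone of \<open>f\<close>. They are then treated
  as a node of the binary tree, and \<open>f\<close> moves nodes as it moves the midpoints of dyadic
  intervals.\<close>

declare build_cons [simp del] build_append [simp del]

lemma conc_in_cantor_iff [simp]: "w \<frown> x \<in> cantor n \<longleftrightarrow> w \<in> lists (alph n) \<and> x \<in> cantor n"
  by (auto simp: cantor_def)

lemma suffix_in_cantor [simp]: "x \<in> cantor n \<Longrightarrow> suffix k x \<in> cantor n"
  by (auto simp: cantor_def)

lemma prefix_in_lists_alph [simp]: "x \<in> cantor n \<Longrightarrow> prefix k x \<in> lists (alph n)"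
  by (auto simp: cantor_def subset_iff)

lemma Plain_in_alph_iff [simp]: "Plain j \<in> alph n \<longleftrightarrow> j < n"
  by (auto simp: alph_def)

lemma const_in_cantor [simp]: "(\<lambda>_. a) \<in> cantor n \<longleftrightarrow> a \<in> alph n"
  by (auto simp: cantor_def)

lemma conc_head_tail: "x = [x 0] \<frown> suffix 1 x"
  by (auto simp: fun_eq_iff conc_def)

section \<open>Prefixes and greatest common prefixes\<close>

lemma conc_compare:
  assumes "u \<frown> x = v \<frown> y" "length u \<le> length v"
  obtains t where "v = u @ t" "x = t \<frown> y"
proof -
  have "prefix (length u) (u \<frown> x) = prefix (length u) (v \<frown> y)"
    using assms by simp
  then have "u = take (length u) v"
    using assms(2) by simp
  then have v: "v = u @ drop (length u) v"
    by (metis append_take_drop_id)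
  then have "u \<frown> x = u \<frown> (drop (length u) v \<frown> y)"
    using assms(1) by (metis conc_conc)
  then have "x = drop (length u) v \<frown> y"
    unfolding same_concat_eq .
  with v show thesis
    by (rule that)
qed

lemma is_prefix_conc [simp]: "is_prefix u (u \<frown> x)"
  by (auto simp: is_prefix_def)

lemma is_prefix_prefix [simp]: "is_prefix (prefix k x) x"
  by (metis is_prefix_conc prefix_suffix)

lemma is_prefix_Nil [simp]: "is_prefix [] x"
  by (auto simp: is_prefix_def)

lemma is_prefix_iff: "is_prefix u x \<longleftrightarrow> prefix (length u) x = u"
  unfolding is_prefix_def by (metis prefix_conc_length prefix_suffix)

lemma is_prefixD: "is_prefix u x \<Longrightarrow> x = u \<frown> suffix (length u) x"
  by (metis is_prefix_def suffix_conc_length)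

lemma is_prefix_append_iff: "is_prefix (u @ v) (u \<frown> x) \<longleftrightarrow> is_prefix v x"
  unfolding is_prefix_def by (metis conc_conc same_concat_eq)

lemma is_prefix_appendD: "is_prefix (u @ v) x \<Longrightarrow> is_prefix u x"
  unfolding is_prefix_def by (metis conc_conc)

lemma is_prefix_linear:
  assumes "is_prefix u x" "is_prefix v x" "length u \<le> length v"
  obtains t where "v = u @ t"
  using assms conc_compare unfolding is_prefix_def by metis

lemma is_prefix_nth: "is_prefix u x \<Longrightarrow> i < length u \<Longrightarrow> x i = u ! i"
  by (auto simp: is_prefix_def)

lemma prefix_eqD: "prefix k x = prefix k y \<Longrightarrow> i < k \<Longrightarrow> x i = y i"
  by (auto simp: subsequence_def)

lemma prefix_eqI: "(\<And>i. i < k \<Longrightarrow> x i = y i) \<Longrightarrow> prefix k x = prefix k y"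
  by (auto simp: subsequence_def)

lemma prefix_eq_mono: "prefix k x = prefix k y \<Longrightarrow> j \<le> k \<Longrightarrow> prefix j x = prefix j y"
  by (rule prefix_eqI) (erule prefix_eqD, simp)

lemma is_gcp_unique:
  assumes "is_gcp u W" "is_gcp v W" "W \<noteq> {}"
  shows "u = v"
proof -
  have "length u = length v"
    using assms unfolding is_gcp_def by (meson le_antisym)
  moreover obtain x where "x \<in> W"
    using assms by auto
  ultimately show ?thesis
    using assms unfolding is_gcp_def by (metis is_prefix_iff)
qed

text \<open>Two distinct words of \<open>W\<close> bound the length of a common prefix by a position
  at which they differ, so a longest one exists.\<close>

lemma ex_is_gcp:
  assumes "x \<in> W" "y \<in> W" "x \<noteq> y"
  shows "\<exists>u. is_gcp u W"
proof -
  obtain i where i: "x i \<noteq> y i"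
    using assms by auto
  have "length v \<le> i" if "\<forall>x\<in>W. is_prefix v x" for v
    using that assms is_prefix_nth[of v x i] is_prefix_nth[of v y i] i by (metis linorder_not_le)
  then obtain u where u: "\<forall>x\<in>W. is_prefix u x"
      "\<And>v. \<forall>x\<in>W. is_prefix v x \<Longrightarrow> length v \<le> length u"
    using ex_has_greatest_nat[of "\<lambda>v. \<forall>x\<in>W. is_prefix v x" "[]" length "Suc i"]
    by (auto simp: less_Suc_eq_le)
  then show ?thesis
    unfolding is_gcp_def by blast
qed

lemma is_gcp_conc:
  assumes "is_gcp u W" "W \<noteq> {}"
  shows "is_gcp (v @ u) ((\<frown>) v ` W)"
  unfolding is_gcp_def
proof safe
  fix x assume "x \<in> W"
  then show "is_prefix (v @ u) (v \<frown> x)"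
    using assms by (simp add: is_gcp_def is_prefix_append_iff)
next
  fix t assume t: "\<forall>x\<in>(\<frown>) v ` W. is_prefix t x"
  show "length t \<le> length (v @ u)"
  proof (cases "length t \<le> length v")
    case False
    obtain x where "x \<in> W"
      using assms by auto
    with t have "is_prefix t (v \<frown> x)"
      by blast
    then obtain s where s: "t = v @ s"
      using False is_prefix_linear[of v "v \<frown> x" t] by (metis is_prefix_conc nle_le)
    then have "\<forall>x\<in>W. is_prefix s x"
      using t by (auto simp: is_prefix_append_iff)
    then show ?thesis
      using assms s by (auto simp: is_gcp_def)
  qed simp
qed

text \<open>A normal form for residual maps: by \<open>no_common_prefix_cancel\<close> a map splits
  in at most one way into a fixed word followed by such a map. The comparisons of states with
  prescribed maps rest on this.\<close>

definition no_common_prefix :: "nat \<Rightarrow> (letter word \<Rightarrow> letter word) \<Rightarrow> bool" where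
  "no_common_prefix n \<psi> \<longleftrightarrow> (\<forall>v. (\<forall>x\<in>cantor n. is_prefix v (\<psi> x)) \<longrightarrow> v = [])"

text \<open>Otherwise the part of \<open>u\<close> beyond \<open>v\<close> would be a common prefix
  of the values of \<open>\<psi>\<close>.\<close>

lemma no_common_prefix_length:
  assumes "no_common_prefix n \<psi>" "x0 \<in> cantor n" "\<And>x. x \<in> cantor n \<Longrightarrow> v \<frown> \<psi> x = u \<frown> \<eta> x"
  shows "length u \<le> length v"
proof (rule ccontr)
  assume n: "\<not> ?thesis"
  have "is_prefix (drop (length v) u) (\<psi> x)" if x: "x \<in> cantor n" for x
  proof -
    obtain t where "u = v @ t" "\<psi> x = t \<frown> \<eta> x"
    proof (rule conc_compare[OF assms(3)[OF x]])
      show "length v \<le> length u"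
        using n by simp
    qed
    then show ?thesis by simp
  qed
  then have "drop (length v) u = []"
    using assms(1) unfolding no_common_prefix_def by blast
  with n show False by simp
qed

lemma no_common_prefix_cancel:
  assumes "no_common_prefix n \<psi>" "no_common_prefix n \<eta>" "x0 \<in> cantor n"
    and eq: "\<And>x. x \<in> cantor n \<Longrightarrow> v \<frown> \<psi> x = u \<frown> \<eta> x"
  shows "u = v" and "\<And>x. x \<in> cantor n \<Longrightarrow> \<psi> x = \<eta> x"
proof -
  have "length u = length v"
    using no_common_prefix_length[OF assms(1,3), of v u \<eta>] no_common_prefix_length[OF assms(2,3), of u v \<psi>] eq
    by (metis le_antisym)
  then show "u = v" "\<And>x. x \<in> cantor n \<Longrightarrow> \<psi> x = \<eta> x"
    using eq assms(3) by (metis concat_eq)+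
qed

section \<open>Runs, outputs and limit words\<close>

lemma trans_word_Nil [simp]: "trans_word A [] q = q"
  by (simp add: trans_word_def)

lemma trans_word_Cons [simp]: "trans_word A (i # w) q = trans_word A w (ttrans A i q)"
  by (simp add: trans_word_def)

lemma trans_word_append [simp]: "trans_word A (u @ v) q = trans_word A v (trans_word A u q)"
  by (simp add: trans_word_def)

lemma out_word_append: "out_word A (u @ v) q = out_word A u q @ out_word A v (trans_word A u q)"
  by (induction u arbitrary: q) simp_all

lemma out_word_prefix_mono:
  "k \<le> l \<Longrightarrow> \<exists>t. out_word A (prefix l x) q = out_word A (prefix k x) q @ t"
  by (metis le_add_diff_inverse out_word_append subsequence_append)

text \<open>The limit word: its letter at \<open>i\<close> is read off any output longer than \<open>i\<close>.\<close>

lemma ex1_state_map: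
  assumes "infinite_output A q x"
  shows "\<exists>!y. \<forall>k. is_prefix (out_word A (prefix k x) q) y"
proof -
  let ?o = "\<lambda>k. out_word A (prefix k x) q"
  obtain K where K: "\<And>m. m \<le> length (?o (K m))"
    using assms unfolding infinite_output_def by metis
  have nth: "?o k ! i = ?o l ! i" if "i < length (?o k)" "i < length (?o l)" for k l i
    using out_word_prefix_mono[of k l A x q] out_word_prefix_mono[of l k A x q] that
    by (metis nle_le nth_append)
  define y where "y i = ?o (K (Suc i)) ! i" for i
  have y: "is_prefix (?o k) y" for k
    unfolding is_prefix_iff
  proof (rule nth_equalityI)
    fix i assume "i < length (prefix (length (?o k)) y)"
    then show "prefix (length (?o k)) y ! i = ?o k ! i"
      using nth[of i k "K (Suc i)"] K[of "Suc i"] by (auto simp: y_def)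
  qed simp
  moreover have "z = y" if "\<forall>k. is_prefix (?o k) z" for z
  proof
    fix i
    show "z i = y i"
      using is_prefix_nth[of "?o (K (Suc i))"] that y K[of "Suc i"] by (metis Suc_le_lessD)
  qed
  ultimately show ?thesis by blast
qed

lemma is_prefix_state_map:
  "infinite_output A q x \<Longrightarrow> is_prefix (out_word A (prefix k x) q) (state_map A q x)"
  unfolding state_map_def using theI'[OF ex1_state_map, of A q x] by blast

lemma state_map_eqI:
  assumes "infinite_output A q x" "\<And>k. is_prefix (out_word A (prefix k x) q) y"
  shows "state_map A q x = y"
  using ex1_state_map[OF assms(1)] is_prefix_state_map[OF assms(1)] assms(2) by blast

lemma infinite_output_conc:
  assumes "infinite_output A (trans_word A w q) x"
  shows "infinite_output A q (w \<frown> x)"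
  unfolding infinite_output_def
proof
  fix m
  obtain k where "m \<le> length (out_word A (prefix k x) (trans_word A w q))"
    using assms infinite_output_def by metis
  then have "m \<le> length (out_word A (prefix (length w + k) (w \<frown> x)) q)"
    by (simp add: out_word_append)
  then show "\<exists>k. m \<le> length (out_word A (prefix k (w \<frown> x)) q)" ..
qed

lemma state_map_conc:
  assumes "infinite_output A (trans_word A w q) x"
  shows "state_map A q (w \<frown> x) = out_word A w q \<frown> state_map A (trans_word A w q) x"
proof (rule state_map_eqI[OF infinite_output_conc[OF assms]])
  fix k
  have "is_prefix (out_word A (prefix (length w + k) (w \<frown> x)) q)
          (out_word A w q \<frown> state_map A (trans_word A w q) x)"
    by (simp add: out_word_append is_prefix_append_iff is_prefix_state_map[OF assms])
  moreover obtain t where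
    "out_word A (prefix (length w + k) (w \<frown> x)) q = out_word A (prefix k (w \<frown> x)) q @ t"
    using out_word_prefix_mono[of k "length w + k" A "w \<frown> x" q] by auto
  ultimately show "is_prefix (out_word A (prefix k (w \<frown> x)) q)
          (out_word A w q \<frown> state_map A (trans_word A w q) x)"
    by (metis is_prefix_appendD)
qed

lemma out_word_cong:
  "ttrans A = ttrans B \<Longrightarrow> tout A = tout B \<Longrightarrow> out_word A w q = out_word B w q"
  by (induction w arbitrary: q) auto

text \<open>Passing to a core changes the state set only, and none of these notions looks at
  it.\<close>

lemma transducer_cong:
  assumes "ttrans A = ttrans B" "tout A = tout B"
  shows "trans_word A = trans_word B" "out_word A = out_word B"
    "state_map A = state_map B" "infinite_output A = infinite_output B"
proof -
  show "trans_word A = trans_word B"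
    using assms by (intro ext) (simp add: trans_word_def)
  show o: "out_word A = out_word B"
    using out_word_cong[OF assms] by (auto simp: fun_eq_iff)
  show "state_map A = state_map B" "infinite_output A = infinite_output B"
    by (auto simp: fun_eq_iff state_map_def infinite_output_def o)
qed

text \<open>The common part of plain transducers and of the states outside \<open>R\<close> of rooted ones.\<close>

definition closed_states :: "nat \<Rightarrow> ('q, 'm) transducer_scheme \<Rightarrow> 'q set \<Rightarrow> bool" where
  "closed_states n A S \<longleftrightarrow>
     (\<forall>q\<in>S. \<forall>i\<in>alph n. ttrans A i q \<in> S \<and> tout A i q \<in> lists (alph n)) \<and>
     (\<forall>q\<in>S. \<forall>\<delta>\<in>cantor n. infinite_output A q \<delta>)"

lemma is_transducer_iff: "is_transducer n A \<longleftrightarrow> closed_states n A (tstates A)"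
  by (simp add: is_transducer_def closed_states_def)

lemma closed_statesD:
  assumes "closed_states n A S" "q \<in> S"
  shows "x \<in> cantor n \<Longrightarrow> infinite_output A q x"
    and "i \<in> alph n \<Longrightarrow> ttrans A i q \<in> S"
    and "i \<in> alph n \<Longrightarrow> tout A i q \<in> lists (alph n)"
    and trans_word_closed: "w \<in> lists (alph n) \<Longrightarrow> trans_word A w q \<in> S"
proof -
  show "w \<in> lists (alph n) \<Longrightarrow> trans_word A w q \<in> S"
    by (induction w rule: rev_induct) (use assms in \<open>auto simp: closed_states_def\<close>)
qed (use assms in \<open>auto simp: closed_states_def\<close>)

lemma out_word_in_lists:
  assumes "closed_states n A S" "q \<in> S" "w \<in> lists (alph n)"
  shows "out_word A w q \<in> lists (alph n)"
  using assms(2,3)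
  by (induction w arbitrary: q) (use assms(1) in \<open>auto simp: closed_states_def\<close>)

lemma state_map_conc_closed:
  assumes "closed_states n A S" "q \<in> S" "w \<in> lists (alph n)" "x \<in> cantor n"
  shows "state_map A q (w \<frown> x) = out_word A w q \<frown> state_map A (trans_word A w q) x"
  using assms by (meson state_map_conc closed_statesD)

lemma state_map_in_cantor:
  assumes "closed_states n A S" "q \<in> S" "x \<in> cantor n"
  shows "state_map A q x \<in> cantor n"
proof -
  have inf: "infinite_output A q x"
    using assms closed_statesD by metis
  have "state_map A q x i \<in> alph n" for i
  proof -
    obtain k where k: "Suc i \<le> length (out_word A (prefix k x) q)"
      using inf infinite_output_def by metis
    then have "state_map A q x i = out_word A (prefix k x) q ! i"
      using is_prefix_nth[OF is_prefix_state_map[OF inf, of k], of i] by simp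
    then show ?thesis
      using k out_word_in_lists[OF assms(1,2), of "prefix k x"] assms(3)
      by (metis Suc_le_lessD in_lists_conv_set nth_mem prefix_in_lists_alph)
  qed
  then show ?thesis
    by (auto simp: cantor_def)
qed

text \<open>With greatest common prefixes as outputs, the map of a state determines what is emitted
  on a letter and, after cancelling it, the map of the next state.\<close>

lemma step_unique:
  assumes "is_gcp (tout A i q) {state_map A q ([i] \<frown> \<delta>) | \<delta>. \<delta> \<in> cantor n}"
    and "is_gcp (tout B i p) {state_map B p ([i] \<frown> \<delta>) | \<delta>. \<delta> \<in> cantor n}"
    and eq: "\<And>\<delta>. \<delta> \<in> cantor n \<Longrightarrow> state_map A q ([i] \<frown> \<delta>) = state_map B p ([i] \<frown> \<delta>)"
    and A: "\<And>\<delta>. \<delta> \<in> cantor n \<Longrightarrow> infinite_output A (ttrans A i q) \<delta>"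
    and B: "\<And>\<delta>. \<delta> \<in> cantor n \<Longrightarrow> infinite_output B (ttrans B i p) \<delta>"
    and "x0 \<in> cantor n"
  shows "tout A i q = tout B i p"
    and "\<And>\<delta>. \<delta> \<in> cantor n \<Longrightarrow> state_map A (ttrans A i q) \<delta> = state_map B (ttrans B i p) \<delta>"
proof -
  have "{state_map A q ([i] \<frown> \<delta>) | \<delta>. \<delta> \<in> cantor n} = {state_map B p ([i] \<frown> \<delta>) | \<delta>. \<delta> \<in> cantor n}"
    unfolding Setcompr_eq_image using eq by (intro image_cong) simp_all
  then show *: "tout A i q = tout B i p"
    using assms(1,2,6) by (intro is_gcp_unique[of _ "{state_map A q ([i] \<frown> \<delta>) | \<delta>. \<delta> \<in> cantor n}"]) auto
  fix \<delta> assume d: "\<delta> \<in> cantor n"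
  show "state_map A (ttrans A i q) \<delta> = state_map B (ttrans B i p) \<delta>"
    using eq[OF d] state_map_conc[of A "[i]" q \<delta>] state_map_conc[of B "[i]" p \<delta>] A[OF d] B[OF d] *
    by simp
qed

text \<open>A common prefix remaining after the transition would lengthen the greatest common prefix
  emitted by it.\<close>

lemma no_common_prefix_target:
  assumes "is_gcp (tout A i q) {state_map A q ([i] \<frown> \<delta>) | \<delta>. \<delta> \<in> cantor n}"
    and A: "\<And>\<delta>. \<delta> \<in> cantor n \<Longrightarrow> infinite_output A (ttrans A i q) \<delta>"
  shows "no_common_prefix n (state_map A (ttrans A i q))"
  unfolding no_common_prefix_def
proof safe
  fix v assume v: "\<forall>x\<in>cantor n. is_prefix v (state_map A (ttrans A i q) x)"
  have "\<forall>x\<in>{state_map A q ([i] \<frown> \<delta>) | \<delta>. \<delta> \<in> cantor n}. is_prefix (tout A i q @ v) x"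
    using v state_map_conc[of A "[i]" q] A by (auto simp: is_prefix_append_iff)
  then have "length (tout A i q @ v) \<le> length (tout A i q)"
    using assms(1) unfolding is_gcp_def by blast
  then show "v = []" by simp
qed

section \<open>Existence of minimal transducers\<close>

text \<open>The state set is a separate argument so that the notion covers both plain transducers
  and the states of a rooted one outside \<open>rpre\<close>.\<close>

definition reduced_on :: "nat \<Rightarrow> ('q, 'm) transducer_scheme \<Rightarrow> 'q set \<Rightarrow> bool" where
  "reduced_on n A S \<longleftrightarrow>
     (\<forall>q\<in>S. \<forall>p\<in>S. q \<noteq> p \<longrightarrow> (\<exists>\<delta>\<in>cantor n. state_map A q \<delta> \<noteq> state_map A p \<delta>))"

definition gcp_outputs_on :: "nat \<Rightarrow> ('q, 'm) transducer_scheme \<Rightarrow> 'q set \<Rightarrow> bool" where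
  "gcp_outputs_on n A S \<longleftrightarrow>
     (\<forall>q\<in>S. \<forall>i\<in>alph n. is_gcp (tout A i q) {state_map A q ([i] \<frown> \<delta>) | \<delta>. \<delta> \<in> cantor n})"

lemma minimal_iff:
  "minimal n A q0 \<longleftrightarrow> is_transducer n A \<and> q0 \<in> tstates A \<and>
     (\<forall>q\<in>tstates A. \<exists>w\<in>lists (alph n). trans_word A w q0 = q) \<and>
     reduced_on n A (tstates A) \<and> gcp_outputs_on n A (tstates A)"
  by (simp add: minimal_def reduced_on_def gcp_outputs_on_def)

section \<open>Morphisms of transducers\<close>

definition tmorph :: "nat \<Rightarrow> ('p \<Rightarrow> 'q) \<Rightarrow> 'p transducer \<Rightarrow> 'q transducer \<Rightarrow> bool" where
  "tmorph n f A B \<longleftrightarrow> (\<forall>q\<in>tstates A. \<forall>i\<in>alph n.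
     f (ttrans A i q) = ttrans B i (f q) \<and> tout A i q = tout B i (f q))"

lemma transducer_iso_alt:
  "transducer_iso n A B \<longleftrightarrow> (\<exists>f. bij_betw f (tstates A) (tstates B) \<and> tmorph n f A B)"
  by (simp add: transducer_iso_def tmorph_def)

lemma tmorph_word:
  assumes "tmorph n f A B" "closed_states n A (tstates A)" "q \<in> tstates A" "w \<in> lists (alph n)"
  shows "trans_word B w (f q) = f (trans_word A w q)" "out_word B w (f q) = out_word A w q"
  using assms(3,4)
proof (induction w arbitrary: q)
  case (Cons i w)
  {
    case 1
    then show ?case
      using Cons.IH(1)[of "ttrans A i q"] assms(1,2) closed_statesD(2)[OF assms(2), of q i]
      by (simp add: tmorph_def)
  next
    case 2
    then show ?case
      using Cons.IH(2)[of "ttrans A i q"] assms(1,2) closed_statesD(2)[OF assms(2), of q i]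
      by (simp add: tmorph_def)
  }
qed auto

lemma tmorph_state_map:
  assumes "tmorph n f A B" "closed_states n A (tstates A)" "q \<in> tstates A" "x \<in> cantor n"
  shows "state_map B (f q) x = state_map A q x" "infinite_output B (f q) x"
proof -
  have *: "out_word B (prefix k x) (f q) = out_word A (prefix k x) q" for k
    using tmorph_word(2)[OF assms(1-3)] assms(4) by simp
  show "state_map B (f q) x = state_map A q x"
    by (simp add: state_map_def *)
  show "infinite_output B (f q) x"
    using closed_statesD(1)[OF assms(2,3,4)] by (simp add: infinite_output_def *)
qed

lemma tmorph_gcp_set:
  assumes "tmorph n f A B" "closed_states n A (tstates A)" "q \<in> tstates A" "i \<in> alph n"
  shows "{state_map B (f q) ([i] \<frown> \<delta>) | \<delta>. \<delta> \<in> cantor n} = {state_map A q ([i] \<frown> \<delta>) | \<delta>. \<delta> \<in> cantor n}"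
  unfolding Setcompr_eq_image
  using tmorph_state_map(1)[OF assms(1-3)] assms(4) by (intro image_cong) simp_all

lemma tmorph_is_transducer:
  assumes f: "tmorph n f A B" "f ` tstates A = tstates B" and A: "is_transducer n A"
  shows "is_transducer n B"
proof -
  have c: "closed_states n A (tstates A)"
    using A by (simp add: is_transducer_iff)
  show ?thesis
    unfolding is_transducer_def f(2)[symmetric]
    using f(1) closed_statesD[OF c] tmorph_state_map(2)[OF f(1) c]
    by (auto simp: tmorph_def) (metis imageI)+
qed

lemma tmorph_reduced:
  assumes f: "tmorph n f A B" "f ` tstates A = tstates B" and A: "is_transducer n A"
    and red: "reduced_on n A (tstates A)"
  shows "reduced_on n B (tstates B)"
proof -
  have c: "closed_states n A (tstates A)"
    using A by (simp add: is_transducer_iff)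
  show ?thesis
    unfolding f(2)[symmetric] reduced_on_def
  proof safe
    fix q p assume "q \<in> tstates A" "p \<in> tstates A" "f q \<noteq> f p"
    then show "\<exists>\<delta>\<in>cantor n. state_map B (f q) \<delta> \<noteq> state_map B (f p) \<delta>"
      using red[unfolded reduced_on_def] tmorph_state_map(1)[OF f(1) c] by metis
  qed
qed

lemma tmorph_gcp:
  assumes f: "tmorph n f A B" "f ` tstates A = tstates B" and A: "is_transducer n A"
    and gcp: "gcp_outputs_on n A (tstates A)"
  shows "gcp_outputs_on n B (tstates B)"
proof -
  have c: "closed_states n A (tstates A)"
    using A by (simp add: is_transducer_iff)
  show ?thesis
    unfolding f(2)[symmetric] gcp_outputs_on_def
  proof safe
    fix q i assume q: "q \<in> tstates A" "i \<in> alph n"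
    then have "tout B i (f q) = tout A i q"
      using f(1) by (simp add: tmorph_def)
    then show "is_gcp (tout B i (f q)) {state_map B (f q) ([i] \<frown> \<delta>) | \<delta>. \<delta> \<in> cantor n}"
      using gcp q tmorph_gcp_set[OF f(1) c q] by (simp add: gcp_outputs_on_def)
  qed
qed

lemma tmorph_minimal:
  assumes f: "tmorph n f A B" "f ` tstates A = tstates B" and A: "minimal n A q0"
  shows "minimal n B (f q0)"
proof -
  have t: "is_transducer n A" and q0: "q0 \<in> tstates A"
    using A by (auto simp: minimal_def)
  then have c: "closed_states n A (tstates A)"
    by (simp add: is_transducer_iff)
  have "\<exists>w\<in>lists (alph n). trans_word B w (f q0) = q" if q: "q \<in> tstates B" for q
  proof -
    obtain p where p: "p \<in> tstates A" "q = f p"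
      using q f(2) by auto
    then obtain w where "w \<in> lists (alph n)" "trans_word A w q0 = p"
      using A unfolding minimal_def by blast
    then show ?thesis
      using tmorph_word(1)[OF f(1) c q0] p by auto
  qed
  moreover have "f q0 \<in> tstates B"
    using f(2) q0 by auto
  ultimately show ?thesis
    using tmorph_is_transducer[OF f t] tmorph_reduced[OF f t] tmorph_gcp[OF f t] A
    by (simp add: minimal_iff)
qed

section \<open>Continuity of state maps\<close>

definition cantor_continuous :: "nat \<Rightarrow> (letter word \<Rightarrow> letter word) \<Rightarrow> bool" where
  "cantor_continuous n \<psi> \<longleftrightarrow> (\<forall>x\<in>cantor n. \<forall>m. \<exists>k. \<forall>y\<in>cantor n.
     prefix k y = prefix k x \<longrightarrow> prefix m (\<psi> y) = prefix m (\<psi> x))"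

lemma state_map_continuous:
  assumes "closed_states n A S" "q \<in> S"
  shows "cantor_continuous n (state_map A q)"
  unfolding cantor_continuous_def
proof (intro ballI allI)
  fix x m assume x: "x \<in> cantor n"
  obtain k where k: "m \<le> length (out_word A (prefix k x) q)"
    using closed_statesD(1)[OF assms x] infinite_output_def by metis
  have "prefix m (state_map A q y) = prefix m (state_map A q x)"
    if "y \<in> cantor n" "prefix k y = prefix k x" for y
  proof (rule prefix_eqI)
    fix i assume "i < m"
    then show "state_map A q y i = state_map A q x i"
      using is_prefix_nth[OF is_prefix_state_map[OF closed_statesD(1)[OF assms x], of k], of i]
        is_prefix_nth[OF is_prefix_state_map[OF closed_statesD(1)[OF assms that(1)], of k], of i] k that(2)
      by simp
  qed
  then show "\<exists>k. \<forall>y\<in>cantor n. prefix k y = prefix k x \<longrightarrow> prefix m (state_map A q y) = prefix m (state_map A q x)"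
    by blast
qed

lemma cantor_continuous_comp:
  assumes "cantor_continuous n \<phi>" "cantor_continuous n \<psi>" "\<And>x. x \<in> cantor n \<Longrightarrow> \<phi> x \<in> cantor n"
  shows "cantor_continuous n (\<lambda>x. \<psi> (\<phi> x))"
  unfolding cantor_continuous_def
proof (intro ballI allI)
  fix x m assume x: "x \<in> cantor n"
  obtain l where l: "\<And>y. y \<in> cantor n \<Longrightarrow> prefix l y = prefix l (\<phi> x) \<Longrightarrow> prefix m (\<psi> y) = prefix m (\<psi> (\<phi> x))"
    using assms(2,3) x unfolding cantor_continuous_def by metis
  obtain k where "\<And>y. y \<in> cantor n \<Longrightarrow> prefix k y = prefix k x \<Longrightarrow> prefix l (\<phi> y) = prefix l (\<phi> x)"
    using assms(1) x unfolding cantor_continuous_def by metis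
  then show "\<exists>k. \<forall>y\<in>cantor n. prefix k y = prefix k x \<longrightarrow> prefix m (\<psi> (\<phi> y)) = prefix m (\<psi> (\<phi> x))"
    using l assms(3) by metis
qed

text \<open>The minimal transducer of a map: its states are the derivatives of the map, a letter being
  processed by emitting the greatest common prefix of the images and removing it.\<close>

definition dout :: "nat \<Rightarrow> letter \<Rightarrow> (letter word \<Rightarrow> letter word) \<Rightarrow> letter list" where
  "dout n i \<psi> = (SOME u. is_gcp u {\<psi> ([i] \<frown> \<delta>) | \<delta>. \<delta> \<in> cantor n})"

definition dtrans :: "nat \<Rightarrow> letter \<Rightarrow> (letter word \<Rightarrow> letter word) \<Rightarrow> (letter word \<Rightarrow> letter word)" where
  "dtrans n i \<psi> = (\<lambda>\<delta>\<in>cantor n. suffix (length (dout n i \<psi>)) (\<psi> ([i] \<frown> \<delta>)))"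

definition derivative_transducer ::
    "nat \<Rightarrow> (letter word \<Rightarrow> letter word) \<Rightarrow> (letter word \<Rightarrow> letter word) transducer" where
  "derivative_transducer n \<phi> = \<lparr>tstates = {fold (dtrans n) w \<phi> | w. w \<in> lists (alph n)},
     ttrans = dtrans n, tout = dout n\<rparr>"

text \<open>The maps themselves serve as states; being extensional, distinct ones differ at a point
  of the Cantor space. Injectivity provides greatest common prefixes, continuity provides infinite
  output.\<close>

definition cantor_embeddings :: "nat \<Rightarrow> (letter word \<Rightarrow> letter word) set" where
  "cantor_embeddings n = {\<psi> \<in> extensional (cantor n). \<psi> ` cantor n \<subseteq> cantor n \<and>
     inj_on \<psi> (cantor n) \<and> cantor_continuous n \<psi>}"

lemma two_points:
  assumes "2 \<le> n"
  shows "(\<lambda>_. Plain 0) \<in> cantor n" "(\<lambda>_. Plain 1) \<in> cantor n" "(\<lambda>_::nat. Plain 0) \<noteq> (\<lambda>_. Plain 1)"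
  using assms by (auto dest: fun_cong[of _ _ 0])

lemma dout_is_gcp:
  assumes "2 \<le> n" "inj_on \<psi> (cantor n)" "i \<in> alph n"
  shows "is_gcp (dout n i \<psi>) {\<psi> ([i] \<frown> \<delta>) | \<delta>. \<delta> \<in> cantor n}"
  unfolding dout_def
proof (rule someI_ex, rule ex_is_gcp)
  show "\<psi> ([i] \<frown> (\<lambda>_. Plain 0)) \<in> {\<psi> ([i] \<frown> \<delta>) | \<delta>. \<delta> \<in> cantor n}"
    "\<psi> ([i] \<frown> (\<lambda>_. Plain 1)) \<in> {\<psi> ([i] \<frown> \<delta>) | \<delta>. \<delta> \<in> cantor n}"
    using two_points[OF assms(1)] by blast+
  show "\<psi> ([i] \<frown> (\<lambda>_. Plain 0)) \<noteq> \<psi> ([i] \<frown> (\<lambda>_. Plain 1))"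
    using two_points[OF assms(1)] assms(2,3) by (simp add: inj_on_eq_iff)
qed

lemma dtrans_eq:
  assumes "2 \<le> n" "inj_on \<psi> (cantor n)" "i \<in> alph n" "\<delta> \<in> cantor n"
  shows "\<psi> ([i] \<frown> \<delta>) = dout n i \<psi> \<frown> dtrans n i \<psi> \<delta>"
proof -
  have "is_prefix (dout n i \<psi>) (\<psi> ([i] \<frown> \<delta>))"
    using dout_is_gcp[OF assms(1-3)] assms(4) unfolding is_gcp_def by blast
  then show ?thesis
    using assms(4) by (simp add: dtrans_def flip: is_prefixD)
qed

lemma dtrans_embedding:
  assumes n: "2 \<le> n" and psi: "\<psi> \<in> cantor_embeddings n" and i: "i \<in> alph n"
  shows "dtrans n i \<psi> \<in> cantor_embeddings n" "dout n i \<psi> \<in> lists (alph n)"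
proof -
  have inj: "inj_on \<psi> (cantor n)" and ran: "\<And>x. x \<in> cantor n \<Longrightarrow> \<psi> x \<in> cantor n"
    and cont: "cantor_continuous n \<psi>"
    using psi by (auto simp: cantor_embeddings_def)
  note eq = dtrans_eq[OF n inj i]
  have *: "dout n i \<psi> \<frown> dtrans n i \<psi> x \<in> cantor n" if "x \<in> cantor n" for x
    using ran[of "[i] \<frown> x"] eq[OF that] i that by simp
  then show "dout n i \<psi> \<in> lists (alph n)"
    using two_points(1)[OF n] conc_in_cantor_iff by blast
  have "dtrans n i \<psi> \<in> extensional (cantor n)"
    by (simp add: dtrans_def)
  moreover have "dtrans n i \<psi> ` cantor n \<subseteq> cantor n"
    using * by auto
  moreover have "inj_on (dtrans n i \<psi>) (cantor n)"
  proof (rule inj_onI)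
    fix x y assume xy: "x \<in> cantor n" "y \<in> cantor n" "dtrans n i \<psi> x = dtrans n i \<psi> y"
    then have "\<psi> ([i] \<frown> x) = \<psi> ([i] \<frown> y)"
      using eq by simp
    then have "[i] \<frown> x = [i] \<frown> y"
      using inj xy i by (simp add: inj_on_eq_iff)
    then show "x = y" by simp
  qed
  moreover have "cantor_continuous n (dtrans n i \<psi>)"
    unfolding cantor_continuous_def
  proof (intro ballI allI)
    fix x m assume x: "x \<in> cantor n"
    let ?l = "length (dout n i \<psi>)"
    obtain k where k: "\<And>y. y \<in> cantor n \<Longrightarrow> prefix k y = prefix k ([i] \<frown> x) \<Longrightarrow>
        prefix (?l + m) (\<psi> y) = prefix (?l + m) (\<psi> ([i] \<frown> x))"
      using cont x i unfolding cantor_continuous_def by (metis conc_in_cantor_iff lists.simps)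
    have "prefix m (dtrans n i \<psi> y) = prefix m (dtrans n i \<psi> x)"
      if "y \<in> cantor n" "prefix (Suc k) y = prefix (Suc k) x" for y
    proof -
      have "prefix k ([i] \<frown> y) = prefix k ([i] \<frown> x)"
      proof (rule prefix_eqI)
        fix j assume "j < k"
        then show "([i] \<frown> y) j = ([i] \<frown> x) j"
          using prefix_eqD[OF that(2), of "j - 1"] by (cases j) auto
      qed
      then have "prefix (?l + m) (\<psi> ([i] \<frown> y)) = prefix (?l + m) (\<psi> ([i] \<frown> x))"
        using k that i by simp
      then show ?thesis
        using eq x that(1) by simp
    qed
    then show "\<exists>k. \<forall>y\<in>cantor n. prefix k y = prefix k x \<longrightarrow>
        prefix m (dtrans n i \<psi> y) = prefix m (dtrans n i \<psi> x)"
      by blast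
  qed
  ultimately show "dtrans n i \<psi> \<in> cantor_embeddings n"
    by (simp add: cantor_embeddings_def)
qed

context
  fixes n :: nat and A :: "(letter word \<Rightarrow> letter word) transducer"
  assumes n2: "2 \<le> n" and A: "ttrans A = dtrans n" "tout A = dout n"
begin

lemma derivative_trans_word:
  "\<psi> \<in> cantor_embeddings n \<Longrightarrow> w \<in> lists (alph n) \<Longrightarrow> trans_word A w \<psi> \<in> cantor_embeddings n"
  by (induction w arbitrary: \<psi>) (auto simp: A dtrans_embedding[OF n2])

lemma derivative_out_word_eq:
  "\<psi> \<in> cantor_embeddings n \<Longrightarrow> w \<in> lists (alph n) \<Longrightarrow> x \<in> cantor n \<Longrightarrow>
    \<psi> (w \<frown> x) = out_word A w \<psi> \<frown> trans_word A w \<psi> x"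
proof (induction w arbitrary: \<psi>)
  case (Cons i w)
  have "\<psi> ((i # w) \<frown> x) = dout n i \<psi> \<frown> dtrans n i \<psi> (w \<frown> x)"
    using dtrans_eq[OF n2, of \<psi> i "w \<frown> x"] Cons.prems
    by (simp add: cantor_embeddings_def)
  also have "\<dots> = dout n i \<psi> \<frown> (out_word A w (dtrans n i \<psi>) \<frown> trans_word A w (dtrans n i \<psi>) x)"
    using Cons.IH[of "dtrans n i \<psi>"] Cons.prems dtrans_embedding[OF n2] by simp
  finally show ?case by (simp add: A)
qed simp

text \<open>Only the last letter matters: what was emitted before is a fixed word in front, which
  merely shifts the greatest common prefix. The empty word is excluded because nothing has been
  stripped from \<open>\<psi>\<close> itself.\<close>

lemma derivative_out_word_gcp:
  assumes "\<psi> \<in> cantor_embeddings n" "w \<in> lists (alph n)" "w \<noteq> []"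
  shows "is_gcp (out_word A w \<psi>) {\<psi> (w \<frown> x) | x. x \<in> cantor n}"
proof -
  obtain u i where w: "w = u @ [i]"
    using assms(3) by (metis append_butlast_last_id)
  let ?\<eta> = "trans_word A u \<psi>"
  have eta: "?\<eta> \<in> cantor_embeddings n"
    using assms w derivative_trans_word by simp
  have "is_gcp (dout n i ?\<eta>) {?\<eta> ([i] \<frown> \<delta>) | \<delta>. \<delta> \<in> cantor n}"
    using dout_is_gcp[OF n2, of ?\<eta> i] eta assms w by (simp add: cantor_embeddings_def)
  then have "is_gcp (out_word A u \<psi> @ dout n i ?\<eta>)
      ((\<frown>) (out_word A u \<psi>) ` {?\<eta> ([i] \<frown> \<delta>) | \<delta>. \<delta> \<in> cantor n})"
    by (rule is_gcp_conc) (use two_points(1)[OF n2] in blast)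
  moreover have "(\<frown>) (out_word A u \<psi>) ` {?\<eta> ([i] \<frown> \<delta>) | \<delta>. \<delta> \<in> cantor n}
      = {\<psi> (w \<frown> x) | x. x \<in> cantor n}"
  proof -
    have "\<psi> (w \<frown> x) = out_word A u \<psi> \<frown> ?\<eta> ([i] \<frown> x)" if "x \<in> cantor n" for x
      using derivative_out_word_eq[OF assms(1), of u "[i] \<frown> x"] assms(2) w that by simp
    then show ?thesis
      unfolding Setcompr_eq_image image_image by (intro image_cong) auto
  qed
  ultimately show ?thesis
    by (simp add: w out_word_append A)
qed

lemma derivative_state_map:
  assumes psi: "\<psi> \<in> cantor_embeddings n" and x: "x \<in> cantor n"
  shows "infinite_output A \<psi> x" "state_map A \<psi> x = \<psi> x"
proof -
  show inf: "infinite_output A \<psi> x"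
    unfolding infinite_output_def
  proof
    fix m
    obtain k where k: "\<And>y. y \<in> cantor n \<Longrightarrow> prefix k y = prefix k x \<Longrightarrow> prefix m (\<psi> y) = prefix m (\<psi> x)"
      using psi x unfolding cantor_embeddings_def cantor_continuous_def by blast
    \<comment> \<open>One letter more than continuity asks for, so that the word is nonempty and
      \<open>derivative_out_word_gcp\<close> applies.\<close>
    let ?w = "prefix (Suc k) x"
    have "is_prefix (prefix m (\<psi> x)) y" if y: "y \<in> {\<psi> (?w \<frown> z) | z. z \<in> cantor n}" for y
    proof -
      obtain z where z: "z \<in> cantor n" "y = \<psi> (?w \<frown> z)"
        using y by blast
      have "prefix k (?w \<frown> z) = prefix k x"
        by (simp del: subseq_to_Suc)
      then have "prefix m y = prefix m (\<psi> x)"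
        using k[of "?w \<frown> z"] z x prefix_in_lists_alph[OF x, of "Suc k"] by simp
      then show ?thesis
        by (metis is_prefix_prefix)
    qed
    moreover have "is_gcp (out_word A ?w \<psi>) {\<psi> (?w \<frown> z) | z. z \<in> cantor n}"
      using derivative_out_word_gcp[OF psi prefix_in_lists_alph[OF x, of "Suc k"]] by simp
    ultimately have "length (prefix m (\<psi> x)) \<le> length (out_word A ?w \<psi>)"
      unfolding is_gcp_def by blast
    then show "\<exists>k. m \<le> length (out_word A (prefix k x) \<psi>)"
      by (metis subsequence_length minus_nat.diff_0)
  qed
  show "state_map A \<psi> x = \<psi> x"
  proof (rule state_map_eqI[OF inf])
    fix k
    show "is_prefix (out_word A (prefix k x) \<psi>) (\<psi> x)"
      using derivative_out_word_eq[OF psi, of "prefix k x" "suffix k x"] x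
      by (metis is_prefix_conc prefix_in_lists_alph prefix_suffix suffix_in_cantor)
  qed
qed

end

lemma derivative_transducer_minimal:
  assumes n: "2 \<le> n" and phi: "\<phi> \<in> cantor_embeddings n"
  shows "minimal n (derivative_transducer n \<phi>) \<phi>"
proof -
  let ?A = "derivative_transducer n \<phi>"
  have A: "ttrans ?A = dtrans n" "tout ?A = dout n"
    by (simp_all add: derivative_transducer_def)
  have st: "tstates ?A = {trans_word ?A w \<phi> | w. w \<in> lists (alph n)}"
    by (simp add: derivative_transducer_def trans_word_def)
  note tw = derivative_trans_word[OF n A] and sm = derivative_state_map[OF n A]
  have emb: "\<psi> \<in> cantor_embeddings n" if "\<psi> \<in> tstates ?A" for \<psi>
    using that tw[OF phi] st by auto
  have "ttrans ?A i \<psi> \<in> tstates ?A" if *: "\<psi> \<in> tstates ?A" "i \<in> alph n" for i \<psi>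
  proof -
    obtain w where "\<psi> = trans_word ?A w \<phi>" "w \<in> lists (alph n)"
      using * st by auto
    then have "ttrans ?A i \<psi> = trans_word ?A (w @ [i]) \<phi>" "w @ [i] \<in> lists (alph n)"
      using * by auto
    then show ?thesis
      using st by blast
  qed
  then have "is_transducer n ?A"
    using emb dtrans_embedding[OF n] sm(1) by (auto simp: is_transducer_def A)
  moreover have "\<phi> \<in> tstates ?A"
    using st by (auto intro!: exI[of _ "[]"])
  moreover have "\<exists>\<delta>\<in>cantor n. state_map ?A \<psi> \<delta> \<noteq> state_map ?A \<eta> \<delta>"
    if "\<psi> \<in> tstates ?A" "\<eta> \<in> tstates ?A" "\<psi> \<noteq> \<eta>" for \<psi> \<eta>
  proof -
    have "\<exists>\<delta>\<in>cantor n. \<psi> \<delta> \<noteq> \<eta> \<delta>"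
      using that emb by (metis (no_types, lifting) cantor_embeddings_def extensionalityI mem_Collect_eq)
    then show ?thesis
      using sm(2) emb that by metis
  qed
  moreover have "is_gcp (tout ?A i \<psi>) {state_map ?A \<psi> ([i] \<frown> \<delta>) | \<delta>. \<delta> \<in> cantor n}"
    if "\<psi> \<in> tstates ?A" "i \<in> alph n" for \<psi> i
  proof -
    have "{state_map ?A \<psi> ([i] \<frown> \<delta>) | \<delta>. \<delta> \<in> cantor n} = {\<psi> ([i] \<frown> \<delta>) | \<delta>. \<delta> \<in> cantor n}"
      unfolding Setcompr_eq_image
      using sm(2)[OF emb[OF that(1)]] that(2) by (intro image_cong) simp_all
    then show ?thesis
      using dout_is_gcp[OF n, of \<psi> i] emb[OF that(1)] that(2) by (simp add: A cantor_embeddings_def)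
  qed
  ultimately show ?thesis
    using st by (auto simp: minimal_iff reduced_on_def gcp_outputs_on_def)
qed

text \<open>The derivative transducer has maps as states, whereas the definitions of the groups ask
  for natural numbers.\<close>

lemma ex_nat_minimal:
  fixes A :: "'q transducer"
  assumes "minimal n A q0"
  shows "\<exists>(M :: nat transducer) m0. minimal n M m0 \<and>
    (\<forall>x\<in>cantor n. state_map M m0 x = state_map A q0 x)"
proof -
  have t: "is_transducer n A" "q0 \<in> tstates A"
    using assms by (auto simp: minimal_def)
  have "countable (alph n)"
    by (simp add: alph_def)
  then have "countable ((\<lambda>w. trans_word A w q0) ` lists (alph n))"
    by simp
  moreover have "tstates A \<subseteq> (\<lambda>w. trans_word A w q0) ` lists (alph n)"
    using assms by (force simp: minimal_iff)
  ultimately have cnt: "countable (tstates A)"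
    by (rule countable_subset[rotated])
  define e where "e = to_nat_on (tstates A)"
  define d where "d = from_nat_into (tstates A)"
  have de: "d (e q) = q" if "q \<in> tstates A" for q
    using that cnt by (simp add: d_def e_def)
  let ?M = "\<lparr>tstates = e ` tstates A, ttrans = (\<lambda>i s. e (ttrans A i (d s))), tout = (\<lambda>i s. tout A i (d s))\<rparr>"
  have m: "tmorph n e A ?M"
    by (simp add: tmorph_def de)
  then have "minimal n ?M (e q0)"
    using assms by (intro tmorph_minimal[of n e A]) auto
  moreover have "\<forall>x\<in>cantor n. state_map ?M (e q0) x = state_map A q0 x"
    using tmorph_state_map(1)[OF m] t by (auto simp: is_transducer_iff)
  ultimately show ?thesis by blast
qed

lemma ex_minimal_of_map:
  assumes "2 \<le> n" "inj_on \<phi> (cantor n)" "\<phi> ` cantor n \<subseteq> cantor n" "cantor_continuous n \<phi>"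
  shows "\<exists>(M :: nat transducer) m0. minimal n M m0 \<and> (\<forall>x\<in>cantor n. state_map M m0 x = \<phi> x)"
proof -
  let ?\<phi> = "restrict \<phi> (cantor n)"
  have e: "?\<phi> \<in> cantor_embeddings n"
    using assms by (auto simp: cantor_embeddings_def cantor_continuous_def inj_on_def)
  have "state_map (derivative_transducer n ?\<phi>) ?\<phi> x = \<phi> x" if "x \<in> cantor n" for x
    using derivative_state_map(2)[OF assms(1) _ _ e that, of "derivative_transducer n ?\<phi>"] that
    by (simp add: derivative_transducer_def)
  then show ?thesis
    using ex_nat_minimal[OF derivative_transducer_minimal[OF assms(1) e]] by metis
qed

section \<open>Cores\<close>

text \<open>What a core retains independently of the transducer it was cut from. By
  \<open>core_class_iso\<close> these properties determine it up to renaming from the map of any one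
  of its states; injectivity of the state maps serves to form composites.\<close>

definition core_transducer :: "nat \<Rightarrow> 'q transducer \<Rightarrow> bool" where
  "core_transducer n D \<longleftrightarrow> is_transducer n D \<and> tstates D \<noteq> {} \<and>
     (\<forall>p\<in>tstates D. \<forall>q\<in>tstates D. \<exists>w\<in>lists (alph n). trans_word D w p = q) \<and>
     reduced_on n D (tstates D) \<and> gcp_outputs_on n D (tstates D) \<and>
     (\<forall>q\<in>tstates D. inj_on (state_map D q) (cantor n))"

lemma core_transducerD:
  assumes "core_transducer n D"
  shows "is_transducer n D" "closed_states n D (tstates D)" "tstates D \<noteq> {}"
    "reduced_on n D (tstates D)" "gcp_outputs_on n D (tstates D)"
    "q \<in> tstates D \<Longrightarrow> inj_on (state_map D q) (cantor n)"
    "p \<in> tstates D \<Longrightarrow> q \<in> tstates D \<Longrightarrow> \<exists>w\<in>lists (alph n). trans_word D w p = q"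
  using assms by (auto simp: core_transducer_def is_transducer_iff)

text \<open>Either empty or exactly one class of transducers up to renaming, by
  \<open>transducer_class_eq_core_class\<close>. It turns statements about cores into statements
  about maps.\<close>

definition core_class :: "nat \<Rightarrow> (letter word \<Rightarrow> letter word) \<Rightarrow> nat transducer set" where
  "core_class n \<phi> = {D. core_transducer n D \<and> (\<exists>q\<in>tstates D. \<forall>\<delta>\<in>cantor n. state_map D q \<delta> = \<phi> \<delta>)}"

lemma tmorph_core_transducer:
  assumes f: "tmorph n f A B" "f ` tstates A = tstates B" and A: "core_transducer n A"
  shows "core_transducer n B"
proof -
  note t = core_transducerD(1,2)[OF A]
  have "\<exists>w\<in>lists (alph n). trans_word B w (f p) = f q" if pq: "p \<in> tstates A" "q \<in> tstates A" for p q
  proof -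
    obtain w where w: "w \<in> lists (alph n)" "trans_word A w p = q"
      using core_transducerD(7)[OF A pq] by auto
    then have "trans_word B w (f p) = f q"
      using tmorph_word(1)[OF f(1) t(2) pq(1)] by simp
    with w show ?thesis by blast
  qed
  moreover have "inj_on (state_map B (f q)) (cantor n)" if q: "q \<in> tstates A" for q
    using core_transducerD(6)[OF A q] tmorph_state_map(1)[OF f(1) t(2) q] by (simp cong: inj_on_cong)
  ultimately have "\<forall>p\<in>tstates B. \<forall>q\<in>tstates B. \<exists>w\<in>lists (alph n). trans_word B w p = q"
    "\<forall>q\<in>tstates B. inj_on (state_map B q) (cantor n)"
    unfolding f(2)[symmetric] by blast+
  moreover have "tstates B \<noteq> {}"
    using core_transducerD(3)[OF A] f(2) by blast
  ultimately show ?thesis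
    using tmorph_is_transducer[OF f t(1)] tmorph_reduced[OF f t(1) core_transducerD(4)[OF A]]
      tmorph_gcp[OF f t(1) core_transducerD(5)[OF A]]
    unfolding core_transducer_def by (intro conjI)
qed

lemma transducer_iso_core_class:
  assumes "transducer_iso n D B" "D \<in> core_class n \<phi>"
  shows "B \<in> core_class n \<phi>"
proof -
  obtain f where f: "f ` tstates D = tstates B" "tmorph n f D B"
    using assms(1) by (auto simp: transducer_iso_alt bij_betw_def)
  obtain q where q: "core_transducer n D" "q \<in> tstates D" "\<forall>\<delta>\<in>cantor n. state_map D q \<delta> = \<phi> \<delta>"
    using assms(2) by (auto simp: core_class_def)
  have "\<forall>\<delta>\<in>cantor n. state_map B (f q) \<delta> = \<phi> \<delta>"
    using tmorph_state_map(1)[OF f(2) core_transducerD(2)[OF q(1)] q(2)] q(3) by simp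
  then show ?thesis
    using tmorph_core_transducer[OF f(2,1) q(1)] f(1) q(2) by (auto simp: core_class_def)
qed

lemma transducer_iso_refl: "transducer_iso n A A"
  unfolding transducer_iso_def by (rule exI[of _ id]) simp

lemma transducer_class_self: "A \<in> transducer_class n A"
  by (simp add: transducer_class_def transducer_iso_refl)

section \<open>Recovering a core from the map of one state\<close>

lemma same_map_word:
  assumes A: "closed_states n A S" "gcp_outputs_on n A S"
    and B: "closed_states n B T" "gcp_outputs_on n B T"
    and x0: "x0 \<in> cantor n"
  shows "q \<in> S \<Longrightarrow> p \<in> T \<Longrightarrow> (\<forall>\<delta>\<in>cantor n. state_map A q \<delta> = state_map B p \<delta>) \<Longrightarrow> w \<in> lists (alph n) \<Longrightarrow>
    out_word A w q = out_word B w p \<and>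
    (\<forall>\<delta>\<in>cantor n. state_map A (trans_word A w q) \<delta> = state_map B (trans_word B w p) \<delta>)"
proof (induction w arbitrary: q p)
  case (Cons i w)
  have i: "i \<in> alph n" using Cons.prems by simp
  note step = step_unique[of A i q n B p x0]
  have a: "is_gcp (tout A i q) {state_map A q ([i] \<frown> \<delta>) | \<delta>. \<delta> \<in> cantor n}"
    "is_gcp (tout B i p) {state_map B p ([i] \<frown> \<delta>) | \<delta>. \<delta> \<in> cantor n}"
    using A(2) B(2) Cons.prems i by (simp_all add: gcp_outputs_on_def)
  have b: "state_map A q ([i] \<frown> \<delta>) = state_map B p ([i] \<frown> \<delta>)" if "\<delta> \<in> cantor n" for \<delta>
    using Cons.prems(3) i that by simp
  have c: "infinite_output A (ttrans A i q) \<delta>" "infinite_output B (ttrans B i p) \<delta>"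
    if "\<delta> \<in> cantor n" for \<delta>
    using closed_statesD(1,2)[OF A(1)] closed_statesD(1,2)[OF B(1)] Cons.prems i that by auto
  have "tout A i q = tout B i p"
    "\<And>\<delta>. \<delta> \<in> cantor n \<Longrightarrow> state_map A (ttrans A i q) \<delta> = state_map B (ttrans B i p) \<delta>"
    using step[OF a b c] x0 by auto
  moreover have "ttrans A i q \<in> S" "ttrans B i p \<in> T"
    using closed_statesD(2)[OF A(1)] closed_statesD(2)[OF B(1)] Cons.prems i by auto
  ultimately show ?case
    using Cons.IH[of "ttrans A i q" "ttrans B i p"] Cons.prems(4) by simp
qed simp

lemma reduced_onD:
  assumes "reduced_on n A S" "q \<in> S" "p \<in> S" "\<And>\<delta>. \<delta> \<in> cantor n \<Longrightarrow> state_map A q \<delta> = state_map A p \<delta>"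
  shows "q = p"
  using assms unfolding reduced_on_def by (rule_tac ccontr) auto

text \<open>States reached by the same word from states inducing the same map correspond to each other.\<close>

lemma core_class_iso:
  fixes A :: "'p transducer" and B :: "'q transducer"
  assumes n: "0 < n" and A: "core_transducer n A" and B: "core_transducer n B"
    and a: "a \<in> tstates A" and b: "b \<in> tstates B"
    and eq: "\<And>\<delta>. \<delta> \<in> cantor n \<Longrightarrow> state_map A a \<delta> = state_map B b \<delta>"
  shows "transducer_iso n A B"
proof -
  have x0: "(\<lambda>_. Plain 0) \<in> cantor n" using n by simp
  note cA = core_transducerD(2,5)[OF A] and cB = core_transducerD(2,5)[OF B]
  note same = same_map_word[OF cA cB x0 a b]
  have "\<exists>p\<in>tstates B. \<forall>\<delta>\<in>cantor n. state_map A q \<delta> = state_map B p \<delta>" if q: "q \<in> tstates A" for q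
  proof -
    obtain w where w: "w \<in> lists (alph n)" "trans_word A w a = q"
      using core_transducerD(7)[OF A a q] by auto
    then show ?thesis
      using same[of w] eq trans_word_closed[OF cB(1) b w(1)] by auto
  qed
  then obtain f where f: "\<And>q. q \<in> tstates A \<Longrightarrow> f q \<in> tstates B"
      "\<And>q \<delta>. q \<in> tstates A \<Longrightarrow> \<delta> \<in> cantor n \<Longrightarrow> state_map A q \<delta> = state_map B (f q) \<delta>"
    by metis
  have inj: "inj_on f (tstates A)"
  proof (rule inj_onI)
    fix q p assume "q \<in> tstates A" "p \<in> tstates A" "f q = f p"
    then show "q = p"
      using reduced_onD[OF core_transducerD(4)[OF A], of q p] f(2) by simp
  qed
  have surj: "p \<in> f ` tstates A" if p: "p \<in> tstates B" for p
  proof -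
    obtain w where w: "w \<in> lists (alph n)" "trans_word B w b = p"
      using core_transducerD(7)[OF B b p] by auto
    let ?q = "trans_word A w a"
    have q: "?q \<in> tstates A"
      using trans_word_closed[OF cA(1) a w(1)] .
    have "f ?q = p"
      using same[of w] eq w q p f by (intro reduced_onD[OF core_transducerD(4)[OF B]]) auto
    with q show ?thesis by blast
  qed
  have "f (ttrans A i q) = ttrans B i (f q) \<and> tout A i q = tout B i (f q)"
    if q: "q \<in> tstates A" and i: "i \<in> alph n" for q i
  proof -
    have *: "out_word A [i] q = out_word B [i] (f q)"
      "\<And>\<delta>. \<delta> \<in> cantor n \<Longrightarrow> state_map A (trans_word A [i] q) \<delta> = state_map B (trans_word B [i] (f q)) \<delta>"
      using same_map_word[OF cA cB x0 q f(1)[OF q], of "[i]"] f(2)[OF q] i by auto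
    have t: "ttrans A i q \<in> tstates A" "ttrans B i (f q) \<in> tstates B"
      using closed_statesD(2)[OF cA(1) q i] closed_statesD(2)[OF cB(1) f(1)[OF q] i] by auto
    have "f (ttrans A i q) = ttrans B i (f q)"
      using t *(2) f by (intro reduced_onD[OF core_transducerD(4)[OF B]]) auto
    with *(1) show ?thesis by simp
  qed
  moreover have "bij_betw f (tstates A) (tstates B)"
    using inj surj f(1) by (auto simp: bij_betw_def)
  ultimately show ?thesis
    unfolding transducer_iso_def by blast
qed

lemma transducer_class_eq_core_class:
  assumes "0 < n" "D \<in> core_class n \<phi>"
  shows "transducer_class n D = core_class n \<phi>"
proof
  show "transducer_class n D \<subseteq> core_class n \<phi>"
    using transducer_iso_core_class assms(2) by (auto simp: transducer_class_def)
  show "core_class n \<phi> \<subseteq> transducer_class n D"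
  proof
    fix B assume "B \<in> core_class n \<phi>"
    then obtain p where p: "core_transducer n B" "p \<in> tstates B" "\<forall>\<delta>\<in>cantor n. state_map B p \<delta> = \<phi> \<delta>"
      by (auto simp: core_class_def)
    obtain q where q: "core_transducer n D" "q \<in> tstates D" "\<forall>\<delta>\<in>cantor n. state_map D q \<delta> = \<phi> \<delta>"
      using assms(2) by (auto simp: core_class_def)
    have "transducer_iso n D B"
      using p(3) q(3) by (intro core_class_iso[OF assms(1) q(1) p(1) q(2) p(2)]) simp
    then show "B \<in> transducer_class n D"
      by (simp add: transducer_class_def)
  qed
qed

text \<open>By strong connectivity every state lies on a cycle. The last transition of the cycle
  ends in \<open>q\<close>, and it has already emitted everything common.\<close>

lemma core_no_common_prefix:
  assumes "0 < n" "core_transducer n D" "q \<in> tstates D"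
  shows "no_common_prefix n (state_map D q)"
proof -
  note c = core_transducerD(2)[OF assms(2)]
  let ?i = "Plain 0"
  have i: "?i \<in> alph n" using assms(1) by simp
  obtain w where w: "w \<in> lists (alph n)" "trans_word D w (ttrans D ?i q) = q"
    using core_transducerD(7)[OF assms(2) closed_statesD(2)[OF c assms(3) i] assms(3)] by auto
  obtain u j where u: "?i # w = u @ [j]"
    by (metis append_butlast_last_id list.distinct(1))
  then have l: "u \<in> lists (alph n)" "j \<in> alph n"
    using w(1) i by (metis Cons_in_lists_iff append_in_lists_conv)+
  let ?p = "trans_word D u q"
  have p: "?p \<in> tstates D"
    using trans_word_closed[OF c assms(3) l(1)] .
  have "trans_word D (u @ [j]) q = q"
    unfolding u[symmetric] using w(2) by simp
  then have "ttrans D j ?p = q"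
    by simp
  moreover have "no_common_prefix n (state_map D (ttrans D j ?p))"
  proof (rule no_common_prefix_target)
    show "is_gcp (tout D j ?p) {state_map D ?p ([j] \<frown> \<delta>) | \<delta>. \<delta> \<in> cantor n}"
      using core_transducerD(5)[OF assms(2)] p l(2) by (simp add: gcp_outputs_on_def)
    show "infinite_output D (ttrans D j ?p) \<delta>" if "\<delta> \<in> cantor n" for \<delta>
      using closed_statesD(1)[OF c closed_statesD(2)[OF c p l(2)] that] .
  qed
  ultimately show ?thesis by simp
qed

text \<open>The core of a plain transducer and that of a rooted one, for the set \<open>S\<close> of states outside
  \<open>R\<close>, are both of the following form.\<close>

lemma forced_core_transducer:
  fixes A :: "('q, 'm) transducer_scheme" and C :: "'q transducer"
  assumes A: "closed_states n A S" "reduced_on n A S" "gcp_outputs_on n A S" and S: "S \<noteq> {}" and n: "0 < n"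
    and inj: "\<And>q. q \<in> S \<Longrightarrow> inj_on (state_map A q) (cantor n)"
    and sync: "\<And>w q p. w \<in> lists (alph n) \<Longrightarrow> length w = K \<Longrightarrow> q \<in> S \<Longrightarrow> p \<in> S \<Longrightarrow>
      trans_word A w q = trans_word A w p"
    and C: "ttrans C = ttrans A" "tout C = tout A"
      "tstates C = {trans_word A w q | w q. w \<in> lists (alph n) \<and> length w = K \<and> q \<in> S}"
  shows "core_transducer n C"
    and "tstates C \<subseteq> S"
    and "\<And>w q. w \<in> lists (alph n) \<Longrightarrow> K \<le> length w \<Longrightarrow> q \<in> S \<Longrightarrow> trans_word A w q \<in> tstates C"
proof -
  note cong = transducer_cong[of C A, OF C(1,2)]
  show sub: "tstates C \<subseteq> S"
    using trans_word_closed[OF A(1)] C(3) by auto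
  show long: "trans_word A w q \<in> tstates C" if w: "w \<in> lists (alph n)" "K \<le> length w" "q \<in> S" for w q
  proof -
    let ?u = "take (length w - K) w" and ?v = "drop (length w - K) w"
    have uv: "?u \<in> lists (alph n)" "?v \<in> lists (alph n)" "length ?v = K"
      using w by (auto dest: in_set_takeD in_set_dropD)
    have "trans_word A w q = trans_word A ?v (trans_word A ?u q)"
      by (metis append_take_drop_id trans_word_append)
    moreover have "trans_word A ?u q \<in> S"
      using trans_word_closed[OF A(1) w(3) uv(1)] .
    ultimately show ?thesis
      unfolding C(3) using uv by blast
  qed
  have closed: "ttrans A i q \<in> tstates C" if q: "q \<in> tstates C" and i: "i \<in> alph n" for i q
  proof -
    obtain w p where w: "q = trans_word A w p" "w \<in> lists (alph n)" "length w = K" "p \<in> S"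
      using q C(3) by auto
    then show ?thesis
      using long[of "w @ [i]" p] i by simp
  qed
  have t: "is_transducer n C"
    unfolding is_transducer_def cong C(1,2)
    using closed closed_statesD(1,3)[OF A(1)] sub by (meson subsetD)
  \<comment> \<open>A word forcing \<open>q\<close> leads to \<open>q\<close> from every state,
    which gives strong connectivity.\<close>
  have "\<exists>w\<in>lists (alph n). trans_word A w p = q" if pq: "p \<in> tstates C" "q \<in> tstates C" for p q
  proof -
    obtain w s where w: "q = trans_word A w s" "w \<in> lists (alph n)" "length w = K" "s \<in> S"
      using pq(2) C(3) by auto
    then show ?thesis
      using sync[of w p s] pq(1) sub by auto
  qed
  moreover have "tstates C \<noteq> {}"
  proof -
    obtain s where "s \<in> S" using S by auto
    moreover have "replicate K (Plain 0) \<in> lists (alph n)"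
      using n by (auto simp: in_lists_conv_set)
    ultimately show ?thesis
      using long[of "replicate K (Plain 0)" s] by auto
  qed
  ultimately have "\<forall>p\<in>tstates C. \<forall>q\<in>tstates C. \<exists>w\<in>lists (alph n). trans_word C w p = q"
      "tstates C \<noteq> {}"
    unfolding cong by blast+
  moreover have "reduced_on n C (tstates C)"
    using A(2) sub unfolding reduced_on_def cong by (meson subsetD)
  moreover have "gcp_outputs_on n C (tstates C)"
    using A(3) sub unfolding gcp_outputs_on_def cong C(2) by (meson subsetD)
  moreover have "\<forall>q\<in>tstates C. inj_on (state_map C q) (cantor n)"
    using inj sub unfolding cong by (meson subsetD)
  ultimately show "core_transducer n C"
    using t unfolding core_transducer_def by (intro conjI)
qed

lemma core_is_core_transducer:
  assumes "minimal n A q0" "sync_level n A k" "0 < n" "inj_on (state_map A q0) (cantor n)"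
  shows "core_transducer n (core n A)"
    and "\<And>w q. w \<in> lists (alph n) \<Longrightarrow> k \<le> length w \<Longrightarrow> q \<in> tstates A \<Longrightarrow> trans_word A w q \<in> tstates (core n A)"
    and "tstates (core n A) \<subseteq> tstates A"
proof -
  let ?K = "LEAST k. sync_level n A k"
  have K: "sync_level n A ?K" "?K \<le> k"
    using assms(2) by (auto intro: LeastI Least_le)
  have c: "closed_states n A (tstates A)"
    using assms(1) by (simp add: minimal_iff is_transducer_iff)
  have inj: "inj_on (state_map A q) (cantor n)" if q: "q \<in> tstates A" for q
  proof (rule inj_onI)
    fix x y assume xy: "x \<in> cantor n" "y \<in> cantor n" "state_map A q x = state_map A q y"
    obtain w where w: "w \<in> lists (alph n)" "trans_word A w q0 = q"
      using assms(1) q by (auto simp: minimal_iff)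
    have "state_map A q0 (w \<frown> x) = state_map A q0 (w \<frown> y)"
      using state_map_conc_closed[OF c, of q0 w] assms(1) w xy by (simp add: minimal_iff)
    then have "w \<frown> x = w \<frown> y"
      using assms(4) w xy by (simp add: inj_on_eq_iff)
    then show "x = y" by simp
  qed
  have m: "reduced_on n A (tstates A)" "gcp_outputs_on n A (tstates A)" "tstates A \<noteq> {}"
    using assms(1) by (auto simp: minimal_iff)
  have s: "trans_word A w q = trans_word A w p"
    if "w \<in> lists (alph n)" "length w = ?K" "q \<in> tstates A" "p \<in> tstates A" for w q p
    using K(1) that unfolding sync_level_def by blast
  have C: "ttrans (core n A) = ttrans A" "tout (core n A) = tout A"
    "tstates (core n A) = {trans_word A w q | w q. w \<in> lists (alph n) \<and> length w = ?K \<and> q \<in> tstates A}"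
    by (simp_all add: core_def)
  note * = forced_core_transducer[OF c m assms(3) inj s C]
  show "core_transducer n (core n A)"
    by (rule *(1))
  show "tstates (core n A) \<subseteq> tstates A"
    by (rule *(2))
  show "trans_word A w q \<in> tstates (core n A)"
    if "w \<in> lists (alph n)" "k \<le> length w" "q \<in> tstates A" for w q
    by (rule *(3)) (use that K(2) in simp_all)
qed

section \<open>Rooted transducers\<close>

declare in_lists_conv_set [simp del]

lemma is_rtransducerD:
  assumes "is_rtransducer n r A"
  shows "rpre A \<subseteq> tstates A" "finite (rpre A)" "rinit A \<in> rpre A" "rinit A \<in> tstates A"
    "closed_states n A (tstates A - rpre A)"
    "q \<in> tstates A \<Longrightarrow> i \<in> readable_letters n r A q \<Longrightarrow> ttrans A i q \<in> tstates A - {rinit A}"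
    "q \<in> rpre A \<Longrightarrow> w \<in> readable_words n r A q \<Longrightarrow> w \<noteq> [] \<Longrightarrow> trans_word A w q \<noteq> q"
proof -
  note * = assms[unfolded is_rtransducer_def]
  show "rpre A \<subseteq> tstates A" "finite (rpre A)" "rinit A \<in> rpre A"
    using * by - (elim conjE, assumption)+
  then show "rinit A \<in> tstates A"
    by blast
  show "closed_states n A (tstates A - rpre A)"
    unfolding closed_states_def using * by (elim conjE, intro conjI)
  have a: "\<forall>q\<in>tstates A. \<forall>i\<in>readable_letters n r A q. ttrans A i q \<in> tstates A - {rinit A}"
    and b: "\<forall>q\<in>rpre A. \<forall>w\<in>readable_words n r A q. w \<noteq> [] \<longrightarrow> trans_word A w q \<noteq> q"
    using * by - (elim conjE, assumption)+
  show "q \<in> tstates A \<Longrightarrow> i \<in> readable_letters n r A q \<Longrightarrow> ttrans A i q \<in> tstates A - {rinit A}"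
    using a by blast
  show "q \<in> rpre A \<Longrightarrow> w \<in> readable_words n r A q \<Longrightarrow> w \<noteq> [] \<Longrightarrow> trans_word A w q \<noteq> q"
    using b by blast
qed

section \<open>Rooted words and runs from the root\<close>

lemma rooted_cantor_iff: "y \<in> rooted_cantor n r \<longleftrightarrow> y 0 \<in> dots r \<and> suffix 1 y \<in> cantor n"
proof
  assume "y 0 \<in> dots r \<and> suffix 1 y \<in> cantor n"
  then show "y \<in> rooted_cantor n r"
    unfolding rooted_cantor_def using conc_head_tail[of y] by blast
qed (auto simp: rooted_cantor_def)

lemma conc_in_rooted_cantor [simp]: "w \<in> rooted_words n r \<Longrightarrow> x \<in> cantor n \<Longrightarrow> w \<frown> x \<in> rooted_cantor n r"
proof -
  assume w: "w \<in> rooted_words n r" and x: "x \<in> cantor n"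
  obtain a u where u: "w = a # u" "a \<in> dots r" "u \<in> lists (alph n)"
    using w unfolding rooted_words_def by blast
  then have "w \<frown> x = [a] \<frown> (u \<frown> x)" "u \<frown> x \<in> cantor n"
    using x by simp_all
  then show ?thesis
    unfolding rooted_cantor_def using u(2) by blast
qed

lemma Dot_in_dots [simp]: "Dot a \<in> dots r \<longleftrightarrow> a < r"
  by (auto simp: dots_def)

lemma rooted_words_Cons [simp]: "a # w \<in> rooted_words n r \<longleftrightarrow> a \<in> dots r \<and> w \<in> lists (alph n)"
  by (auto simp: rooted_words_def)

lemma Nil_notin_rooted_words [simp]: "[] \<notin> rooted_words n r"
  by (auto simp: rooted_words_def)

lemma rooted_words_append: "u \<in> rooted_words n r \<Longrightarrow> w \<in> lists (alph n) \<Longrightarrow> u @ w \<in> rooted_words n r"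
  by (cases u) auto

lemma rooted_words_not_plain: "w \<in> rooted_words n r \<Longrightarrow> w \<notin> lists (alph n)"
  by (cases w) (auto simp: dots_def alph_def)

text \<open>Which letters are readable depends on whether the state is \<open>rinit\<close>, and
  this state is never entered again. The state and the legality of the next letter have to be
  followed together.\<close>

lemma reading:
  assumes A: "is_rtransducer n r A" and q: "q \<in> tstates A" and d: "\<delta> \<in> readable_inf n r A q"
  shows "trans_word A (prefix k \<delta>) q \<in> tstates A \<and> (0 < k \<longrightarrow> trans_word A (prefix k \<delta>) q \<noteq> rinit A) \<and>
    \<delta> k \<in> readable_letters n r A (trans_word A (prefix k \<delta>) q)"
proof (induction k)
  case 0
  then show ?case
    using q d by (auto simp: readable_inf_def readable_letters_def rooted_cantor_iff cantor_def split: if_splits)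
next
  case (Suc k)
  have "trans_word A (prefix (Suc k) \<delta>) q = ttrans A (\<delta> k) (trans_word A (prefix k \<delta>) q)"
    by simp
  then have *: "trans_word A (prefix (Suc k) \<delta>) q \<in> tstates A - {rinit A}"
    using is_rtransducerD(6)[OF A] Suc by (simp del: subseq_to_Suc)
  have "\<delta> (Suc k) \<in> alph n"
  proof (cases "q = rinit A")
    case True
    then have "suffix 1 \<delta> \<in> cantor n"
      using d by (simp add: readable_inf_def rooted_cantor_iff)
    then have "range (suffix 1 \<delta>) \<subseteq> alph n"
      by (simp add: cantor_def)
    then have "suffix 1 \<delta> k \<in> alph n"
      by blast
    then show ?thesis by simp
  next
    case False
    then show ?thesis
      using d by (auto simp: readable_inf_def cantor_def)
  qed
  with * show ?case
    by (simp add: readable_letters_def del: subseq_to_Suc)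
qed

text \<open>By the pigeonhole principle an infinite path inside \<open>R\<close> would close a cycle.\<close>

lemma reaches_S:
  assumes A: "is_rtransducer n r A" and q: "q \<in> tstates A" and d: "\<delta> \<in> readable_inf n r A q"
  shows "\<exists>k. trans_word A (prefix k \<delta>) q \<in> tstates A - rpre A"
proof (rule ccontr)
  assume n: "\<not> ?thesis"
  let ?s = "\<lambda>k. trans_word A (prefix k \<delta>) q"
  note r = reading[OF A q d]
  have R: "range ?s \<subseteq> rpre A"
    using n r by blast
  then have "finite (range ?s)"
    using is_rtransducerD(2)[OF A] by (rule finite_subset)
  then have "\<not> inj ?s"
    using range_inj_infinite by blast
  then obtain j l where jl: "j < l" "?s j = ?s l"
    by (metis (mono_tags, lifting) injI linorder_neqE_nat)
  let ?w = "\<delta> [j \<rightarrow> l]"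
  \<comment> \<open>The repeated state is also reached after \<open>l > 0\<close> letters, hence is
    not \<open>rinit\<close>, and the word read around the loop is a plain one.\<close>
  have ne: "?s j \<noteq> rinit A"
    using r[of l] jl by simp
  have "prefix l \<delta> = prefix j \<delta> @ ?w"
    using subsequence_append[where i = j and j = "l - j" and w = \<delta>] jl by simp
  then have cyc: "trans_word A ?w (?s j) = ?s j"
    using jl by (metis trans_word_append)
  have "\<delta> i \<in> alph n" if i: "j \<le> i" for i
  proof -
    have "?s i \<noteq> rinit A"
      using r[of i] ne i by (cases "i = j") auto
    then show ?thesis
      using r[of i] by (simp add: readable_letters_def)
  qed
  then have "?w \<in> readable_words n r A (?s j)"
    using ne by (auto simp: readable_words_def)
  moreover have "?s j \<in> rpre A"
    using R by blast
  moreover have "?w \<noteq> []"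
    using jl by simp
  ultimately show False
    using is_rtransducerD(7)[OF A] cyc by blast
qed

lemma rtransducer_infinite_output:
  assumes A: "is_rtransducer n r A" and q: "q \<in> tstates A" and d: "\<delta> \<in> readable_inf n r A q"
  shows "infinite_output A q \<delta>"
proof -
  obtain k where k: "trans_word A (prefix k \<delta>) q \<in> tstates A - rpre A"
    using reaches_S[OF assms] by auto
  have "\<delta> i \<in> alph n" if i: "k \<le> i" for i
  proof -
    have "trans_word A (prefix i \<delta>) q \<noteq> rinit A"
    proof (cases "i = k")
      case True
      then show ?thesis
        using k is_rtransducerD(3)[OF A] by auto
    next
      case False
      then show ?thesis
        using reading[OF assms, of i] i by simp
    qed
    then show ?thesis
      using reading[OF assms, of i] by (simp add: readable_letters_def)
  qed
  then have "suffix k \<delta> \<in> cantor n"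
    by (auto simp: cantor_def)
  then have "infinite_output A (trans_word A (prefix k \<delta>) q) (suffix k \<delta>)"
    using closed_statesD(1)[OF is_rtransducerD(5)[OF A] k] by blast
  then have "infinite_output A q (prefix k \<delta> \<frown> suffix k \<delta>)"
    by (rule infinite_output_conc)
  then show ?thesis by simp
qed

lemma rminimalD:
  assumes "rminimal n r A"
  shows "is_rtransducer n r A"
    "q \<in> tstates A \<Longrightarrow> \<exists>w\<in>readable_words n r A (rinit A). trans_word A w (rinit A) = q"
    "q \<in> tstates A \<Longrightarrow> p \<in> tstates A \<Longrightarrow> q \<noteq> rinit A \<Longrightarrow> p \<noteq> rinit A \<Longrightarrow>
       (\<And>\<delta>. \<delta> \<in> cantor n \<Longrightarrow> state_map A q \<delta> = state_map A p \<delta>) \<Longrightarrow> q = p"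
    "q \<in> tstates A \<Longrightarrow> i \<in> readable_letters n r A q \<Longrightarrow>
       is_gcp (tout A i q) {state_map A q ([i] \<frown> \<delta>) | \<delta>. \<delta> \<in> cantor n}"
proof -
  show "q = p" if "q \<in> tstates A" "p \<in> tstates A" "q \<noteq> rinit A" "p \<noteq> rinit A"
    "\<And>\<delta>. \<delta> \<in> cantor n \<Longrightarrow> state_map A q \<delta> = state_map A p \<delta>"
  proof (rule ccontr)
    assume "q \<noteq> p"
    then have "readable_inf n r A q \<noteq> readable_inf n r A p \<or>
        (\<exists>\<delta>\<in>readable_inf n r A q. state_map A q \<delta> \<noteq> state_map A p \<delta>)"
      using assms that(1,2) unfolding rminimal_def by blast
    then show False
      using that(3-5) by (simp add: readable_inf_def)
  qed
qed (use assms in \<open>auto simp: rminimal_def\<close>)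

lemma rtransducer_trans_word:
  assumes A: "is_rtransducer n r A" and w: "w \<in> rooted_words n r"
  shows "trans_word A w (rinit A) \<in> tstates A - {rinit A}"
proof -
  obtain a u where u: "w = a # u" "a \<in> dots r" "u \<in> lists (alph n)"
    using w unfolding rooted_words_def by blast
  have "trans_word A (a # u) (rinit A) \<in> tstates A - {rinit A}"
    using u(3)
  proof (induction u rule: rev_induct)
    case Nil
    then show ?case
      using is_rtransducerD(6)[OF A is_rtransducerD(4)[OF A], of a] u(2) by (simp add: readable_letters_def)
  next
    case (snoc i u)
    then show ?case
      using is_rtransducerD(6)[OF A, of "trans_word A (a # u) (rinit A)" i]
      by (simp add: readable_letters_def)
  qed
  then show ?thesis using u by simp
qed

lemma non_initial_reached:
  assumes "rminimal n r A" "q \<in> tstates A" "q \<noteq> rinit A"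
  obtains u where "u \<in> rooted_words n r" "trans_word A u (rinit A) = q"
proof -
  obtain w where w: "w \<in> readable_words n r A (rinit A)" "trans_word A w (rinit A) = q"
    using rminimalD(2)[OF assms(1,2)] by auto
  then have "w \<in> rooted_words n r"
    using assms(3) by (auto simp: readable_words_def)
  then show thesis using that w by blast
qed

lemma plain_trans_word:
  assumes A: "is_rtransducer n r A" and "q \<in> tstates A - {rinit A}" "w \<in> lists (alph n)"
  shows "trans_word A w q \<in> tstates A - {rinit A}"
  using assms(3,2)
proof (induction w arbitrary: q)
  case (Cons i w)
  then show ?case
    using is_rtransducerD(6)[OF A, of q i] by (simp add: readable_letters_def)
qed simp

text \<open>The argument of \<open>same_map_word\<close> started at the root, where both transducers
  represent \<open>h\<close>. It makes the later notions independent of the minimal transducer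
  chosen for \<open>h\<close>.\<close>

lemma represented_same_maps:
  assumes A: "rminimal n r A" "represents n r A h" and B: "rminimal n r B" "represents n r B h"
    and n: "0 < n" and w: "w \<in> rooted_words n r" and x: "x \<in> cantor n"
  shows "state_map A (trans_word A w (rinit A)) x = state_map B (trans_word B w (rinit B)) x"
proof -
  note rA = rminimalD(1)[OF A(1)] and rB = rminimalD(1)[OF B(1)]
  have x0: "(\<lambda>_. Plain 0) \<in> cantor n"
    using n by simp
  have step: "state_map A (ttrans A i q) \<delta> = state_map B (ttrans B i p) \<delta>"
    if q: "q \<in> tstates A" "p \<in> tstates B" "i \<in> readable_letters n r A q" "i \<in> readable_letters n r B p"
      and eq: "\<And>\<delta>. \<delta> \<in> cantor n \<Longrightarrow> state_map A q ([i] \<frown> \<delta>) = state_map B p ([i] \<frown> \<delta>)"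
      and d: "\<delta> \<in> cantor n" for q p i \<delta>
  proof (rule step_unique(2)[OF rminimalD(4)[OF A(1) q(1,3)] rminimalD(4)[OF B(1) q(2,4)] eq _ _ x0 d])
    fix \<delta> assume "\<delta> \<in> cantor n"
    then show "infinite_output A (ttrans A i q) \<delta>" "infinite_output B (ttrans B i p) \<delta>"
      using is_rtransducerD(6)[OF rA q(1,3)] is_rtransducerD(6)[OF rB q(2,4)]
      by (auto intro!: rtransducer_infinite_output[OF rA] rtransducer_infinite_output[OF rB]
          simp: readable_inf_def)
  qed
  obtain a u where u: "w = a # u" "a \<in> dots r" "u \<in> lists (alph n)"
    using w unfolding rooted_words_def by blast
  have "\<forall>\<delta>\<in>cantor n. state_map A (trans_word A (a # u) (rinit A)) \<delta> = state_map B (trans_word B (a # u) (rinit B)) \<delta>"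
    using u(3)
  proof (induction u rule: rev_induct)
    case Nil
    have "state_map A (rinit A) ([a] \<frown> \<delta>) = state_map B (rinit B) ([a] \<frown> \<delta>)" if "\<delta> \<in> cantor n" for \<delta>
      using A(2) B(2) u(2) that unfolding represents_def by simp
    then show ?case
      using step[of "rinit A" "rinit B" a] is_rtransducerD(4)[OF rA] is_rtransducerD(4)[OF rB] u(2)
      by (simp add: readable_letters_def)
  next
    case (snoc i u)
    have i: "i \<in> alph n" "u \<in> lists (alph n)"
      using snoc.prems by simp_all
    let ?q = "trans_word A (a # u) (rinit A)" and ?p = "trans_word B (a # u) (rinit B)"
    have qp: "?q \<in> tstates A - {rinit A}" "?p \<in> tstates B - {rinit B}"
      using rtransducer_trans_word[OF rA, of "a # u"] rtransducer_trans_word[OF rB, of "a # u"] u(2) i(2)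
      by simp_all
    show ?case
      using step[of ?q ?p i] qp snoc.IH i by (simp add: readable_letters_def)
  qed
  then show ?thesis using u x by blast
qed

section \<open>Synchronizing levels and cores of rooted transducers\<close>

lemma rsync_levelD:
  assumes "rsync_level n r A k" "length w = k" "q \<in> tstates A" "p \<in> tstates A"
    "w \<in> readable_words n r A q" "w \<in> readable_words n r A p"
  shows "trans_word A w q = trans_word A w p"
  using assms(1)[unfolded rsync_level_def, rule_format, of w q p] assms(2-) by blast

text \<open>The empty word is readable everywhere, so level \<open>0\<close> would identify the root
  with the states after it. At a positive level no word is readable both from the root and from
  another state.\<close>

lemma rsync_level_pos:
  assumes A: "is_rtransducer n r A" and r: "0 < r" and k: "rsync_level n r A k"
  shows "0 < k"
proof (rule ccontr)
  assume "\<not> ?thesis"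
  then have eq: "q = p" if "q \<in> tstates A" "p \<in> tstates A" for q p
    using rsync_levelD[OF k, of "[]" q p] that \<open>\<not> 0 < k\<close> by (simp add: readable_words_def)
  have "trans_word A [Dot 0] (rinit A) \<in> tstates A - {rinit A}"
    using rtransducer_trans_word[OF A, of "[Dot 0]"] r by simp
  then show False
    using eq[of "trans_word A [Dot 0] (rinit A)" "rinit A"] is_rtransducerD(4)[OF A] by blast
qed

text \<open>\<open>Core\<close> makes its own choice of a minimal transducer, which need not be the
  one supplied by \<open>finite_sync\<close>. States of \<open>A\<close> are compared through the
  words leading to them, which can be read in \<open>B\<close> as well.\<close>

lemma rsync_level_transfer:
  assumes A: "rminimal n r A" "represents n r A h" and B: "rminimal n r B" "represents n r B h"
    and n: "0 < n" and r: "0 < r" and k: "rsync_level n r B k"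
  shows "rsync_level n r A k"
  unfolding rsync_level_def
proof safe
  fix w q p
  assume k': "k = length w" and q: "q \<in> tstates A" and p: "p \<in> tstates A"
    and wq: "w \<in> readable_words n r A q" and wp: "w \<in> readable_words n r A p"
  note rA = rminimalD(1)[OF A(1)] and rB = rminimalD(1)[OF B(1)]
  have w0: "w \<noteq> []"
    using rsync_level_pos[OF rB r k] k' by auto
  show "trans_word A w q = trans_word A w p"
  proof (cases "q = rinit A \<or> p = rinit A")
    case True
    then have "q = p"
      using wq wp w0 rooted_words_not_plain[of w n r] by (auto simp: readable_words_def split: if_splits)
    then show ?thesis by simp
  next
    case False
    then have w: "w \<in> lists (alph n)"
      using wq by (simp add: readable_words_def)
    obtain u where u: "u \<in> rooted_words n r" "trans_word A u (rinit A) = q"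
      using non_initial_reached[OF A(1) q] False by blast
    obtain v where v: "v \<in> rooted_words n r" "trans_word A v (rinit A) = p"
      using non_initial_reached[OF A(1) p] False by blast
    note uw = rooted_words_append[OF u(1) w] and vw = rooted_words_append[OF v(1) w]
    have "trans_word B w (trans_word B u (rinit B)) = trans_word B w (trans_word B v (rinit B))"
      using rsync_levelD[OF k k'[symmetric]] rtransducer_trans_word[OF rB u(1)]
        rtransducer_trans_word[OF rB v(1)] w by (simp add: readable_words_def)
    then have "state_map A (trans_word A (u @ w) (rinit A)) \<delta> = state_map A (trans_word A (v @ w) (rinit A)) \<delta>"
      if "\<delta> \<in> cantor n" for \<delta>
      using represented_same_maps[OF A B n uw that] represented_same_maps[OF A B n vw that] by simp
    then have "trans_word A (u @ w) (rinit A) = trans_word A (v @ w) (rinit A)"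
      using rtransducer_trans_word[OF rA uw] rtransducer_trans_word[OF rA vw]
      by (intro rminimalD(3)[OF A(1)]) blast+
    then show ?thesis
      using u v by simp
  qed
qed

lemma rcore_is_core_transducer:
  assumes A: "rminimal n r A" "represents n r A h" and n: "0 < n" and r: "0 < r"
    and k: "rsync_level n r A k" and inj: "inj_on h (rooted_cantor n r)"
  shows "core_transducer n (rcore n r A)"
    and "\<And>w u. w \<in> lists (alph n) \<Longrightarrow> k \<le> length w \<Longrightarrow> u \<in> rooted_words n r \<Longrightarrow>
      trans_word A (u @ w) (rinit A) \<in> tstates (rcore n r A)"
proof -
  note rA = rminimalD(1)[OF A(1)]
  let ?S = "tstates A - rpre A" and ?K = "LEAST k. rsync_level n r A k"
  have K: "rsync_level n r A ?K" "?K \<le> k"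
    using k by (auto intro: LeastI Least_le)
  have sync: "trans_word A w q = trans_word A w p"
    if "w \<in> lists (alph n)" "length w = ?K" "q \<in> tstates A - {rinit A}" "p \<in> tstates A - {rinit A}" for w q p
    using rsync_levelD[OF K(1) that(2), of q p] that by (simp add: readable_words_def)
  have sub: "q \<in> tstates A - {rinit A}" if "q \<in> ?S" for q
    using that is_rtransducerD(3)[OF rA] by auto
  have "[Dot 0] \<frown> (\<lambda>_. Plain 0) \<in> readable_inf n r A (rinit A)"
    using n r by (simp add: readable_inf_def)
  from reaches_S[OF rA is_rtransducerD(4)[OF rA] this] obtain s where s: "s \<in> ?S"
    by auto
  have nonempty: "?S \<noteq> {}"
    using s by blast
  have reds: "reduced_on n A ?S"
    unfolding reduced_on_def
  proof (intro ballI impI)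
    fix q p assume qp: "q \<in> ?S" "p \<in> ?S" "q \<noteq> p"
    then have "\<not> (\<forall>\<delta>\<in>cantor n. state_map A q \<delta> = state_map A p \<delta>)"
      using rminimalD(3)[OF A(1), of q p] sub[of q] sub[of p] by blast
    then show "\<exists>\<delta>\<in>cantor n. state_map A q \<delta> \<noteq> state_map A p \<delta>"
      by blast
  qed
  have gcps: "gcp_outputs_on n A ?S"
    unfolding gcp_outputs_on_def using rminimalD(4)[OF A(1)] sub by (simp add: readable_letters_def)
  have injs: "inj_on (state_map A q) (cantor n)" if q: "q \<in> ?S" for q
  proof (rule inj_onI)
    fix x y assume xy: "x \<in> cantor n" "y \<in> cantor n" "state_map A q x = state_map A q y"
    obtain u where u: "u \<in> rooted_words n r" "trans_word A u (rinit A) = q"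
      using non_initial_reached[OF A(1)] sub[OF q] by blast
    have "h (u \<frown> z) = out_word A u (rinit A) \<frown> state_map A q z" if z: "z \<in> cantor n" for z
    proof -
      have "h (u \<frown> z) = state_map A (rinit A) (u \<frown> z)"
        using A(2) u z unfolding represents_def by simp
      also have "\<dots> = out_word A u (rinit A) \<frown> state_map A (trans_word A u (rinit A)) z"
        using closed_statesD(1)[OF is_rtransducerD(5)[OF rA] q z] u(2) by (intro state_map_conc) simp
      finally show ?thesis using u by simp
    qed
    then have "h (u \<frown> x) = h (u \<frown> y)"
      using xy by simp
    then have "u \<frown> x = u \<frown> y"
      using inj u xy by (simp add: inj_on_eq_iff)
    then show "x = y" by simp
  qed
  \<comment> \<open>\<open>rcore\<close> starts from all non-initial states, also from those in
    \<open>rpre\<close>. As a forcing word ends in the same place when started from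
    \<open>s \<in> ?S\<close>, no further states arise.\<close>
  have st: "tstates (rcore n r A) = {trans_word A w q | w q. w \<in> lists (alph n) \<and> length w = ?K \<and> q \<in> ?S}"
    (is "_ = ?C")
  proof
    show "?C \<subseteq> tstates (rcore n r A)"
      unfolding rcore_def using sub by simp blast
    show "tstates (rcore n r A) \<subseteq> ?C"
    proof
      fix p assume "p \<in> tstates (rcore n r A)"
      then obtain w q where w: "p = trans_word A w q" "w \<in> lists (alph n)" "length w = ?K" "q \<in> tstates A - {rinit A}"
        unfolding rcore_def by auto
      then have "p = trans_word A w s"
        using sync[of w q s] sub[OF s] by simp
      then show "p \<in> ?C"
        using w s by blast
    qed
  qed
  have tr: "ttrans (rcore n r A) = ttrans A" "tout (rcore n r A) = tout A"
    by (simp_all add: rcore_def)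
  have sync': "trans_word A w q = trans_word A w p"
    if "w \<in> lists (alph n)" "length w = ?K" "q \<in> ?S" "p \<in> ?S" for w q p
    using sync that sub by blast
  note * = forced_core_transducer[OF is_rtransducerD(5)[OF rA] reds gcps nonempty n injs sync' tr st]
  show "core_transducer n (rcore n r A)"
    by (rule *(1))
  fix w u assume w: "w \<in> lists (alph n)" "k \<le> length w" "u \<in> rooted_words n r"
  let ?q = "trans_word A u (rinit A)"
  let ?u = "take (length w - ?K) w" and ?v = "drop (length w - ?K) w"
  have uv: "?u \<in> lists (alph n)" "?v \<in> lists (alph n)" "length ?v = ?K"
    using w K(2) by (auto simp: in_lists_conv_set dest: in_set_takeD in_set_dropD)
  have q: "trans_word A ?u ?q \<in> tstates A - {rinit A}"
    using plain_trans_word[OF rA rtransducer_trans_word[OF rA w(3)] uv(1)] .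
  have *: "trans_word A (u @ w) (rinit A) = trans_word A ?v (trans_word A ?u ?q)"
    by (metis append_take_drop_id trans_word_append)
  have "tstates (rcore n r A) =
      {trans_word A w q | w q. w \<in> lists (alph n) \<and> length w = ?K \<and> q \<in> tstates A - {rinit A}}"
    by (simp add: rcore_def)
  then show "trans_word A (u @ w) (rinit A) \<in> tstates (rcore n r A)"
    unfolding * using uv(2,3) q by blast
qed

section \<open>Maps acting in the same way below every root letter\<close>

definition rooted_lift :: "nat \<Rightarrow> nat \<Rightarrow> (letter word \<Rightarrow> letter word) \<Rightarrow> (letter word \<Rightarrow> letter word) \<Rightarrow> bool" where
  "rooted_lift n r \<phi> h \<longleftrightarrow> (\<forall>a\<in>dots r. \<forall>x\<in>cantor n. h ([a] \<frown> x) = [a] \<frown> \<phi> x)"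

text \<open>A root letter followed by a long word as in \<open>loop\<close> ends in a core state. On
  this cone \<open>h\<close> is \<open>\<phi>\<close> behind a fixed word, and so is the output of
  the transducer behind another one; cancelling shows that the core state induces
  \<open>\<phi>\<close>.\<close>

lemma Core_eq_core_class:
  assumes fs: "finite_sync n r h" and n: "0 < n" and r: "0 < r"
    and lift: "rooted_lift n r \<phi> h" and inj: "inj_on h (rooted_cantor n r)"
    and ncp: "no_common_prefix n \<phi>"
    and loop: "\<And>k. \<exists>w\<in>lists (alph n). k \<le> length w \<and> (\<exists>v. \<forall>x\<in>cantor n. \<phi> (w \<frown> x) = v \<frown> \<phi> x)"
  shows "Core n r h = core_class n \<phi>"
proof -
  let ?P = "\<lambda>A :: nat rtransducer. rminimal n r A \<and> represents n r A h"
  obtain B :: "nat rtransducer" and k where B: "?P B" and k: "rsync_level n r B k"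
    using fs unfolding finite_sync_def by blast
  define A where "A = (SOME A. ?P A)"
  have A: "rminimal n r A" "represents n r A h"
    using someI[of ?P, OF B] by (simp_all add: A_def)
  have kA: "rsync_level n r A k"
    using rsync_level_transfer[OF A _ _ n r k] B by blast
  note core = rcore_is_core_transducer[OF A n r kA inj]
  obtain w v where w: "w \<in> lists (alph n)" "k \<le> length w" "\<And>x. x \<in> cantor n \<Longrightarrow> \<phi> (w \<frown> x) = v \<frown> \<phi> x"
    using loop[of k] by blast
  let ?p = "trans_word A ([Dot 0] @ w) (rinit A)"
  have p: "?p \<in> tstates (rcore n r A)"
    using core(2)[OF w(1,2), of "[Dot 0]"] r by simp
  have sm: "state_map (rcore n r A) = state_map A" "infinite_output (rcore n r A) = infinite_output A"
    by (rule transducer_cong; simp add: rcore_def)+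
  have "[Dot 0] \<frown> v \<frown> \<phi> x = out_word A ([Dot 0] @ w) (rinit A) \<frown> state_map A ?p x" if x: "x \<in> cantor n" for x
  proof -
    have wr: "[Dot 0] @ w \<in> rooted_words n r"
      using r w by simp
    have inf: "infinite_output A ?p x"
      using closed_statesD(1)[OF core_transducerD(2)[OF core(1)] p x] sm by simp
    have "h (([Dot 0] @ w) \<frown> x) = out_word A ([Dot 0] @ w) (rinit A) \<frown> state_map A ?p x"
      using A(2) conc_in_rooted_cantor[OF wr x] state_map_conc[OF inf] unfolding represents_def by simp
    moreover have "h (([Dot 0] @ w) \<frown> x) = h ([Dot 0] \<frown> (w \<frown> x))"
      by simp
    moreover have "h ([Dot 0] \<frown> (w \<frown> x)) = [Dot 0] \<frown> \<phi> (w \<frown> x)"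
      using lift r w x unfolding rooted_lift_def by (metis Dot_in_dots conc_in_cantor_iff)
    ultimately show ?thesis
      using w(3)[OF x] by simp
  qed
  then have eq: "([Dot 0] @ v) \<frown> \<phi> x = out_word A ([Dot 0] @ w) (rinit A) \<frown> state_map A ?p x"
    if "x \<in> cantor n" for x
    using that by simp
  have "no_common_prefix n (state_map A ?p)"
    using core_no_common_prefix[OF n core(1) p] sm by simp
  then have "\<phi> x = state_map A ?p x" if "x \<in> cantor n" for x
    using no_common_prefix_cancel(2)[OF ncp _ _ eq that] that by blast
  then have "rcore n r A \<in> core_class n \<phi>"
    unfolding core_class_def using core(1) p sm(1) by auto
  then show ?thesis
    unfolding Core_def A_def[symmetric] by (rule transducer_class_eq_core_class[OF n])
qed

lemma Core_core_transducer:
  assumes "h \<in> B_maps n r" "0 < n" "0 < r" "D \<in> Core n r h"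
  shows "core_transducer n D"
proof -
  let ?P = "\<lambda>A :: nat rtransducer. rminimal n r A \<and> represents n r A h"
  have fs: "finite_sync n r h"
    and hom: "homeomorphic_map (rooted_cantor_top n r) (rooted_cantor_top n r) h"
    using assms(1) unfolding B_maps_def by auto
  have inj: "inj_on h (rooted_cantor n r)"
    using homeomorphic_imp_injective_map[OF hom] by (simp add: rooted_cantor_top_def)
  obtain B :: "nat rtransducer" and k where B: "?P B" and k: "rsync_level n r B k"
    using fs unfolding finite_sync_def by blast
  define A where "A = (SOME A. ?P A)"
  have A: "rminimal n r A" "represents n r A h"
    using someI[of ?P, OF B] by (simp_all add: A_def)
  have kA: "rsync_level n r A k"
    using rsync_level_transfer[OF A _ _ assms(2,3) k] B by blast
  note core = rcore_is_core_transducer(1)[OF A assms(2,3) kA inj]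
  obtain f where "f ` tstates (rcore n r A) = tstates D" "tmorph n f (rcore n r A) D"
    using assms(4) unfolding Core_def A_def[symmetric] transducer_class_def
    by (auto simp: transducer_iso_alt bij_betw_def)
  then show ?thesis
    using tmorph_core_transducer core by metis
qed

text \<open>A root that copies the dotted letter is put in front of the minimal transducer of
  \<open>\<phi>\<close>.\<close>

lemma ex_finite_sync:
  fixes M :: "nat transducer"
  assumes M: "minimal n M m0" and fin: "finite (tstates M)" and k: "sync_level n M k"
    and map: "\<And>x. x \<in> cantor n \<Longrightarrow> state_map M m0 x = \<phi> x" and ncp: "no_common_prefix n \<phi>"
    and n: "0 < n" and r: "0 < r" and lift: "rooted_lift n r \<phi> h"
  shows "finite_sync n r h"
proof -
  \<comment> \<open>State \<open>0\<close> is the new root and the only element of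
    \<open>rpre\<close>; the states of \<open>M\<close> are shifted by \<open>Suc\<close>. All
    dotted letters lead to the initial state of \<open>M\<close>, as \<open>h\<close> does the same
    below each of them.\<close>
  define A :: "nat rtransducer" where
    "A = \<lparr>tstates = insert 0 (Suc ` tstates M),
       ttrans = (\<lambda>l s. case l of Dot a \<Rightarrow> Suc m0 | Plain j \<Rightarrow> Suc (ttrans M l (s - 1))),
       tout = (\<lambda>l s. case l of Dot a \<Rightarrow> [l] | Plain j \<Rightarrow> tout M l (s - 1)),
       rinit = 0, rpre = {0}\<rparr>"
  have t: "is_transducer n M" "m0 \<in> tstates M"
    using M by (auto simp: minimal_iff)
  then have c: "closed_states n M (tstates M)"
    by (simp add: is_transducer_iff)
  have A_simps: "tstates A = insert 0 (Suc ` tstates M)" "rinit A = 0" "rpre A = {0}"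
    by (simp_all add: A_def)
  have plain: "ttrans A i (Suc q) = Suc (ttrans M i q)" "tout A i (Suc q) = tout M i q" if "i \<in> alph n" for i q
    using that by (auto simp: A_def alph_def)
  have dot: "ttrans A i 0 = Suc m0" "tout A i 0 = [i]" if "i \<in> dots r" for i
    using that by (auto simp: A_def dots_def)
  have word: "trans_word A w (Suc q) = Suc (trans_word M w q) \<and> out_word A w (Suc q) = out_word M w q"
    if "w \<in> lists (alph n)" for w q
    using that by (induction w arbitrary: q) (auto simp: plain)
  have wordr: "trans_word A (a # w) 0 = Suc (trans_word M w m0)" if "a \<in> dots r" "w \<in> lists (alph n)" for a w
    using that dot word by simp
  have sm: "state_map A (Suc q) x = state_map M q x" "infinite_output A (Suc q) x = infinite_output M q x"
    if "x \<in> cantor n" for q x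
    using word that by (simp_all add: state_map_def infinite_output_def)
  have sm0: "state_map A 0 ([a] \<frown> x) = [a] \<frown> \<phi> x" if "a \<in> dots r" "x \<in> cantor n" for a x
    using state_map_conc[of A "[a]" 0 x] that dot sm[OF that(2)] closed_statesD(1)[OF c t(2) that(2)] map
    by simp
  have rt: "is_rtransducer n r A"
    unfolding is_rtransducer_def
  proof (intro conjI)
    show "\<forall>q\<in>tstates A. \<forall>i\<in>readable_letters n r A q. ttrans A i q \<in> tstates A - {rinit A}"
      using closed_statesD(2)[OF c] t(2) dot(1) plain(1) by (auto simp: A_simps readable_letters_def)
    show "\<forall>q\<in>rpre A. \<forall>i\<in>readable_letters n r A q.
        (if ttrans A i q \<in> rpre A then tout A i q = [] else tout A i q \<in> rooted_words n r)"
      using dot by (auto simp: A_simps readable_letters_def)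
    show "\<forall>q\<in>tstates A - rpre A. \<forall>i\<in>alph n.
        ttrans A i q \<in> tstates A - rpre A \<and> tout A i q \<in> lists (alph n)"
      using closed_statesD(2,3)[OF c] plain by (auto simp: A_simps)
    show "\<forall>q\<in>tstates A - rpre A. \<forall>\<delta>\<in>cantor n. infinite_output A q \<delta>"
      using closed_statesD(1)[OF c] sm(2) by (auto simp: A_simps)
    show "\<forall>q\<in>rpre A. \<forall>w\<in>readable_words n r A q. w \<noteq> [] \<longrightarrow> trans_word A w q \<noteq> q"
    proof (intro ballI impI)
      fix q w assume q: "q \<in> rpre A" and w: "w \<in> readable_words n r A q" "w \<noteq> []"
      have "q = 0"
        using q by (simp add: A_simps)
      then have "w \<in> rooted_words n r"
        using w by (simp add: readable_words_def A_simps)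
      then obtain a u where "w = a # u" "a \<in> dots r" "u \<in> lists (alph n)"
        unfolding rooted_words_def by blast
      then show "trans_word A w q \<noteq> q"
        using wordr[of a u] \<open>q = 0\<close> by (simp del: trans_word_Cons)
    qed
  qed (auto simp: A_simps)
  have disj: "rooted_cantor n r \<noteq> cantor n"
  proof
    assume "rooted_cantor n r = cantor n"
    moreover have "(\<lambda>_. Plain 0) \<in> cantor n" using n by simp
    ultimately have "(\<lambda>_. Plain 0) \<in> rooted_cantor n r" by blast
    then show False by (auto simp: rooted_cantor_iff dots_def)
  qed
  have "rminimal n r A"
    unfolding rminimal_def
  proof (intro conjI)
    show "\<forall>q\<in>tstates A. \<exists>w\<in>readable_words n r A (rinit A). trans_word A w (rinit A) = q"
    proof
      fix q assume "q \<in> tstates A"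
      then consider "q = 0" | p where "q = Suc p" "p \<in> tstates M"
        by (auto simp: A_simps)
      then show "\<exists>w\<in>readable_words n r A (rinit A). trans_word A w (rinit A) = q"
      proof cases
        case 1
        then show ?thesis
          by (intro bexI[of _ "[]"]) (simp_all add: A_simps readable_words_def)
      next
        case 2
        obtain w where "w \<in> lists (alph n)" "trans_word M w m0 = p"
          using M 2 by (auto simp: minimal_iff)
        then show ?thesis
          using wordr[of "Dot 0" w] r 2
          by (intro bexI[of _ "Dot 0 # w"]) (simp_all add: A_simps readable_words_def)
      qed
    qed
    show "\<forall>q\<in>tstates A. \<forall>p\<in>tstates A. q \<noteq> p \<longrightarrow> readable_inf n r A q \<noteq> readable_inf n r A p \<or>
        (\<exists>\<delta>\<in>readable_inf n r A q. state_map A q \<delta> \<noteq> state_map A p \<delta>)"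
    proof (intro ballI impI)
      fix q p assume "q \<in> tstates A" "p \<in> tstates A" "q \<noteq> p"
      then consider "q = 0" "p \<noteq> 0" | "p = 0" "q \<noteq> 0" |
        q' p' where "q = Suc q'" "p = Suc p'" "q' \<in> tstates M" "p' \<in> tstates M" "q' \<noteq> p'"
        by (auto simp: A_simps)
      then show "readable_inf n r A q \<noteq> readable_inf n r A p \<or>
        (\<exists>\<delta>\<in>readable_inf n r A q. state_map A q \<delta> \<noteq> state_map A p \<delta>)"
      proof cases
        case 3
        then obtain \<delta> where "\<delta> \<in> cantor n" "state_map M q' \<delta> \<noteq> state_map M p' \<delta>"
          using M unfolding minimal_iff reduced_on_def by blast
        then show ?thesis
          using 3 sm(1) by (auto simp: readable_inf_def A_simps)
      qed (use disj in \<open>auto simp: readable_inf_def A_simps\<close>)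
    qed
    show "\<forall>q\<in>tstates A. \<forall>i\<in>readable_letters n r A q.
        is_gcp (tout A i q) {state_map A q ([i] \<frown> \<delta>) | \<delta>. \<delta> \<in> cantor n}"
    proof (intro ballI)
      fix q i assume q: "q \<in> tstates A" and i: "i \<in> readable_letters n r A q"
      consider "q = 0" | p where "q = Suc p" "p \<in> tstates M"
        using q by (auto simp: A_simps)
      then show "is_gcp (tout A i q) {state_map A q ([i] \<frown> \<delta>) | \<delta>. \<delta> \<in> cantor n}"
      proof cases
        case 1
        then have i: "i \<in> dots r"
          using i by (simp add: readable_letters_def A_simps)
        have "{state_map A q ([i] \<frown> \<delta>) | \<delta>. \<delta> \<in> cantor n} = (\<frown>) [i] ` (\<phi> ` cantor n)"
          unfolding Setcompr_eq_image image_image using sm0[OF i] 1 by (intro image_cong) simp_all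
        \<comment> \<open>Here \<open>no_common_prefix\<close> enters: the root may emit its own
          letter and nothing beyond it.\<close>
        moreover have "is_gcp [] (\<phi> ` cantor n)"
          using ncp by (auto simp: is_gcp_def no_common_prefix_def)
        moreover have "\<phi> ` cantor n \<noteq> {}"
        proof -
          have "(\<lambda>_. Plain 0) \<in> cantor n" using n by simp
          then show ?thesis by blast
        qed
        ultimately show ?thesis
          using is_gcp_conc[of "[]" "\<phi> ` cantor n" "[i]"] dot(2)[OF i] 1 by simp
      next
        case 2
        then have i: "i \<in> alph n"
          using i by (simp add: readable_letters_def A_simps)
        have "{state_map A q ([i] \<frown> \<delta>) | \<delta>. \<delta> \<in> cantor n} = {state_map M p ([i] \<frown> \<delta>) | \<delta>. \<delta> \<in> cantor n}"
          unfolding Setcompr_eq_image using sm(1) 2 i by (intro image_cong) simp_all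
        then show ?thesis
          using M 2 i plain(2)[OF i] by (simp add: minimal_iff gcp_outputs_on_def)
      qed
    qed
  qed (rule rt)
  moreover have "represents n r A h"
    unfolding represents_def
  proof
    fix y assume "y \<in> rooted_cantor n r"
    then obtain a x where "y = [a] \<frown> x" "a \<in> dots r" "x \<in> cantor n"
      by (auto simp: rooted_cantor_def)
    then show "state_map A (rinit A) y = h y"
      using sm0 lift by (simp add: A_simps rooted_lift_def)
  qed
  moreover have "finite (tstates A)"
    using fin by (simp add: A_simps)
  \<comment> \<open>The extra letter makes the level positive; at level \<open>0\<close> the empty
    word would have to identify the root with the other states.\<close>
  moreover have "rsync_level n r A (Suc k)"
    unfolding rsync_level_def
  proof safe
    fix w q p
    assume k': "length w = Suc k" and q: "q \<in> tstates A" and p: "p \<in> tstates A"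
      and wq: "w \<in> readable_words n r A q" and wp: "w \<in> readable_words n r A p"
    have w0: "w \<noteq> []"
      using k' by auto
    show "trans_word A w q = trans_word A w p"
    proof (cases "q = 0 \<or> p = 0")
      case True
      then have "q = p"
        using wq wp w0 rooted_words_not_plain[of w n r]
        by (auto simp: readable_words_def A_simps(2) split: if_splits)
      then show ?thesis by simp
    next
      case False
      then have w: "w \<in> lists (alph n)"
        using wq by (simp add: readable_words_def A_simps)
      obtain q' p' where qp: "q = Suc q'" "p = Suc p'" "q' \<in> tstates M" "p' \<in> tstates M"
        using False q p by (auto simp: A_simps)
      obtain i u where u: "w = i # u" "length u = k" "i \<in> alph n" "u \<in> lists (alph n)"
        using w k' by (cases w) auto
      have "trans_word M u (ttrans M i q') = trans_word M u (ttrans M i p')"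
        using k u closed_statesD(2)[OF c] qp unfolding sync_level_def by blast
      then show ?thesis
        using word[OF w] u qp by simp
    qed
  qed
  ultimately show ?thesis
    unfolding finite_sync_def by blast
qed

section \<open>Synchronizing maps\<close>

text \<open>By compactness this amounts to continuity; the uniform form provides the depth
  independent of the point that composites of synchronizing maps require.\<close>

definition cantor_unif_continuous :: "nat \<Rightarrow> (letter word \<Rightarrow> letter word) \<Rightarrow> bool" where
  "cantor_unif_continuous n \<phi> \<longleftrightarrow> (\<forall>m. \<exists>k. \<forall>x\<in>cantor n. \<forall>y\<in>cantor n.
     prefix k x = prefix k y \<longrightarrow> prefix m (\<phi> x) = prefix m (\<phi> y))"

lemma cantor_unif_continuousD:
  assumes "cantor_unif_continuous n \<phi>"
  obtains k where "\<And>x y. x \<in> cantor n \<Longrightarrow> y \<in> cantor n \<Longrightarrow> prefix k x = prefix k y \<Longrightarrow> prefix m (\<phi> x) = prefix m (\<phi> y)"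
  using assms unfolding cantor_unif_continuous_def by blast

lemma cantor_unif_continuousI:
  assumes "\<And>m. \<exists>k. \<forall>x\<in>cantor n. \<forall>y\<in>cantor n. prefix k x = prefix k y \<longrightarrow> prefix m (\<phi> x) = prefix m (\<phi> y)"
  shows "cantor_unif_continuous n \<phi>"
  using assms unfolding cantor_unif_continuous_def by blast

lemma cantor_unif_continuous_imp:
  assumes "cantor_unif_continuous n \<phi>"
  shows "cantor_continuous n \<phi>"
  unfolding cantor_continuous_def
proof (intro ballI allI)
  fix x m assume x: "x \<in> cantor n"
  obtain k where "\<And>x y. x \<in> cantor n \<Longrightarrow> y \<in> cantor n \<Longrightarrow> prefix k x = prefix k y \<Longrightarrow> prefix m (\<phi> x) = prefix m (\<phi> y)"
    using cantor_unif_continuousD[OF assms] by blast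
  then show "\<exists>k. \<forall>y\<in>cantor n. prefix k y = prefix k x \<longrightarrow> prefix m (\<phi> y) = prefix m (\<phi> x)"
    using x by (intro exI[of _ k]) blast
qed

lemma prefix_conc_same:
  assumes "prefix k x = prefix k y"
  shows "prefix k (w \<frown> x) = prefix k (w \<frown> y)" "prefix (length w + k) (w \<frown> x) = prefix (length w + k) (w \<frown> y)"
proof -
  show *: "prefix (length w + k) (w \<frown> x) = prefix (length w + k) (w \<frown> y)"
    using assms by simp
  show "prefix k (w \<frown> x) = prefix k (w \<frown> y)"
    using prefix_eq_mono[OF *] by simp
qed

lemma prefix_conc_cancel:
  assumes "prefix (length v + m) (v \<frown> x) = prefix (length v + m) (v \<frown> y)"
  shows "prefix m x = prefix m y"
  using assms by simp

text \<open>Maps whose minimal transducer is synchronizing: up to a prefix, the restriction to a cone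
  \<open>u w\<close> with \<open>w\<close> long depends on \<open>w\<close> only.\<close>

definition forced_map :: "nat \<Rightarrow> (letter word \<Rightarrow> letter word) \<Rightarrow> letter list \<Rightarrow> (letter word \<Rightarrow> letter word) \<Rightarrow> bool" where
  "forced_map n \<phi> w \<psi> \<longleftrightarrow> (\<forall>u\<in>lists (alph n). \<exists>v. \<forall>x\<in>cantor n. \<phi> (u \<frown> w \<frown> x) = v \<frown> \<psi> x)"

definition sync_map :: "nat \<Rightarrow> (letter word \<Rightarrow> letter word) \<Rightarrow> bool" where
  "sync_map n \<phi> \<longleftrightarrow> inj_on \<phi> (cantor n) \<and> \<phi> ` cantor n \<subseteq> cantor n \<and> cantor_unif_continuous n \<phi> \<and>
     (\<exists>k>0. \<forall>w\<in>lists (alph n). length w = k \<longrightarrow> (\<exists>\<psi>. no_common_prefix n \<psi> \<and> forced_map n \<phi> w \<psi>))"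

lemma strip_common_prefix:
  assumes n: "2 \<le> n" and inj: "inj_on \<psi> (cantor n)"
  obtains v \<psi>' where "\<And>x. x \<in> cantor n \<Longrightarrow> \<psi> x = v \<frown> \<psi>' x" "no_common_prefix n \<psi>'"
proof -
  have "\<psi> (\<lambda>_. Plain 0) \<noteq> \<psi> (\<lambda>_. Plain 1)"
    using two_points[OF n] inj by (simp add: inj_on_eq_iff)
  then obtain v where v: "is_gcp v (\<psi> ` cantor n)"
    using ex_is_gcp[of "\<psi> (\<lambda>_. Plain 0)" "\<psi> ` cantor n" "\<psi> (\<lambda>_. Plain 1)"] two_points[OF n] by blast
  let ?\<psi> = "\<lambda>x. suffix (length v) (\<psi> x)"
  have eq: "\<psi> x = v \<frown> ?\<psi> x" if "x \<in> cantor n" for x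
    using v that unfolding is_gcp_def by (intro is_prefixD) blast
  have "no_common_prefix n ?\<psi>"
    unfolding no_common_prefix_def
  proof (intro allI impI)
    fix u assume u: "\<forall>x\<in>cantor n. is_prefix u (?\<psi> x)"
    have "is_prefix (v @ u) (\<psi> x)" if x: "x \<in> cantor n" for x
      using u x eq[OF x] by (metis is_prefix_append_iff)
    then have "length (v @ u) \<le> length v"
      using v unfolding is_gcp_def by blast
    then show "u = []" by simp
  qed
  with eq show thesis by (rule that)
qed

text \<open>The forced maps supplied may still have a common prefix: it is stripped here and moved
  into the fixed word in front.\<close>

lemma sync_mapI:
  assumes n: "2 \<le> n" and inj: "inj_on \<phi> (cantor n)" and "\<And>x. x \<in> cantor n \<Longrightarrow> \<phi> x \<in> cantor n"
    "cantor_unif_continuous n \<phi>" "0 < k"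
    and f: "\<And>w. w \<in> lists (alph n) \<Longrightarrow> length w = k \<Longrightarrow> \<exists>\<psi>. forced_map n \<phi> w \<psi>"
  shows "sync_map n \<phi>"
proof -
  have "\<exists>\<psi>. no_common_prefix n \<psi> \<and> forced_map n \<phi> w \<psi>" if w: "w \<in> lists (alph n)" "length w = k" for w
  proof -
    obtain \<psi> where psi: "forced_map n \<phi> w \<psi>"
      using f[OF w] by blast
    obtain v where v: "\<And>x. x \<in> cantor n \<Longrightarrow> \<phi> (w \<frown> x) = v \<frown> \<psi> x"
      using psi unfolding forced_map_def by (metis conc_empty lists.Nil)
    have "inj_on \<psi> (cantor n)"
    proof (rule inj_onI)
      fix x y assume xy: "x \<in> cantor n" "y \<in> cantor n" "\<psi> x = \<psi> y"
      then have "\<phi> (w \<frown> x) = \<phi> (w \<frown> y)"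
        using v by simp
      then have "w \<frown> x = w \<frown> y"
        using inj xy w by (simp add: inj_on_eq_iff)
      then show "x = y" by simp
    qed
    then obtain u \<psi>' where u: "\<And>x. x \<in> cantor n \<Longrightarrow> \<psi> x = u \<frown> \<psi>' x" "no_common_prefix n \<psi>'"
      using strip_common_prefix[OF n] by blast
    have "forced_map n \<phi> w \<psi>'"
      unfolding forced_map_def
    proof
      fix s assume "s \<in> lists (alph n)"
      then obtain t where "\<And>x. x \<in> cantor n \<Longrightarrow> \<phi> (s \<frown> w \<frown> x) = t \<frown> \<psi> x"
        using psi unfolding forced_map_def by blast
      then have "\<forall>x\<in>cantor n. \<phi> (s \<frown> w \<frown> x) = (t @ u) \<frown> \<psi>' x"
        using u(1) by simp
      then show "\<exists>v. \<forall>x\<in>cantor n. \<phi> (s \<frown> w \<frown> x) = v \<frown> \<psi>' x" ..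
    qed
    with u(2) show ?thesis by blast
  qed
  then show ?thesis
    unfolding sync_map_def using assms by blast
qed

lemma sync_mapD:
  assumes "sync_map n \<phi>"
  shows "inj_on \<phi> (cantor n)" "x \<in> cantor n \<Longrightarrow> \<phi> x \<in> cantor n" "cantor_unif_continuous n \<phi>"
  using assms by (auto simp: sync_map_def)

lemma sync_map_level:
  assumes "sync_map n \<phi>"
  obtains k \<psi> where "0 < k"
    "\<And>w. w \<in> lists (alph n) \<Longrightarrow> length w = k \<Longrightarrow> no_common_prefix n (\<psi> w)"
    "\<And>w u. w \<in> lists (alph n) \<Longrightarrow> length w = k \<Longrightarrow> u \<in> lists (alph n) \<Longrightarrow>
       \<exists>v. \<forall>x\<in>cantor n. \<phi> (u \<frown> w \<frown> x) = v \<frown> \<psi> w x"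
proof -
  obtain k where k: "0 < k" "\<forall>w\<in>lists (alph n). length w = k \<longrightarrow> (\<exists>\<psi>. no_common_prefix n \<psi> \<and> forced_map n \<phi> w \<psi>)"
    using assms unfolding sync_map_def by blast
  define \<psi> where "\<psi> w = (SOME \<psi>. no_common_prefix n \<psi> \<and> forced_map n \<phi> w \<psi>)" for w
  have *: "no_common_prefix n (\<psi> w) \<and> forced_map n \<phi> w (\<psi> w)" if "w \<in> lists (alph n)" "length w = k" for w
    unfolding \<psi>_def
    using k(2) that by (intro someI_ex[of "\<lambda>\<psi>. no_common_prefix n \<psi> \<and> forced_map n \<phi> w \<psi>"]) blast
  show thesis
  proof (rule that[OF k(1)])
    show "no_common_prefix n (\<psi> w)" if "w \<in> lists (alph n)" "length w = k" for w
      using *[OF that] by blast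
    show "\<exists>v. \<forall>x\<in>cantor n. \<phi> (u \<frown> w \<frown> x) = v \<frown> \<psi> w x"
      if "w \<in> lists (alph n)" "length w = k" "u \<in> lists (alph n)" for w u
      using *[OF that(1,2)] that(3) unfolding forced_map_def by blast
  qed
qed

text \<open>The words forcing the behaviour of \<open>\<phi>\<close> force that of its residual too,
  because the word \<open>w\<close> read before is just a longer history. This covers the maps of
  all states of a core.\<close>

lemma sync_map_residual:
  assumes n: "2 \<le> n" and phi: "sync_map n \<phi>" and w: "w \<in> lists (alph n)"
    and eq: "\<And>x. x \<in> cantor n \<Longrightarrow> \<phi> (w \<frown> x) = v \<frown> \<eta> x"
  shows "sync_map n \<eta>"
proof -
  obtain k \<psi> where k: "0 < k"
    "\<And>w. w \<in> lists (alph n) \<Longrightarrow> length w = k \<Longrightarrow> no_common_prefix n (\<psi> w)"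
    "\<And>w u. w \<in> lists (alph n) \<Longrightarrow> length w = k \<Longrightarrow> u \<in> lists (alph n) \<Longrightarrow>
       \<exists>v. \<forall>x\<in>cantor n. \<phi> (u \<frown> w \<frown> x) = v \<frown> \<psi> w x"
    using sync_map_level[OF phi] by blast
  show ?thesis
  proof (rule sync_mapI[OF n _ _ _ k(1)])
    show "inj_on \<eta> (cantor n)"
    proof (rule inj_onI)
      fix x y assume xy: "x \<in> cantor n" "y \<in> cantor n" "\<eta> x = \<eta> y"
      then have "\<phi> (w \<frown> x) = \<phi> (w \<frown> y)"
        using eq by simp
      then have "w \<frown> x = w \<frown> y"
        using sync_mapD(1)[OF phi] xy w by (simp add: inj_on_eq_iff)
      then show "x = y" by simp
    qed
    show "\<eta> x \<in> cantor n" if "x \<in> cantor n" for x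
      using sync_mapD(2)[OF phi, of "w \<frown> x"] eq[OF that] w that by simp
    show "cantor_unif_continuous n \<eta>"
    proof (rule cantor_unif_continuousI)
      fix m
      obtain l where l: "\<And>x y. x \<in> cantor n \<Longrightarrow> y \<in> cantor n \<Longrightarrow> prefix l x = prefix l y \<Longrightarrow>
          prefix (length v + m) (\<phi> x) = prefix (length v + m) (\<phi> y)"
        using cantor_unif_continuousD[OF sync_mapD(3)[OF phi]] by blast
      have "prefix m (\<eta> x) = prefix m (\<eta> y)" if xy: "x \<in> cantor n" "y \<in> cantor n" "prefix l x = prefix l y" for x y
      proof (rule prefix_conc_cancel)
        show "prefix (length v + m) (v \<frown> \<eta> x) = prefix (length v + m) (v \<frown> \<eta> y)"
          using l[of "w \<frown> x" "w \<frown> y"] prefix_conc_same(1)[OF xy(3)] w xy eq[OF xy(1)] eq[OF xy(2)] by simp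
      qed
      then show "\<exists>k. \<forall>x\<in>cantor n. \<forall>y\<in>cantor n. prefix k x = prefix k y \<longrightarrow> prefix m (\<eta> x) = prefix m (\<eta> y)"
        by blast
    qed
    fix s assume s: "s \<in> lists (alph n)" "length s = k"
    have "forced_map n \<eta> s (\<psi> s)"
      unfolding forced_map_def
    proof
      fix u assume u: "u \<in> lists (alph n)"
      then have "w @ u \<in> lists (alph n)"
        using w by simp
      then obtain t where t: "\<And>x. x \<in> cantor n \<Longrightarrow> \<phi> ((w @ u) \<frown> s \<frown> x) = t \<frown> \<psi> s x"
        using k(3)[OF s] by blast
      have *: "t \<frown> \<psi> s x = v \<frown> \<eta> (u \<frown> s \<frown> x)" if x: "x \<in> cantor n" for x
        using t[OF x] eq[of "u \<frown> s \<frown> x"] u s x by simp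
      have "(\<lambda>_. Plain 0) \<in> cantor n"
        using n by simp
      \<comment> \<open>As \<open>\<psi> s\<close> has no common prefix, the fixed word
        \<open>v\<close> on the other side cannot reach beyond \<open>t\<close>, and it can be
        cancelled.\<close>
      from no_common_prefix_length[OF k(2)[OF s] this *] have len: "length v \<le> length t"
        by blast
      have "\<eta> (u \<frown> s \<frown> x) = drop (length v) t \<frown> \<psi> s x" if x: "x \<in> cantor n" for x
      proof (rule conc_compare[OF *[OF x, symmetric] len])
        fix r assume "t = v @ r" "\<eta> (u \<frown> s \<frown> x) = r \<frown> \<psi> s x"
        then show ?thesis by simp
      qed
      then show "\<exists>v. \<forall>x\<in>cantor n. \<eta> (u \<frown> s \<frown> x) = v \<frown> \<psi> s x"
        by blast
    qed
    then show "\<exists>\<psi>. forced_map n \<eta> s \<psi>"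
      by blast
  qed
qed

text \<open>The first \<open>k\<close> letters of \<open>W\<close> force the map
  \<open>\<psi> w\<close> that \<open>\<phi>\<close> applies to the rest; the next \<open>L\<close>
  letters settle the first \<open>l\<close> letters \<open>t\<close> of its value, and these force
  the behaviour of \<open>\<eta>\<close>. What was read before \<open>W\<close> contributes only a
  fixed word.\<close>

lemma sync_map_comp:
  assumes n: "2 \<le> n" and phi: "sync_map n \<phi>" and chi: "sync_map n \<eta>"
  shows "sync_map n (\<lambda>x. \<eta> (\<phi> x))"
proof -
  obtain k \<psi> where k: "0 < k"
    "\<And>w. w \<in> lists (alph n) \<Longrightarrow> length w = k \<Longrightarrow> no_common_prefix n (\<psi> w)"
    "\<And>w u. w \<in> lists (alph n) \<Longrightarrow> length w = k \<Longrightarrow> u \<in> lists (alph n) \<Longrightarrow>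
       \<exists>v. \<forall>x\<in>cantor n. \<phi> (u \<frown> w \<frown> x) = v \<frown> \<psi> w x"
    using sync_map_level[OF phi] by blast
  obtain l \<theta> where l: "0 < l"
    "\<And>w. w \<in> lists (alph n) \<Longrightarrow> length w = l \<Longrightarrow> no_common_prefix n (\<theta> w)"
    "\<And>w u. w \<in> lists (alph n) \<Longrightarrow> length w = l \<Longrightarrow> u \<in> lists (alph n) \<Longrightarrow>
       \<exists>v. \<forall>x\<in>cantor n. \<eta> (u \<frown> w \<frown> x) = v \<frown> \<theta> w x"
    using sync_map_level[OF chi] by blast
  have ran: "\<psi> w x \<in> cantor n" if w: "w \<in> lists (alph n)" "length w = k" and x: "x \<in> cantor n" for w x
  proof -
    obtain v where v: "\<phi> ([] \<frown> w \<frown> x) = v \<frown> \<psi> w x"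
      using k(3)[OF w lists.Nil] x by blast
    then show ?thesis
      using sync_mapD(2)[OF phi, of "w \<frown> x"] w x by simp
  qed
  have "\<exists>j. \<forall>x\<in>cantor n. \<forall>y\<in>cantor n. prefix j x = prefix j y \<longrightarrow> prefix l (\<psi> w x) = prefix l (\<psi> w y)"
    if w: "w \<in> lists (alph n)" "length w = k" for w
  proof -
    obtain v where v: "\<forall>x\<in>cantor n. \<phi> ([] \<frown> w \<frown> x) = v \<frown> \<psi> w x"
      using k(3)[OF w lists.Nil] by blast
    obtain j where j: "\<And>x y. x \<in> cantor n \<Longrightarrow> y \<in> cantor n \<Longrightarrow> prefix j x = prefix j y \<Longrightarrow>
        prefix (length v + l) (\<phi> x) = prefix (length v + l) (\<phi> y)"
      using cantor_unif_continuousD[OF sync_mapD(3)[OF phi]] by blast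
    have "prefix l (\<psi> w x) = prefix l (\<psi> w y)" if xy: "x \<in> cantor n" "y \<in> cantor n" "prefix j x = prefix j y" for x y
    proof (rule prefix_conc_cancel)
      show "prefix (length v + l) (v \<frown> \<psi> w x) = prefix (length v + l) (v \<frown> \<psi> w y)"
        using j[of "w \<frown> x" "w \<frown> y"] prefix_conc_same(1)[OF xy(3)] w xy v by simp
    qed
    then show ?thesis by blast
  qed
  then obtain j where j: "\<And>w x y. w \<in> lists (alph n) \<Longrightarrow> length w = k \<Longrightarrow> x \<in> cantor n \<Longrightarrow> y \<in> cantor n \<Longrightarrow>
      prefix (j w) x = prefix (j w) y \<Longrightarrow> prefix l (\<psi> w x) = prefix l (\<psi> w y)"
    by metis
  \<comment> \<open>One depth for all \<open>w\<close>: there are finitely many words of length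
    \<open>k\<close> over the alphabet.\<close>
  define L where "L = Max (j ` {w. set w \<subseteq> alph n \<and> length w = k})"
  have jL: "j w \<le> L" if "w \<in> lists (alph n)" "length w = k" for w
    unfolding L_def
  proof (rule Max_ge)
    show "finite (j ` {w. set w \<subseteq> alph n \<and> length w = k})"
      by (intro finite_imageI finite_lists_length_eq) (simp add: alph_def)
    show "j w \<in> j ` {w. set w \<subseteq> alph n \<and> length w = k}"
      using that by (auto simp: lists_eq_set)
  qed
  show ?thesis
  proof (rule sync_mapI[OF n])
    show "inj_on (\<lambda>x. \<eta> (\<phi> x)) (cantor n)"
      using sync_mapD(1,2)[OF phi] sync_mapD(1)[OF chi] by (simp add: inj_on_def)
    show "\<eta> (\<phi> x) \<in> cantor n" if "x \<in> cantor n" for x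
      using sync_mapD(2)[OF chi] sync_mapD(2)[OF phi] that by blast
    show "cantor_unif_continuous n (\<lambda>x. \<eta> (\<phi> x))"
    proof (rule cantor_unif_continuousI)
      fix m
      obtain a where a: "\<And>x y. x \<in> cantor n \<Longrightarrow> y \<in> cantor n \<Longrightarrow> prefix a x = prefix a y \<Longrightarrow> prefix m (\<eta> x) = prefix m (\<eta> y)"
        using cantor_unif_continuousD[OF sync_mapD(3)[OF chi]] by blast
      obtain b where b: "\<And>x y. x \<in> cantor n \<Longrightarrow> y \<in> cantor n \<Longrightarrow> prefix b x = prefix b y \<Longrightarrow> prefix a (\<phi> x) = prefix a (\<phi> y)"
        using cantor_unif_continuousD[OF sync_mapD(3)[OF phi]] by blast
      show "\<exists>k. \<forall>x\<in>cantor n. \<forall>y\<in>cantor n. prefix k x = prefix k y \<longrightarrow> prefix m (\<eta> (\<phi> x)) = prefix m (\<eta> (\<phi> y))"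
        using a b sync_mapD(2)[OF phi] by blast
    qed
    show "0 < k + L" using k by simp
    fix W assume W: "W \<in> lists (alph n)" "length W = k + L"
    define w where "w = take k W"
    define s where "s = drop k W"
    have ws: "W = w @ s" "w \<in> lists (alph n)" "s \<in> lists (alph n)" "length w = k" "length s = L"
      using W by (auto simp: w_def s_def in_lists_conv_set dest: in_set_takeD in_set_dropD)
    have x0: "(\<lambda>_. Plain 0) \<in> cantor n" using n by simp
    \<comment> \<open>By the choice of \<open>L\<close> the word \<open>t\<close> depends on
      \<open>w\<close> and \<open>s\<close> only; continuing with zeros is an arbitrary way to
      compute it.\<close>
    define t where "t = prefix l (\<psi> w (s \<frown> (\<lambda>_. Plain 0)))"
    have t: "t \<in> lists (alph n)" "length t = l"
      using ran[OF ws(2,4), of "s \<frown> (\<lambda>_. Plain 0)"] ws x0 by (simp_all add: t_def)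
    have split: "\<psi> w (s \<frown> x) = t \<frown> suffix l (\<psi> w (s \<frown> x))" if x: "x \<in> cantor n" for x
    proof -
      have "prefix (j w) (s \<frown> x) = prefix (j w) (s \<frown> (\<lambda>_. Plain 0))"
        using jL[OF ws(2,4)] ws(5) by simp
      then have "prefix l (\<psi> w (s \<frown> x)) = t"
        unfolding t_def using j[OF ws(2,4)] ws(3) x x0 by simp
      then show ?thesis
        by (metis prefix_suffix)
    qed
    have "forced_map n (\<lambda>x. \<eta> (\<phi> x)) W (\<lambda>x. \<theta> t (suffix l (\<psi> w (s \<frown> x))))"
      unfolding forced_map_def
    proof
      fix u assume u: "u \<in> lists (alph n)"
      obtain v where v: "\<And>x. x \<in> cantor n \<Longrightarrow> \<phi> (u \<frown> w \<frown> x) = v \<frown> \<psi> w x"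
        using k(3)[OF ws(2,4) u] by blast
      have vl: "v \<in> lists (alph n)"
        using sync_mapD(2)[OF phi, of "u \<frown> w \<frown> (\<lambda>_. Plain 0)"] v[OF x0] u ws(2) x0 by simp
      obtain v' where v': "\<And>x. x \<in> cantor n \<Longrightarrow> \<eta> (v \<frown> t \<frown> x) = v' \<frown> \<theta> t x"
        using l(3)[OF t vl] by blast
      have "\<eta> (\<phi> (u \<frown> W \<frown> x)) = v' \<frown> \<theta> t (suffix l (\<psi> w (s \<frown> x)))" if x: "x \<in> cantor n" for x
      proof -
        have sx: "s \<frown> x \<in> cantor n" using ws(3) x by simp
        have "\<phi> (u \<frown> W \<frown> x) = v \<frown> \<psi> w (s \<frown> x)"
          using v[OF sx] by (simp add: ws(1))
        also have "\<dots> = v \<frown> t \<frown> suffix l (\<psi> w (s \<frown> x))"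
          using split[OF x] by simp
        finally show ?thesis
          using v'[of "suffix l (\<psi> w (s \<frown> x))"] ran[OF ws(2,4) sx] by simp
      qed
      then show "\<exists>v. \<forall>x\<in>cantor n. \<eta> (\<phi> (u \<frown> W \<frown> x)) = v \<frown> \<theta> t (suffix l (\<psi> w (s \<frown> x)))"
        by blast
    qed
    then show "\<exists>\<psi>. forced_map n (\<lambda>x. \<eta> (\<phi> x)) W \<psi>"
      by blast
  qed
qed

section \<open>Minimal transducers of synchronizing maps\<close>

lemma minimal_no_common_prefix:
  assumes "minimal n M m0" "w \<in> lists (alph n)" "w \<noteq> []"
  shows "no_common_prefix n (state_map M (trans_word M w m0))"
proof -
  have c: "closed_states n M (tstates M)" and m0: "m0 \<in> tstates M" and g: "gcp_outputs_on n M (tstates M)"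
    using assms(1) by (auto simp: minimal_iff is_transducer_iff)
  obtain u i where w: "w = u @ [i]"
    using assms(3) by (metis append_butlast_last_id)
  then have ui: "u \<in> lists (alph n)" "i \<in> alph n"
    using assms(2) by auto
  let ?q = "trans_word M u m0"
  have q: "?q \<in> tstates M"
    using trans_word_closed[OF c m0 ui(1)] .
  have "no_common_prefix n (state_map M (ttrans M i ?q))"
  proof (rule no_common_prefix_target)
    show "is_gcp (tout M i ?q) {state_map M ?q ([i] \<frown> \<delta>) | \<delta>. \<delta> \<in> cantor n}"
      using g q ui(2) unfolding gcp_outputs_on_def by blast
    show "infinite_output M (ttrans M i ?q) \<delta>" if "\<delta> \<in> cantor n" for \<delta>
      using closed_statesD(1)[OF c closed_statesD(2)[OF c q ui(2)] that] .
  qed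
  then show ?thesis by (simp add: w)
qed

text \<open>A word \<open>w\<close> of length \<open>k\<close> leads from any state to one whose map
  is \<open>\<psi> w\<close>: both maps are normalized residuals on the same cone. In a reduced
  transducer equal maps mean equal states.\<close>

lemma minimal_sync:
  assumes n: "2 \<le> n" and M: "minimal n M m0"
    and map: "\<And>x. x \<in> cantor n \<Longrightarrow> state_map M m0 x = \<phi> x" and phi: "sync_map n \<phi>"
  shows "\<exists>k. sync_level n M k" "finite (tstates M)"
proof -
  have c: "closed_states n M (tstates M)" and m0: "m0 \<in> tstates M" and red: "reduced_on n M (tstates M)"
    and reach: "\<And>q. q \<in> tstates M \<Longrightarrow> \<exists>w\<in>lists (alph n). trans_word M w m0 = q"
    using M by (auto simp: minimal_iff is_transducer_iff)
  have x0: "(\<lambda>_. Plain 0) \<in> cantor n" using n by simp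
  obtain k \<psi> where k: "0 < k"
    "\<And>w. w \<in> lists (alph n) \<Longrightarrow> length w = k \<Longrightarrow> no_common_prefix n (\<psi> w)"
    "\<And>w u. w \<in> lists (alph n) \<Longrightarrow> length w = k \<Longrightarrow> u \<in> lists (alph n) \<Longrightarrow>
       \<exists>v. \<forall>x\<in>cantor n. \<phi> (u \<frown> w \<frown> x) = v \<frown> \<psi> w x"
    using sync_map_level[OF phi] by blast
  have psi: "state_map M (trans_word M w q) x = \<psi> w x"
    if w: "w \<in> lists (alph n)" "length w = k" and q: "q \<in> tstates M" and x: "x \<in> cantor n" for w q x
  proof -
    obtain u where u: "u \<in> lists (alph n)" "trans_word M u m0 = q"
      using reach[OF q] by blast
    have uw: "u @ w \<in> lists (alph n)" "u @ w \<noteq> []"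
      using u w k(1) by auto
    obtain v where v: "\<And>x. x \<in> cantor n \<Longrightarrow> \<phi> (u \<frown> w \<frown> x) = v \<frown> \<psi> w x"
      using k(3)[OF w u(1)] by blast
    have eq: "v \<frown> \<psi> w x = out_word M (u @ w) m0 \<frown> state_map M (trans_word M (u @ w) m0) x"
      if x: "x \<in> cantor n" for x
      using v[OF x] map[of "(u @ w) \<frown> x"] state_map_conc_closed[OF c m0 uw(1) x] uw(1) x by simp
    show ?thesis
      using no_common_prefix_cancel(2)[OF k(2)[OF w] minimal_no_common_prefix[OF M uw] x0 eq x] u by simp
  qed
  have sync: "sync_level n M k"
    unfolding sync_level_def
  proof (intro ballI impI)
    fix w q p assume w: "w \<in> lists (alph n)" "length w = k" and qp: "q \<in> tstates M" "p \<in> tstates M"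
    have "state_map M (trans_word M w q) x = state_map M (trans_word M w p) x" if "x \<in> cantor n" for x
      using psi[OF w qp(1) that] psi[OF w qp(2) that] by simp
    then show "trans_word M w q = trans_word M w p"
      using trans_word_closed[OF c qp(1) w(1)] trans_word_closed[OF c qp(2) w(1)]
      by (intro reduced_onD[OF red])
  qed
  then show "\<exists>k. sync_level n M k" ..
  \<comment> \<open>A longer word may be replaced by its last \<open>k\<close> letters, so words of
    bounded length reach all states.\<close>
  have "tstates M \<subseteq> (\<lambda>w. trans_word M w m0) ` {w. set w \<subseteq> alph n \<and> length w \<le> k}"
  proof
    fix q assume "q \<in> tstates M"
    then obtain w where w: "w \<in> lists (alph n)" "trans_word M w m0 = q"
      using reach by blast
    show "q \<in> (\<lambda>w. trans_word M w m0) ` {w. set w \<subseteq> alph n \<and> length w \<le> k}"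
    proof (cases "length w \<le> k")
      case True
      then show ?thesis
        using w by (auto simp: lists_eq_set)
    next
      case False
      let ?u = "take (length w - k) w" and ?v = "drop (length w - k) w"
      have uv: "?u \<in> lists (alph n)" "?v \<in> lists (alph n)" "length ?v = k"
        using w False by (auto simp: in_lists_conv_set dest: in_set_takeD in_set_dropD)
      have "q = trans_word M ?v (trans_word M ?u m0)"
        using w(2) by (metis append_take_drop_id trans_word_append)
      also have "\<dots> = trans_word M ?v m0"
        using sync uv trans_word_closed[OF c m0 uv(1)] m0 unfolding sync_level_def by blast
      finally show ?thesis
        using uv by (auto simp: lists_eq_set simp del: length_drop)
    qed
  qed
  moreover have "finite {w. set w \<subseteq> alph n \<and> length w \<le> k}"
    by (rule finite_lists_length_le) (simp add: alph_def)
  ultimately show "finite (tstates M)"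
    by (meson finite_imageI finite_subset)
qed

text \<open>By the last condition the transducer returns to the state of \<open>\<phi>\<close> after sufficiently many zeros.\<close>

definition core_map :: "nat \<Rightarrow> (letter word \<Rightarrow> letter word) \<Rightarrow> bool" where
  "core_map n \<phi> \<longleftrightarrow> sync_map n \<phi> \<and> no_common_prefix n \<phi> \<and>
     (\<forall>x\<in>cantor n. \<phi> ([Plain 0] \<frown> x) = [Plain 0] \<frown> \<phi> x) \<and>
     (\<exists>k. \<forall>u\<in>lists (alph n). \<exists>v. \<forall>x\<in>cantor n. \<phi> (u \<frown> replicate k (Plain 0) \<frown> x) = v \<frown> \<phi> x)"

lemma replicate_in_lists [simp]: "0 < n \<Longrightarrow> replicate k (Plain 0) \<in> lists (alph n)"
  by (auto simp: in_lists_conv_set)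

lemma core_map_zeros:
  assumes "core_map n \<phi>" "0 < n" "x \<in> cantor n"
  shows "\<phi> (replicate k (Plain 0) \<frown> x) = replicate k (Plain 0) \<frown> \<phi> x"
proof (induction k)
  case (Suc k)
  have "\<phi> (replicate (Suc k) (Plain 0) \<frown> x) = \<phi> ([Plain 0] \<frown> replicate k (Plain 0) \<frown> x)"
    by simp
  also have "\<dots> = [Plain 0] \<frown> \<phi> (replicate k (Plain 0) \<frown> x)"
    using assms unfolding core_map_def by (metis conc_in_cantor_iff replicate_in_lists)
  finally show ?case using Suc by simp
qed simp

lemma core_map_finite_sync:
  assumes n: "2 \<le> n" and r: "0 < r" and phi: "core_map n \<phi>" and lift: "rooted_lift n r \<phi> h"
  shows "finite_sync n r h"
proof -
  have s: "sync_map n \<phi>" "no_common_prefix n \<phi>"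
    using phi by (auto simp: core_map_def)
  have im: "\<phi> ` cantor n \<subseteq> cantor n"
    using sync_mapD(2)[OF s(1)] by blast
  obtain M :: "nat transducer" and m0 where M: "minimal n M m0" "\<And>x. x \<in> cantor n \<Longrightarrow> state_map M m0 x = \<phi> x"
    using ex_minimal_of_map[OF n sync_mapD(1)[OF s(1)] im cantor_unif_continuous_imp[OF sync_mapD(3)[OF s(1)]]]
    by blast
  obtain k where k: "sync_level n M k"
    using minimal_sync(1)[OF n M s(1)] by blast
  have "0 < n" using n by simp
  from ex_finite_sync[OF M(1) minimal_sync(2)[OF n M s(1)] k M(2) s(2) this r lift] show ?thesis .
qed

lemma core_map_Core:
  assumes n: "2 \<le> n" and r: "0 < r" and phi: "core_map n \<phi>" and lift: "rooted_lift n r \<phi> h"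
  shows "Core n r h = core_class n \<phi>"
proof (rule Core_eq_core_class[OF core_map_finite_sync[OF assms] _ r lift])
  show n0: "0 < n" using n by simp
  have s: "sync_map n \<phi>" "no_common_prefix n \<phi>"
    using phi by (auto simp: core_map_def)
  then show "no_common_prefix n \<phi>" by simp
  show "inj_on h (rooted_cantor n r)"
  proof (rule inj_onI)
    fix y z assume yz: "y \<in> rooted_cantor n r" "z \<in> rooted_cantor n r" "h y = h z"
    obtain a x where y: "y = [a] \<frown> x" "a \<in> dots r" "x \<in> cantor n"
      using yz(1) by (auto simp: rooted_cantor_def)
    obtain b x' where z: "z = [b] \<frown> x'" "b \<in> dots r" "x' \<in> cantor n"
      using yz(2) by (auto simp: rooted_cantor_def)
    have "[a] \<frown> \<phi> x = [b] \<frown> \<phi> x'"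
      using yz(3) lift y z unfolding rooted_lift_def by simp
    then have "a = b" "\<phi> x = \<phi> x'"
      by simp_all
    then show "y = z"
      using sync_mapD(1)[OF s(1)] y z by (simp add: inj_on_eq_iff)
  qed
  show "\<exists>w\<in>lists (alph n). k \<le> length w \<and> (\<exists>v. \<forall>x\<in>cantor n. \<phi> (w \<frown> x) = v \<frown> \<phi> x)" for k
    using core_map_zeros[OF phi n0] n0 by (intro bexI[of _ "replicate k (Plain 0)"]) auto
qed

text \<open>This removes the arbitrariness of the states picked by \<open>core_mult\<close>: the map
  of any state is a residual of \<open>\<phi>\<close>, hence synchronizing, and after suitably many
  zeros it is \<open>\<phi>\<close> behind a fixed word.\<close>

lemma core_class_state:
  assumes n: "2 \<le> n" and phi: "core_map n \<phi>" and C: "C \<in> core_class n \<phi>" and q: "q \<in> tstates C"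
  shows "sync_map n (state_map C q)"
    and "\<exists>k. \<exists>t\<in>lists (alph n). \<forall>x\<in>cantor n. state_map C q (replicate k (Plain 0) \<frown> x) = t \<frown> \<phi> x"
proof -
  have n0: "0 < n" using n by simp
  have x0: "(\<lambda>_. Plain 0) \<in> cantor n" using n0 by simp
  have ct: "core_transducer n C" using C by (simp add: core_class_def)
  note c = core_transducerD(2)[OF ct]
  obtain p where p: "p \<in> tstates C" "\<And>x. x \<in> cantor n \<Longrightarrow> state_map C p x = \<phi> x"
    using C by (auto simp: core_class_def)
  obtain w where w: "w \<in> lists (alph n)" "trans_word C w p = q"
    using core_transducerD(7)[OF ct p(1) q] by blast
  have eq: "\<phi> (w \<frown> x) = out_word C w p \<frown> state_map C q x" if x: "x \<in> cantor n" for x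
    using state_map_conc_closed[OF c p(1) w(1) x] p(2)[of "w \<frown> x"] w x by simp
  have s: "sync_map n \<phi>" "no_common_prefix n \<phi>"
    using phi by (auto simp: core_map_def)
  show "sync_map n (state_map C q)"
    by (rule sync_map_residual[OF n s(1) w(1) eq])
  obtain k where k: "\<forall>u\<in>lists (alph n). \<exists>v. \<forall>x\<in>cantor n. \<phi> (u \<frown> replicate k (Plain 0) \<frown> x) = v \<frown> \<phi> x"
    using phi unfolding core_map_def by blast
  then obtain v where v: "\<And>x. x \<in> cantor n \<Longrightarrow> \<phi> (w \<frown> replicate k (Plain 0) \<frown> x) = v \<frown> \<phi> x"
    using w(1) by blast
  have *: "v \<frown> \<phi> x = out_word C w p \<frown> state_map C q (replicate k (Plain 0) \<frown> x)" if x: "x \<in> cantor n" for x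
    using eq[of "replicate k (Plain 0) \<frown> x"] v[OF x] x n0 by simp
  have len: "length (out_word C w p) \<le> length v"
    using no_common_prefix_length[OF s(2) x0 *] .
  let ?t = "drop (length (out_word C w p)) v"
  have st: "state_map C q (replicate k (Plain 0) \<frown> x) = ?t \<frown> \<phi> x" if x: "x \<in> cantor n" for x
  proof (rule conc_compare[OF *[OF x, symmetric] len])
    fix r assume "v = out_word C w p @ r" "state_map C q (replicate k (Plain 0) \<frown> x) = r \<frown> \<phi> x"
    then show ?thesis by simp
  qed
  moreover have "?t \<in> lists (alph n)"
    using state_map_in_cantor[OF c q, of "replicate k (Plain 0) \<frown> (\<lambda>_. Plain 0)"] st[OF x0] x0 n0 by simp
  ultimately show "\<exists>k. \<exists>t\<in>lists (alph n). \<forall>x\<in>cantor n. state_map C q (replicate k (Plain 0) \<frown> x) = t \<frown> \<phi> x"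
    by blast
qed

text \<open>From the state of \<open>\<phi>\<close>, read a word leading to the state of
  \<open>\<psi>\<close> and then \<open>k\<close> zeros. These zeros restore \<open>\<phi>\<close>,
  whereas \<open>\<psi>\<close> copies them to the output; cancelling the fixed words gives
  equality.\<close>

lemma core_class_inj:
  assumes n: "0 < n" and "core_map n \<phi>" "core_map n \<psi>" and D: "D \<in> core_class n \<phi>" "D \<in> core_class n \<psi>"
    and x: "x \<in> cantor n"
  shows "\<phi> x = \<psi> x"
proof -
  have x0: "(\<lambda>_. Plain 0) \<in> cantor n" using n by simp
  have ct: "core_transducer n D" using D by (simp add: core_class_def)
  note c = core_transducerD(2)[OF ct]
  obtain p where p: "p \<in> tstates D" "\<And>x. x \<in> cantor n \<Longrightarrow> state_map D p x = \<phi> x"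
    using D by (auto simp: core_class_def)
  obtain q where q: "q \<in> tstates D" "\<And>x. x \<in> cantor n \<Longrightarrow> state_map D q x = \<psi> x"
    using D by (auto simp: core_class_def)
  obtain w where w: "w \<in> lists (alph n)" "trans_word D w p = q"
    using core_transducerD(7)[OF ct p(1) q(1)] by blast
  have s: "no_common_prefix n \<phi>" "no_common_prefix n \<psi>"
    using assms by (auto simp: core_map_def)
  obtain k where k: "\<forall>u\<in>lists (alph n). \<exists>v. \<forall>x\<in>cantor n. \<phi> (u \<frown> replicate k (Plain 0) \<frown> x) = v \<frown> \<phi> x"
    using assms(2) unfolding core_map_def by blast
  then obtain v where v: "\<And>x. x \<in> cantor n \<Longrightarrow> \<phi> (w \<frown> replicate k (Plain 0) \<frown> x) = v \<frown> \<phi> x"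
    using w(1) by blast
  have "v \<frown> \<phi> x = (out_word D w p @ replicate k (Plain 0)) \<frown> \<psi> x" if x: "x \<in> cantor n" for x
  proof -
    have r: "replicate k (Plain 0) \<frown> x \<in> cantor n" using x n by simp
    have "v \<frown> \<phi> x = state_map D p (w \<frown> replicate k (Plain 0) \<frown> x)"
      using v[OF x] p(2)[of "w \<frown> replicate k (Plain 0) \<frown> x"] w(1) r by simp
    also have "\<dots> = out_word D w p \<frown> \<psi> (replicate k (Plain 0) \<frown> x)"
      using state_map_conc_closed[OF c p(1) w(1) r] w(2) q(2)[OF r] by simp
    finally show ?thesis
      using core_map_zeros[OF assms(3) n x] by simp
  qed
  from no_common_prefix_cancel(2)[OF s x0 this x] show ?thesis .
qed

section \<open>Products and inverses of cores\<close>

lemma composite_minimal: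
  assumes n: "2 \<le> n" and C: "core_transducer n C" "q1 \<in> tstates C" and D: "core_transducer n D" "q2 \<in> tstates D"
  shows "\<exists>(A :: nat transducer) q0. minimal n A q0 \<and>
    (\<forall>\<delta>\<in>cantor n. state_map A q0 \<delta> = state_map D q2 (state_map C q1 \<delta>))"
proof (rule ex_minimal_of_map[OF n])
  note sC = state_map_in_cantor[OF core_transducerD(2)[OF C(1)] C(2)]
  note sD = state_map_in_cantor[OF core_transducerD(2)[OF D(1)] D(2)]
  show "inj_on (\<lambda>x. state_map D q2 (state_map C q1 x)) (cantor n)"
    using core_transducerD(6)[OF C] core_transducerD(6)[OF D] sC by (simp add: inj_on_def)
  show "(\<lambda>x. state_map D q2 (state_map C q1 x)) ` cantor n \<subseteq> cantor n"
    using sC sD by blast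
  show "cantor_continuous n (\<lambda>x. state_map D q2 (state_map C q1 x))"
    using state_map_continuous[OF core_transducerD(2)[OF C(1)] C(2)]
      state_map_continuous[OF core_transducerD(2)[OF D(1)] D(2)] sC by (rule cantor_continuous_comp)
qed

text \<open>The \<open>SOME\<close> in \<open>core_mult\<close> commits to no particular
  representatives or states, so only its defining property is available. That it can be satisfied is
  \<open>composite_minimal\<close>.\<close>

lemma core_mult_some:
  assumes n: "2 \<le> n" and G: "C0 \<in> G" and H: "D0 \<in> H"
    and ct: "\<And>C. C \<in> G \<Longrightarrow> core_transducer n C" "\<And>D. D \<in> H \<Longrightarrow> core_transducer n D"
  obtains A C D q1 q2 q0 where "core_mult n G H = transducer_class n (core n A)"
    "C \<in> G" "D \<in> H" "q1 \<in> tstates C" "q2 \<in> tstates D" "minimal n A q0"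
    "\<And>\<delta>. \<delta> \<in> cantor n \<Longrightarrow> state_map A q0 \<delta> = state_map D q2 (state_map C q1 \<delta>)"
proof -
  let ?P = "\<lambda>A :: nat transducer. \<exists>C\<in>G. \<exists>D\<in>H. \<exists>q1\<in>tstates C. \<exists>q2\<in>tstates D. \<exists>q0. minimal n A q0 \<and>
        (\<forall>\<delta>\<in>cantor n. state_map A q0 \<delta> = state_map D q2 (state_map C q1 \<delta>))"
  obtain q1 where q1: "q1 \<in> tstates C0"
    using core_transducerD(3)[OF ct(1)[OF G]] by blast
  obtain q2 where q2: "q2 \<in> tstates D0"
    using core_transducerD(3)[OF ct(2)[OF H]] by blast
  have "\<exists>A. ?P A"
    using composite_minimal[OF n ct(1)[OF G] q1 ct(2)[OF H] q2] G H q1 q2 by blast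
  then have "?P (SOME A. ?P A)"
    by (rule someI_ex)
  then show thesis
    using that[of "SOME A. ?P A"] unfolding core_mult_def by blast
qed

lemma core_mult_core_class:
  assumes n: "2 \<le> n" and phi: "core_map n \<phi>" and psi: "core_map n \<psi>"
    and ncp: "no_common_prefix n (\<lambda>x. \<psi> (\<phi> x))"
    and ne: "core_class n \<phi> \<noteq> {}" "core_class n \<psi> \<noteq> {}"
  shows "core_mult n (core_class n \<phi>) (core_class n \<psi>) = core_class n (\<lambda>x. \<psi> (\<phi> x))"
proof -
  have n0: "0 < n" using n by simp
  have x0: "(\<lambda>_. Plain 0) \<in> cantor n" using n0 by simp
  have ct: "core_transducer n C" if "C \<in> core_class n \<phi> \<or> C \<in> core_class n \<psi>" for C
    using that by (auto simp: core_class_def)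
  obtain C0 D0 where "C0 \<in> core_class n \<phi>" "D0 \<in> core_class n \<psi>"
    using ne by blast
  then obtain A C D q1 q2 q0 where A: "core_mult n (core_class n \<phi>) (core_class n \<psi>) = transducer_class n (core n A)"
    and C: "C \<in> core_class n \<phi>" "q1 \<in> tstates C" and D: "D \<in> core_class n \<psi>" "q2 \<in> tstates D"
    and min: "minimal n A q0"
    and map: "\<And>\<delta>. \<delta> \<in> cantor n \<Longrightarrow> state_map A q0 \<delta> = state_map D q2 (state_map C q1 \<delta>)"
    using core_mult_some[OF n, of C0 "core_class n \<phi>" D0 "core_class n \<psi>"] ct by metis
  have cA: "closed_states n A (tstates A)" "q0 \<in> tstates A"
    using min by (auto simp: minimal_iff is_transducer_iff)
  have cC: "closed_states n C (tstates C)" and cD: "closed_states n D (tstates D)"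
    using ct C(1) D(1) core_transducerD(2) by blast+
  have sync: "sync_map n (\<lambda>x. state_map D q2 (state_map C q1 x))"
    using core_class_state(1)[OF n phi C] core_class_state(1)[OF n psi D] by (rule sync_map_comp[OF n])
  obtain k where k: "sync_level n A k"
    using minimal_sync(1)[OF n min map sync] by blast
  have inj: "inj_on (state_map A q0) (cantor n)"
    using sync_mapD(1)[OF sync] map by (simp cong: inj_on_cong)
  note core = core_is_core_transducer[OF min k n0 inj]
  let ?z = "\<lambda>k. replicate k (Plain 0)"
  obtain a t where t: "t \<in> lists (alph n)" "\<And>x. x \<in> cantor n \<Longrightarrow> state_map C q1 (?z a \<frown> x) = t \<frown> \<phi> x"
    using core_class_state(2)[OF n phi C] by blast
  let ?p = "trans_word D t q2"
  have p: "?p \<in> tstates D"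
    using trans_word_closed[OF cD D(2) t(1)] .
  obtain b s where s: "s \<in> lists (alph n)" "\<And>x. x \<in> cantor n \<Longrightarrow> state_map D ?p (?z b \<frown> x) = s \<frown> \<psi> x"
    using core_class_state(2)[OF n psi D(1) p] by blast
  have phi_in: "\<phi> x \<in> cantor n" if "x \<in> cantor n" for x
    using phi that sync_mapD(2) unfolding core_map_def by blast
  \<comment> \<open>\<open>a\<close> zeros bring \<open>C\<close> to \<open>\<phi>\<close>, with
    output \<open>t\<close>. The other zeros pass through \<open>\<phi>\<close> unchanged, and
    \<open>b\<close> of them bring \<open>D\<close> from the state reached by \<open>t\<close> to
    \<open>\<psi>\<close>. The last \<open>k\<close> zeros guarantee that the word is long enough to
    end in the core of \<open>A\<close>.\<close>
  let ?w = "?z (a + b + k)"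
  have w: "?w \<in> lists (alph n)" using n0 by simp
  have eq: "(out_word D t q2 @ s @ ?z k) \<frown> \<psi> (\<phi> x) = out_word A ?w q0 \<frown> state_map A (trans_word A ?w q0) x"
    if x: "x \<in> cantor n" for x
  proof -
    have kx: "?z k \<frown> x \<in> cantor n" "?z b \<frown> ?z k \<frown> x \<in> cantor n" "?w \<frown> x \<in> cantor n"
      using x n0 by simp_all
    have "state_map C q1 (?w \<frown> x) = state_map C q1 (?z a \<frown> ?z b \<frown> ?z k \<frown> x)"
      by (simp add: replicate_add)
    also have "\<dots> = t \<frown> \<phi> (?z b \<frown> ?z k \<frown> x)"
      using t(2)[OF kx(2)] .
    also have "\<phi> (?z b \<frown> ?z k \<frown> x) = ?z b \<frown> ?z k \<frown> \<phi> x"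
      using core_map_zeros[OF phi n0] kx(1) x by metis
    finally have "state_map C q1 (?w \<frown> x) = t \<frown> ?z b \<frown> ?z k \<frown> \<phi> x" .
    moreover have "state_map D q2 (t \<frown> ?z b \<frown> ?z k \<frown> \<phi> x) = out_word D t q2 \<frown> state_map D ?p (?z b \<frown> ?z k \<frown> \<phi> x)"
      using phi_in[OF x] n0 by (intro state_map_conc_closed[OF cD D(2) t(1)]) simp
    moreover have "state_map D ?p (?z b \<frown> ?z k \<frown> \<phi> x) = s \<frown> \<psi> (?z k \<frown> \<phi> x)"
      using phi_in[OF x] n0 by (intro s(2)) simp
    moreover have "\<psi> (?z k \<frown> \<phi> x) = ?z k \<frown> \<psi> (\<phi> x)"
      using core_map_zeros[OF psi n0 phi_in[OF x]] .
    ultimately have "state_map D q2 (state_map C q1 (?w \<frown> x)) = (out_word D t q2 @ s @ ?z k) \<frown> \<psi> (\<phi> x)"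
      by (simp only: conc_conc append_assoc)
    then show ?thesis
      using map[OF kx(3)] state_map_conc_closed[OF cA w x] by simp
  qed
  have pA: "trans_word A ?w q0 \<in> tstates (core n A)"
    by (rule core(2)[OF w _ cA(2)]) simp
  have sm: "state_map (core n A) = state_map A"
    by (rule transducer_cong; simp add: core_def)
  have "no_common_prefix n (state_map A (trans_word A ?w q0))"
    using core_no_common_prefix[OF n0 core(1) pA] sm by simp
  then have "state_map (core n A) (trans_word A ?w q0) x = \<psi> (\<phi> x)" if "x \<in> cantor n" for x
    using no_common_prefix_cancel(2)[OF ncp _ x0 eq that] sm by simp
  then have "core n A \<in> core_class n (\<lambda>x. \<psi> (\<phi> x))"
    unfolding core_class_def using core(1) pA by blast
  then show ?thesis
    unfolding A by (rule transducer_class_eq_core_class[OF n0])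
qed

text \<open>\<open>m_inv\<close> being a definite description over the whole carrier, inverses have to be unique among
  all cores.\<close>

lemma core_mult_right_inverse:
  assumes n: "2 \<le> n" and phi: "core_map n \<phi>" and psi: "core_map n \<psi>"
    and inv: "\<And>x. x \<in> cantor n \<Longrightarrow> \<phi> (\<psi> x) = x"
    and ne: "core_class n \<phi> \<noteq> {}" and Y: "core_transducer n Y"
    and one: "core_mult n (core_class n \<phi>) (transducer_class n Y) = core_class n (\<lambda>x. x)"
  shows "transducer_class n Y = core_class n \<psi>"
proof -
  have n0: "0 < n" using n by simp
  have x0: "(\<lambda>_. Plain 0) \<in> cantor n" using n0 by simp
  have ctC: "core_transducer n C" if "C \<in> core_class n \<phi>" for C
    using that by (auto simp: core_class_def)
  have ctD: "core_transducer n D" if "D \<in> transducer_class n Y" for D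
    using that tmorph_core_transducer[OF _ _ Y]
    by (auto simp: transducer_class_def transducer_iso_alt bij_betw_def)
  obtain C0 where "C0 \<in> core_class n \<phi>"
    using ne by blast
  then obtain A C D q1 q2 q0 where A: "core_mult n (core_class n \<phi>) (transducer_class n Y) = transducer_class n (core n A)"
    and C: "C \<in> core_class n \<phi>" "q1 \<in> tstates C" and D: "D \<in> transducer_class n Y" "q2 \<in> tstates D"
    and min: "minimal n A q0"
    and map: "\<And>\<delta>. \<delta> \<in> cantor n \<Longrightarrow> state_map A q0 \<delta> = state_map D q2 (state_map C q1 \<delta>)"
    using core_mult_some[OF n _ transducer_class_self, of C0 "core_class n \<phi>" n Y] ctC ctD by metis
  have cA: "closed_states n A (tstates A)" "q0 \<in> tstates A"
    using min by (auto simp: minimal_iff is_transducer_iff)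
  have cC: "closed_states n C (tstates C)" and cD: "closed_states n D (tstates D)"
    using ctC[OF C(1)] ctD[OF D(1)] core_transducerD(2) by blast+
  \<comment> \<open>The product being the class of the identity, some core state \<open>p\<close> of
    the composite induces the identity; the word \<open>?W\<close> below leads to it from
    \<open>q0\<close>.\<close>
  have "core n A \<in> core_class n (\<lambda>x. x)"
    using transducer_class_self[of "core n A" n] one A by simp
  then obtain p where p: "p \<in> tstates (core n A)" "\<And>x. x \<in> cantor n \<Longrightarrow> state_map (core n A) p x = x"
    by (auto simp: core_class_def)
  have sm: "state_map (core n A) = state_map A"
    by (rule transducer_cong; simp add: core_def)
  obtain w q where wq: "p = trans_word A w q" "w \<in> lists (alph n)" "q \<in> tstates A"
    using p(1) unfolding core_def by auto
  obtain u where u: "u \<in> lists (alph n)" "trans_word A u q0 = q"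
    using min wq(3) unfolding minimal_iff by blast
  let ?W = "u @ w"
  have W: "?W \<in> lists (alph n)" "trans_word A ?W q0 = p"
    using wq u by auto
  let ?c = "trans_word C ?W q1" and ?z = "\<lambda>k. replicate k (Plain 0)"
  have c: "?c \<in> tstates C"
    using trans_word_closed[OF cC C(2) W(1)] .
  obtain a t where t: "t \<in> lists (alph n)" "\<And>x. x \<in> cantor n \<Longrightarrow> state_map C ?c (?z a \<frown> x) = t \<frown> \<phi> x"
    using core_class_state(2)[OF n phi C(1) c] by blast
  let ?T = "out_word C ?W q1 @ t"
  have T: "?T \<in> lists (alph n)"
    using t(1) out_word_in_lists[OF cC C(2) W(1)] by simp
  let ?d = "trans_word D ?T q2"
  have d: "?d \<in> tstates D"
    using trans_word_closed[OF cD D(2) T] .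
  have psi_in: "\<psi> x \<in> cantor n" if "x \<in> cantor n" for x
    using psi that sync_mapD(2) unfolding core_map_def by blast
  \<comment> \<open>Fed with \<open>?W\<close>, \<open>a\<close> zeros and \<open>\<psi> y\<close>,
    the transducer \<open>C\<close> hands \<open>?T\<close> followed by \<open>y\<close> to
    \<open>D\<close>, since \<open>\<phi>\<close> undoes \<open>\<psi>\<close>. The composite acts
    as the identity behind \<open>?W\<close>, so \<open>D\<close> has to turn \<open>y\<close> into
    \<open>\<psi> y\<close>, up to fixed words.\<close>
  have eq: "(out_word A ?W q0 @ ?z a) \<frown> \<psi> y = out_word D ?T q2 \<frown> state_map D ?d y" if y: "y \<in> cantor n" for y
  proof -
    let ?x = "?z a \<frown> \<psi> y"
    have x: "?x \<in> cantor n" "?W \<frown> ?x \<in> cantor n"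
      using psi_in[OF y] n0 W(1) by simp_all
    have "state_map C q1 (?W \<frown> ?x) = out_word C ?W q1 \<frown> state_map C ?c ?x"
      by (rule state_map_conc_closed[OF cC C(2) W(1) x(1)])
    also have "state_map C ?c ?x = t \<frown> y"
      using t(2)[OF psi_in[OF y]] inv[OF y] by simp
    finally have "state_map C q1 (?W \<frown> ?x) = ?T \<frown> y"
      by simp
    then have "state_map A q0 (?W \<frown> ?x) = out_word D ?T q2 \<frown> state_map D ?d y"
      using map[OF x(2)] state_map_conc_closed[OF cD D(2) T y] by simp
    moreover have "state_map A q0 (?W \<frown> ?x) = out_word A ?W q0 \<frown> ?x"
      using state_map_conc_closed[OF cA W(1) x(1)] W(2) p(2)[OF x(1)] sm by simp
    ultimately show ?thesis by simp
  qed
  have ncp: "no_common_prefix n \<psi>"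
    using psi by (simp add: core_map_def)
  have "\<psi> y = state_map D ?d y" if y: "y \<in> cantor n" for y
    using no_common_prefix_cancel(2)[OF ncp core_no_common_prefix[OF n0 ctD[OF D(1)] d] x0 eq y] .
  moreover obtain f where f: "bij_betw f (tstates Y) (tstates D)" "tmorph n f Y D"
    using D(1) by (auto simp: transducer_class_def transducer_iso_alt)
  moreover obtain y0 where y0: "y0 \<in> tstates Y" "f y0 = ?d"
    using f(1) d by (metis bij_betw_imp_surj_on imageE)
  ultimately have "\<forall>x\<in>cantor n. state_map Y y0 x = \<psi> x"
    using tmorph_state_map(1)[OF f(2) core_transducerD(2)[OF Y] y0(1)] by simp
  then have "Y \<in> core_class n \<psi>"
    unfolding core_class_def using Y y0(1) by blast
  then show ?thesis
    by (rule transducer_class_eq_core_class[OF n0])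
qed

section \<open>Thompson's group as dyadic cone maps\<close>

primrec bval :: "bool list \<Rightarrow> real" where
  "bval [] = 0"
| "bval (b # w) = (of_bool b + bval w) / 2"

lemma bval_nonneg [simp]: "0 \<le> bval w"
  by (induction w) auto

lemma bval_upper: "bval w + 1 / 2 ^ length w \<le> 1"
proof (induction w)
  case (Cons b w)
  have "bval (b # w) + 1 / 2 ^ length (b # w) = (of_bool b + (bval w + 1 / 2 ^ length w)) / 2"
    by (simp add: field_simps)
  also have "\<dots> \<le> 1"
    using Cons by (cases b) (simp_all del: add_divide_distrib)
  finally show ?case .
qed simp

lemma bval_append: "bval (u @ v) = bval u + bval v / 2 ^ length u"
  by (induction u) (auto simp: field_simps)

lemma bval_replicate_False [simp]: "bval (replicate k False) = 0"
  by (induction k) auto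

lemma bval_replicate_True: "bval (replicate k True) = 1 - 1 / 2 ^ k"
  by (induction k) (auto simp: field_simps)

lemma bval_less_1: "bval w < 1"
proof -
  have "0 < 1 / (2::real) ^ length w" by simp
  then show ?thesis using bval_upper[of w] by linarith
qed

lemma bval_inj: "length u = length v \<Longrightarrow> bval u = bval v \<Longrightarrow> u = v"
proof (induction u v rule: list_induct2)
  case (Cons a u b v)
  have "of_bool a + bval u = of_bool b + bval v"
    using Cons.prems by simp
  then have "a = b" "bval u = bval v"
    using bval_less_1[of u] bval_less_1[of v] bval_nonneg[of u] bval_nonneg[of v]
    by (cases a; cases b; simp)+
  then show ?case using Cons.IH by simp
qed simp

lemma bval_int: "\<exists>m::int. bval w * 2 ^ length w = of_int m"
proof (induction w)
  case Nil
  show ?case by (rule exI[of _ 0]) simp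
next
  case (Cons b w)
  then obtain m :: int where m: "bval w * 2 ^ length w = of_int m" by auto
  show ?case
    by (rule exI[of _ "of_bool b * 2 ^ length w + m"]) (simp add: m[symmetric] field_simps)
qed

lemma ex_bval: "c < 2 ^ L \<Longrightarrow> \<exists>w. length w = L \<and> bval w = real c / 2 ^ L"
proof (induction L arbitrary: c)
  case 0
  then show ?case by simp
next
  case (Suc L)
  let ?b = "2 ^ L \<le> c"
  define d where "d = (if ?b then c - 2 ^ L else c)"
  have "d < 2 ^ L" and c: "real c = of_bool ?b * 2 ^ L + real d"
    using Suc.prems by (auto simp: d_def of_nat_diff)
  then obtain w where w: "length w = L" "bval w = real d / 2 ^ L"
    using Suc.IH by blast
  have "bval (?b # w) = real c / 2 ^ Suc L"
    unfolding c by (simp add: w field_simps)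
  then show ?case
    using w(1) by (intro exI[of _ "?b # w"]) simp
qed

lemma bval_cover:
  fixes x :: real
  assumes "0 \<le> x" "x \<le> 1"
  shows "\<exists>w z. length w = N \<and> 0 \<le> z \<and> z \<le> 1 \<and> x = bval w + z / 2 ^ N"
  using assms
proof (induction N arbitrary: x)
  case 0
  then show ?case by auto
next
  case (Suc N)
  let ?b = "1 / 2 < x"
  have "0 \<le> 2 * x - of_bool ?b" "2 * x - of_bool ?b \<le> 1"
    using Suc.prems by (auto simp: of_bool_def)
  then obtain w z where w: "length w = N" "0 \<le> z" "z \<le> 1" "2 * x - of_bool ?b = bval w + z / 2 ^ N"
    using Suc.IH by blast
  have "2 * x = of_bool ?b + (bval w + z / 2 ^ N)"
    using w(4) by simp
  then have "x = bval (?b # w) + z / 2 ^ Suc N"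
    by (simp add: field_simps)
  then show ?case
    using w by (intro exI[of _ "?b # w"] exI[of _ z]) simp
qed

lemma point_in_unit:
  assumes "0 \<le> z" "z \<le> 1"
  shows "0 \<le> bval w + z / 2 ^ length w" "bval w + z / 2 ^ length w \<le> 1"
proof -
  show "0 \<le> bval w + z / 2 ^ length w" using assms by simp
  have "z / 2 ^ length w \<le> 1 / 2 ^ length w"
    using assms by (intro divide_right_mono) auto
  then show "bval w + z / 2 ^ length w \<le> 1"
    using bval_upper[of w] by linarith
qed

lemma replicate_conc_const [simp]: "replicate k a \<frown> (\<lambda>_. a) = (\<lambda>_. a)"
  by (auto simp: conc_def)

text \<open>Appending \<open>False\<close> keeps the left endpoint, so both words can be padded to a
  common length, where \<open>bval\<close> is injective. With right endpoints and
  \<open>True\<close> the same argument gives \<open>bval_upper_eq_tail\<close>.\<close>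

lemma bval_eq_tail:
  assumes "bval u = bval v"
  shows "u \<frown> (\<lambda>_. False) = v \<frown> (\<lambda>_. False)"
proof -
  have "u @ replicate (length v) False = v @ replicate (length u) False"
    by (rule bval_inj) (simp_all add: bval_append assms)
  then have "(u @ replicate (length v) False) \<frown> (\<lambda>_. False) = (v @ replicate (length u) False) \<frown> (\<lambda>_. False)"
    by simp
  then show ?thesis
    by (simp flip: conc_conc)
qed

lemma bval_upper_eq_tail:
  assumes "bval u + 1 / 2 ^ length u = bval v + 1 / 2 ^ length v"
  shows "u \<frown> (\<lambda>_. True) = v \<frown> (\<lambda>_. True)"
proof -
  have *: "bval (w @ replicate k True) = bval w + 1 / 2 ^ length w - 1 / 2 ^ (length w + k)" for w k
    by (simp add: bval_append bval_replicate_True field_simps power_add)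
  have "u @ replicate (length v) True = v @ replicate (length u) True"
    by (rule bval_inj) (simp_all add: * assms add.commute)
  then have "(u @ replicate (length v) True) \<frown> (\<lambda>_. True) = (v @ replicate (length u) True) \<frown> (\<lambda>_. True)"
    by simp
  then show ?thesis
    by (simp flip: conc_conc)
qed

text \<open>Midpoints encode the nodes of the binary tree: each dyadic number strictly between
  \<open>0\<close> and \<open>1\<close> is the midpoint of exactly one standard dyadic interval.
  Elements of \<open>F\<close> permute these numbers, and so act on the nodes.\<close>

definition bmid :: "bool list \<Rightarrow> real" where
  "bmid w = bval (w @ [True])"

lemma bmid_alt: "bmid w = bval w + 1 / 2 ^ Suc (length w)"
  by (simp add: bmid_def bval_append)

lemma bmid_append: "bmid (u @ v) = bval u + bmid v / 2 ^ length u"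
  by (simp add: bmid_def bval_append field_simps)

lemma bmid_bounds: "0 < bmid w" "bmid w < 1"
proof -
  show "0 < bmid w"
    unfolding bmid_alt by (intro add_nonneg_pos) auto
  show "bmid w < 1"
    unfolding bmid_def by (rule bval_less_1)
qed

lemma bmid_inj: "bmid u = bmid v \<Longrightarrow> u = v"
proof -
  assume "bmid u = bmid v"
  then have eq: "(u @ [True]) \<frown> (\<lambda>_. False) = (v @ [True]) \<frown> (\<lambda>_. False)"
    unfolding bmid_def by (rule bval_eq_tail)
  have *: "((w @ [True]) \<frown> (\<lambda>_. False)) i = (if i < length w then w ! i else i = length w)" for w i
    by (auto simp: conc_def nth_append)
  have lt: "\<not> length a < length b" if "(a @ [True]) \<frown> (\<lambda>_. False) = (b @ [True]) \<frown> (\<lambda>_. False)" for a b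
    using fun_cong[OF that, of "length b"] by (auto simp: *)
  have "length u = length v"
    using lt[OF eq] lt[OF eq[symmetric]] by simp
  then show "u = v"
    using eq by simp
qed

text \<open>\<open>f\<close> maps the standard dyadic interval of \<open>u\<close> affinely onto that of \<open>v\<close>.\<close>

definition dyadic_cone :: "(real \<Rightarrow> real) \<Rightarrow> bool list \<Rightarrow> bool list \<Rightarrow> bool" where
  "dyadic_cone f u v \<longleftrightarrow> (\<forall>z\<in>{0..1}. f (bval u + z / 2 ^ length u) = bval v + z / 2 ^ length v)"

lemma dyadic_coneD: "dyadic_cone f u v \<Longrightarrow> 0 \<le> z \<Longrightarrow> z \<le> 1 \<Longrightarrow> f (bval u + z / 2 ^ length u) = bval v + z / 2 ^ length v"
  by (simp add: dyadic_cone_def)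

lemma dyadic_cone_left: "dyadic_cone f u v \<Longrightarrow> f (bval u) = bval v"
  using dyadic_coneD[of f u v 0] by simp

lemma dyadic_cone_right: "dyadic_cone f u v \<Longrightarrow> f (bval u + 1 / 2 ^ length u) = bval v + 1 / 2 ^ length v"
  using dyadic_coneD[of f u v 1] by simp

lemma dyadic_cone_append:
  assumes "dyadic_cone f u v"
  shows "dyadic_cone f (u @ t) (v @ t)"
  unfolding dyadic_cone_def
proof
  fix z :: real assume z: "z \<in> {0..1}"
  have "f (bval u + (bval t + z / 2 ^ length t) / 2 ^ length u) = bval v + (bval t + z / 2 ^ length t) / 2 ^ length v"
    using z point_in_unit[of z t] by (intro dyadic_coneD[OF assms]) auto
  then show "f (bval (u @ t) + z / 2 ^ length (u @ t)) = bval (v @ t) + z / 2 ^ length (v @ t)"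
    by (simp add: bval_append add_divide_distrib power_add add.assoc mult.commute)
qed

lemma dyadic_cone_unique:
  assumes "dyadic_cone f u v" "dyadic_cone f u w"
  shows "v = w"
proof -
  have val: "bval v = bval w"
    using dyadic_cone_left[OF assms(1)] dyadic_cone_left[OF assms(2)] by simp
  then have "1 / (2::real) ^ length v = 1 / 2 ^ length w"
    using dyadic_cone_right[OF assms(1)] dyadic_cone_right[OF assms(2)] by simp
  then have "length v = length w"
    by simp
  then show ?thesis using val by (rule bval_inj)
qed

lemma dyadic_cone_comp:
  assumes "dyadic_cone f u v" "dyadic_cone g v w"
  shows "dyadic_cone (compose {0..1} g f) u w"
  unfolding dyadic_cone_def
proof
  fix z :: real assume z: "z \<in> {0..1}"
  then show "compose {0..1} g f (bval u + z / 2 ^ length u) = bval w + z / 2 ^ length w"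
    using dyadic_coneD[OF assms(1), of z] dyadic_coneD[OF assms(2), of z] point_in_unit[of z u]
    by (simp add: compose_def)
qed

lemma dyadic_cone_inverse:
  assumes "dyadic_cone f u v" "\<And>x. 0 \<le> x \<Longrightarrow> x \<le> 1 \<Longrightarrow> g (f x) = x"
  shows "dyadic_cone g v u"
  unfolding dyadic_cone_def
proof
  fix z :: real assume z: "z \<in> {0..1}"
  then show "g (bval v + z / 2 ^ length v) = bval u + z / 2 ^ length u"
    using dyadic_coneD[OF assms(1), of z, symmetric] assms(2) point_in_unit[of z u] by simp
qed

section \<open>Elements of \<open>F\<close> as maps between dyadic cones\<close>

definition unit_homeo :: "(real \<Rightarrow> real) \<Rightarrow> bool" where
  "unit_homeo f \<longleftrightarrow> f \<in> extensional {0..1} \<and> (\<exists>g. homeomorphism {0..1} {0..1} f g) \<and> strict_mono_on {0..1} f"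

lemma unit_homeoD:
  assumes "unit_homeo f"
  shows "0 \<le> x \<Longrightarrow> x \<le> 1 \<Longrightarrow> 0 \<le> f x \<and> f x \<le> 1" "f 0 = 0" "f 1 = 1" "f ` {0..1} = {0..1}"
    "0 \<le> x \<Longrightarrow> x < y \<Longrightarrow> y \<le> 1 \<Longrightarrow> f x < f y" "inj_on f {0..1}"
proof -
  show im: "f ` {0..1} = {0..1}"
    using assms by (auto simp: unit_homeo_def homeomorphism_def)
  then show ran: "0 \<le> x \<Longrightarrow> x \<le> 1 \<Longrightarrow> 0 \<le> f x \<and> f x \<le> 1" for x
    by (metis atLeastAtMost_iff imageI)
  show mono: "0 \<le> x \<Longrightarrow> x < y \<Longrightarrow> y \<le> 1 \<Longrightarrow> f x < f y" for x y
    using assms by (auto simp: unit_homeo_def strict_mono_on_def)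
  have "0 \<in> f ` {0..1}" "1 \<in> f ` {0..1}"
    unfolding im by auto
  then obtain a b where ab: "0 \<le> a" "a \<le> 1" "f a = 0" "0 \<le> b" "b \<le> 1" "f b = 1"
    by auto
  show "f 0 = 0"
    using ran[of 0] mono[of 0 a] ab by (cases "a = 0") auto
  show "f 1 = 1"
    using ran[of 1] mono[of b 1] ab by (cases "b = 1") auto
  show "inj_on f {0..1}"
    using assms by (auto simp: unit_homeo_def intro: strict_mono_on_imp_inj_on)
qed

lemma dyadic_add: "x \<in> dyadic \<Longrightarrow> y \<in> dyadic \<Longrightarrow> x + y \<in> dyadic"
proof -
  assume "x \<in> dyadic" "y \<in> dyadic"
  then obtain a b k l where "x = real_of_int a / 2 ^ k" "y = real_of_int b / 2 ^ l"
    by (auto simp: dyadic_def)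
  then have "x + y = real_of_int (a * 2 ^ l + b * 2 ^ k) / 2 ^ (k + l)"
    by (simp add: add_divide_distrib power_add)
  then show ?thesis
    unfolding dyadic_def by blast
qed

lemma dyadic_powi: "(2::real) powi k \<in> dyadic"
proof (cases "0 \<le> k")
  case True
  then have "(2::real) powi k = real_of_int (2 ^ nat k) / 2 ^ 0"
    by (simp add: power_int_def)
  then show ?thesis unfolding dyadic_def by blast
next
  case False
  then have "(2::real) powi k = real_of_int 1 / 2 ^ nat (- k)"
    by (simp add: power_int_def field_simps)
  then show ?thesis unfolding dyadic_def by blast
qed

lemma common_denominator:
  assumes "finite P" "P \<subseteq> dyadic"
  shows "\<exists>M. \<forall>p\<in>P. \<exists>m::int. p = of_int m / 2 ^ M"
  using assms
proof (induction P rule: finite_induct)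
  case (insert p P)
  then obtain M where M: "\<forall>p\<in>P. \<exists>m::int. p = of_int m / 2 ^ M" by auto
  obtain c :: int and k where p: "p = of_int c / 2 ^ k"
    using insert.prems by (auto simp: dyadic_def)
  have "\<exists>m::int. q = of_int m / 2 ^ (M + k)" if q: "q \<in> insert p P" for q
  proof (cases "q = p")
    case True
    then show ?thesis
      by (intro exI[of _ "c * 2 ^ M"]) (simp add: p power_add)
  next
    case False
    then obtain m :: int where "q = of_int m / 2 ^ M"
      using M q by auto
    then show ?thesis
      by (intro exI[of _ "m * 2 ^ k"]) (simp add: power_add)
  qed
  then show ?case by blast
qed simp

text \<open>The image of the left endpoint has denominator \<open>2 ^ D\<close>. Once a subcell is
  so deep that its image has length \<open>1 / 2 ^ L\<close> with \<open>D \<le> L\<close>, the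
  image also starts at a multiple of \<open>1 / 2 ^ L\<close>, hence is a standard dyadic
  interval.\<close>

lemma affine_dyadic_cones:
  assumes f: "unit_homeo f" and dy: "f (bval u) \<in> dyadic"
    and aff: "\<And>x. bval u \<le> x \<Longrightarrow> x \<le> bval u + 1 / 2 ^ length u \<Longrightarrow> f x = f (bval u) + 2 powi k * (x - bval u)"
  shows "\<exists>K. \<forall>t. K \<le> length t \<longrightarrow> (\<exists>v. dyadic_cone f (u @ t) v)"
proof -
  obtain m :: int and D where m: "f (bval u) = of_int m / 2 ^ D"
    using dy by (auto simp: dyadic_def)
  let ?M = "length u"
  \<comment> \<open>A cell of depth \<open>length t\<close> below \<open>u\<close> has an image of
    length \<open>2 powi e / 2 ^ length t\<close>, which is \<open>1 / 2 ^ L\<close> for the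
    \<open>L\<close> chosen below.\<close>
  define e where "e = k - int ?M"
  have "\<exists>v. dyadic_cone f (u @ t) v" if t: "D + nat \<bar>e\<bar> \<le> length t" for t
  proof -
    define L where "L = nat (int (length t) - e)"
    have L: "int L = int (length t) - e" "D \<le> L"
      using t by (auto simp: L_def)
    have pw: "2 powi k / 2 ^ ?M / 2 ^ length t = 1 / (2::real) ^ L"
    proof -
      have "2 powi k / 2 ^ ?M / 2 ^ length t = (2::real) powi (k - int ?M - int (length t))"
        by (simp add: power_int_diff)
      also have "k - int ?M - int (length t) = - int L"
        using L(1) by (simp add: e_def)
      finally show ?thesis
        by (simp add: power_int_minus inverse_eq_divide)
    qed
    obtain c :: int where c: "bval t * 2 ^ length t = of_int c"
      using bval_int by blast
    define C where "C = m * 2 ^ (L - D) + c"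
    have f_eq: "f (bval (u @ t) + z / 2 ^ length (u @ t)) = (of_int C + z) / 2 ^ L" if z: "0 \<le> z" "z \<le> 1" for z
    proof -
      let ?y = "bval t + z / 2 ^ length t"
      have y: "0 \<le> ?y" "?y \<le> 1"
        using point_in_unit[OF z] by auto
      have pt: "bval (u @ t) + z / 2 ^ length (u @ t) = bval u + ?y / 2 ^ ?M"
        by (simp add: bval_append add_divide_distrib power_add mult.commute)
      have "f (bval u + ?y / 2 ^ ?M) = f (bval u) + 2 powi k * (?y / 2 ^ ?M)"
        using aff[of "bval u + ?y / 2 ^ ?M"] y by (simp add: divide_right_mono)
      also have "2 powi k * (?y / 2 ^ ?M) = (2 powi k / 2 ^ ?M / 2 ^ length t) * (?y * 2 ^ length t)"
        by simp
      also have "?y * 2 ^ length t = of_int c + z"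
        by (simp add: distrib_right c)
      also have "f (bval u) = of_int (m * 2 ^ (L - D)) / 2 ^ L"
      proof -
        have "(2::real) ^ (L - D) = 2 ^ L / 2 ^ D"
          using L(2) by (simp add: power_diff)
        then show ?thesis by (simp add: m)
      qed
      finally show ?thesis
        unfolding pt pw by (simp add: C_def add_divide_distrib)
    qed
    have ran: "0 \<le> (of_int C + z) / (2::real) ^ L \<and> (of_int C + z) / (2::real) ^ L \<le> 1" if z: "0 \<le> z" "z \<le> 1" for z :: real
      using unit_homeoD(1)[OF f point_in_unit[OF z, of "u @ t"]] f_eq[OF z] by simp
    \<comment> \<open>Since \<open>f\<close> stays in the unit interval, \<open>C\<close> lies
      between \<open>0\<close> and \<open>2 ^ L - 1\<close>, so that \<open>C / 2 ^ L\<close> is the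
      value of a binary word of length \<open>L\<close>.\<close>
    have "0 \<le> real_of_int C"
      using mult_nonneg_nonneg[of "of_int C / 2 ^ L" "2 ^ L :: real"] ran[of 0] by simp
    moreover have "real_of_int C + 1 \<le> 2 ^ L"
      using mult_right_mono[of "(of_int C + 1) / 2 ^ L" 1 "2 ^ L :: real"] ran[of 1] by simp
    ultimately have "0 \<le> real_of_int C" "real_of_int (C + 1) \<le> real_of_int (2 ^ L)"
      by simp_all
    then have C: "0 \<le> C" "C + 1 \<le> 2 ^ L"
      unfolding of_int_le_iff by simp_all
    then have "nat C < 2 ^ L"
      by (simp add: nat_less_iff)
    then obtain v where v: "length v = L" "bval v = real (nat C) / 2 ^ L"
      using ex_bval by blast
    have "dyadic_cone f (u @ t) v"
      unfolding dyadic_cone_def using f_eq v C(1) by (simp add: add_divide_distrib)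
    then show ?thesis by blast
  qed
  then show ?thesis by blast
qed

text \<open>In terms of tree pairs: the first tree has depth at most \<open>N\<close>, so every word
  of at least this length lies at or below one of its leaves.\<close>

definition has_cones :: "(real \<Rightarrow> real) \<Rightarrow> nat \<Rightarrow> bool" where
  "has_cones f N \<longleftrightarrow> (\<forall>u. N \<le> length u \<longrightarrow> (\<exists>v. dyadic_cone f u v))"

lemma has_conesD: "has_cones f N \<Longrightarrow> N \<le> length u \<Longrightarrow> \<exists>v. dyadic_cone f u v"
  by (simp add: has_cones_def)

lemma has_conesI:
  assumes "\<And>u. length u = N \<Longrightarrow> \<exists>v. dyadic_cone f u v"
  shows "has_cones f N"
  unfolding has_cones_def
proof (intro allI impI)
  fix u :: "bool list" assume "N \<le> length u"
  then obtain v where "dyadic_cone f (take N u) v"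
    using assms[of "take N u"] by auto
  then have "dyadic_cone f (take N u @ drop N u) (v @ drop N u)"
    by (rule dyadic_cone_append)
  then show "\<exists>v. dyadic_cone f u v" by auto
qed

lemma thompson_has_cones:
  assumes f: "unit_homeo f" and P: "finite P" "P \<subseteq> dyadic"
    and aff: "\<And>a b. 0 \<le> a \<Longrightarrow> a < b \<Longrightarrow> b \<le> 1 \<Longrightarrow> {a<..<b} \<inter> P = {} \<Longrightarrow>
      \<exists>k::int. \<forall>x\<in>{a..b}. f x = f a + 2 powi k * (x - a)"
  shows "\<exists>N. has_cones f N"
proof -
  obtain M where M: "\<forall>p\<in>P. \<exists>m::int. p = of_int m / 2 ^ M"
    using common_denominator[OF P] by blast
  have piece: "\<exists>k::int. \<forall>x\<in>{bval u..bval u + 1 / 2 ^ M}. f x = f (bval u) + 2 powi k * (x - bval u)"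
    if u: "length u = M" for u
  proof (rule aff)
    show "0 \<le> bval u" "bval u < bval u + 1 / 2 ^ M" "bval u + 1 / 2 ^ M \<le> 1"
      using bval_upper[of u] u by auto
    show "{bval u<..<bval u + 1 / 2 ^ M} \<inter> P = {}"
    proof (rule ccontr)
      assume "\<not> ?thesis"
      then obtain p where p: "p \<in> P" "bval u < p" "p < bval u + 1 / 2 ^ M"
        by auto
      obtain m :: int where m: "p = of_int m / 2 ^ M"
        using M p(1) by blast
      obtain c :: int where "bval u * 2 ^ M = of_int c"
        using bval_int[of u] u by blast
      then have c: "bval u = of_int c / 2 ^ M"
        by (simp add: field_simps)
      have "real_of_int c < of_int m" "real_of_int m < of_int c + 1"
        using p(2,3) unfolding m c by (simp_all add: field_simps)
      then have "c < m" "real_of_int m < of_int (c + 1)"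
        by simp_all
      then show False
        unfolding of_int_less_iff by simp
    qed
  qed
  \<comment> \<open>The values at grid points are dyadic because they are reached from
    \<open>f 0 = 0\<close> by increments that are powers of two.\<close>
  have dy: "f (real j / 2 ^ M) \<in> dyadic" if "j \<le> 2 ^ M" for j
    using that
  proof (induction j)
    case 0
    have "(0::real) = of_int 0 / 2 ^ 0" by simp
    then have "(0::real) \<in> dyadic" unfolding dyadic_def by blast
    then show ?case using unit_homeoD(2)[OF f] by simp
  next
    case (Suc j)
    then obtain u where u: "length u = M" "bval u = real j / 2 ^ M"
      using ex_bval[of j M] by auto
    obtain k :: int where k: "\<forall>x\<in>{bval u..bval u + 1 / 2 ^ M}. f x = f (bval u) + 2 powi k * (x - bval u)"
      using piece[OF u(1)] by blast
    have "real (Suc j) / 2 ^ M = bval u + 1 / 2 ^ M"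
      by (simp add: u(2) add_divide_distrib)
    then have "f (real (Suc j) / 2 ^ M) = f (bval u) + 2 powi k * (1 / 2 ^ M)"
      using bspec[OF k, of "bval u + 1 / 2 ^ M"] by simp
    also have "2 powi k * (1 / 2 ^ M) = (2::real) powi (k - int M)"
      by (simp add: power_int_diff)
    finally show ?case
      using Suc u(2) dyadic_add dyadic_powi by simp
  qed
  have "\<exists>K. \<forall>t. K \<le> length t \<longrightarrow> (\<exists>v. dyadic_cone f (u @ t) v)" if u: "length u = M" for u
  proof -
    obtain k :: int where k: "\<forall>x\<in>{bval u..bval u + 1 / 2 ^ M}. f x = f (bval u) + 2 powi k * (x - bval u)"
      using piece[OF u] by blast
    obtain c :: int where c: "bval u * 2 ^ M = of_int c"
      using bval_int[of u] u by blast
    have "0 \<le> real_of_int c" "real_of_int c < 2 ^ M"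
      unfolding c[symmetric] using bval_less_1[of u] by simp_all
    then have c': "0 \<le> c" "c < 2 ^ M"
      by simp_all
    then have "nat c \<le> 2 ^ M" "bval u = real (nat c) / 2 ^ M"
      using c by (simp_all add: nat_le_iff field_simps)
    then have "f (bval u) \<in> dyadic"
      using dy[of "nat c"] by simp
    then show ?thesis
    proof (rule affine_dyadic_cones[OF f])
      show "f x = f (bval u) + 2 powi k * (x - bval u)"
        if "bval u \<le> x" "x \<le> bval u + 1 / 2 ^ length u" for x
        using bspec[OF k, of x] that u by simp
    qed
  qed
  then obtain K where K: "\<And>u t. length u = M \<Longrightarrow> K u \<le> length t \<Longrightarrow> \<exists>v. dyadic_cone f (u @ t) v"
    by metis
  define B where "B = Max (K ` {u. set u \<subseteq> UNIV \<and> length u = M})"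
  have "K u \<le> B" if "length u = M" for u
    unfolding B_def using that by (intro Max_ge finite_imageI finite_lists_length_eq) auto
  then have "\<exists>v. dyadic_cone f w v" if "length w = M + B" for w
    using K[of "take M w" "drop M w"] that by simp
  then show ?thesis
    using has_conesI by blast
qed

lemma has_cones_pieces:
  assumes f: "has_cones f N" and ab: "0 \<le> a" "a < b" "b \<le> 1"
    and P: "{a<..<b} \<inter> (\<lambda>j. real j / 2 ^ N) ` {0..2 ^ N} = {}"
  shows "\<exists>k::int. \<forall>x\<in>{a..b}. f x = f a + 2 powi k * (x - a)"
proof -
  \<comment> \<open>The number of the grid cell containing \<open>a\<close>. Its right end is a grid
    point beyond \<open>a\<close>, so it cannot be smaller than \<open>b\<close>.\<close>
  define j where "j = nat \<lfloor>a * 2 ^ N\<rfloor>"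
  have j: "real j \<le> a * 2 ^ N" "a * 2 ^ N < real j + 1"
    using ab(1) by (auto simp: j_def)
  have "a * 2 ^ N < 1 * 2 ^ N"
    using ab by (intro mult_strict_right_mono) auto
  then have "real j < 2 ^ N"
    using j by linarith
  then have j2: "j < 2 ^ N"
    by (metis of_nat_less_iff of_nat_numeral of_nat_power)
  then obtain u where u: "length u = N" "bval u = real j / 2 ^ N"
    using ex_bval by blast
  obtain v where v: "dyadic_cone f u v"
    using f u unfolding has_cones_def by auto
  have a: "bval u \<le> a" "a < (real j + 1) / 2 ^ N"
    using j by (simp_all add: u field_simps)
  have b: "b \<le> (real j + 1) / 2 ^ N"
  proof (rule ccontr)
    assume "\<not> ?thesis"
    then have "(real j + 1) / 2 ^ N \<in> {a<..<b}"
      using a by simp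
    moreover have "(real j + 1) / 2 ^ N \<in> (\<lambda>j. real j / 2 ^ N) ` {0..2 ^ N}"
      using j2 by (intro image_eqI[of _ _ "Suc j"]) auto
    ultimately show False using P by blast
  qed
  have f_eq: "f x = bval v + (x - bval u) * 2 ^ N / 2 ^ length v" if x: "a \<le> x" "x \<le> b" for x
  proof -
    let ?z = "(x - bval u) * 2 ^ N"
    have "0 \<le> ?z" using a x by simp
    moreover have "?z \<le> 1"
    proof -
      have "x \<le> (real j + 1) / 2 ^ N"
        using b x by linarith
      then show ?thesis
        using u(2) by (simp add: field_simps)
    qed
    ultimately have "f (bval u + ?z / 2 ^ length u) = bval v + ?z / 2 ^ length v"
      using dyadic_coneD[OF v] by blast
    then show ?thesis by (simp add: u(1))
  qed
  let ?k = "int N - int (length v)"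
  have pw: "(2::real) powi ?k = 2 ^ N / 2 ^ length v"
    by (simp add: power_int_diff)
  have "f x = f a + 2 powi ?k * (x - a)" if x: "x \<in> {a..b}" for x
    using f_eq[of x] f_eq[of a] x ab(2) unfolding pw by (simp add: field_simps)
  then show ?thesis by blast
qed

lemma thompson_F_maps_iff: "f \<in> thompson_F_maps \<longleftrightarrow> unit_homeo f \<and> (\<exists>N. has_cones f N)"
proof
  assume f: "f \<in> thompson_F_maps"
  then have u: "unit_homeo f"
    by (auto simp: thompson_F_maps_def unit_homeo_def)
  obtain P where "finite P" "P \<subseteq> dyadic" "\<forall>a b. 0 \<le> a \<and> a < b \<and> b \<le> 1 \<and> {a<..<b} \<inter> P = {} \<longrightarrow>
      (\<exists>k::int. \<forall>x\<in>{a..b}. f x = f a + 2 powi k * (x - a))"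
    using f unfolding thompson_F_maps_def by blast
  then have "\<exists>N. has_cones f N"
    by (intro thompson_has_cones[OF u]) auto
  with u show "unit_homeo f \<and> (\<exists>N. has_cones f N)" ..
next
  assume "unit_homeo f \<and> (\<exists>N. has_cones f N)"
  then obtain N where f: "unit_homeo f" "has_cones f N" by blast
  let ?P = "(\<lambda>j. real j / 2 ^ N) ` {0..2 ^ N}"
  have "?P \<subseteq> dyadic"
    unfolding dyadic_def by (auto intro!: exI[of _ "int _"])
  moreover have "\<forall>a b. 0 \<le> a \<and> a < b \<and> b \<le> 1 \<and> {a<..<b} \<inter> ?P = {} \<longrightarrow>
      (\<exists>k::int. \<forall>x\<in>{a..b}. f x = f a + 2 powi k * (x - a))"
    using has_cones_pieces[OF f(2)] by blast
  ultimately have "\<exists>P. finite P \<and> P \<subseteq> dyadic \<and> (\<forall>a b. 0 \<le> a \<and> a < b \<and> b \<le> 1 \<and> {a<..<b} \<inter> P = {} \<longrightarrow>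
      (\<exists>k::int. \<forall>x\<in>{a..b}. f x = f a + 2 powi k * (x - a)))"
    by (intro exI[of _ ?P]) simp
  then show "f \<in> thompson_F_maps"
    using f(1) unfolding thompson_F_maps_def unit_homeo_def by simp
qed

section \<open>Composition and inversion in \<open>F\<close>\<close>

lemma has_cones_comp:
  assumes "has_cones f N" "has_cones g M"
  shows "has_cones (compose {0..1} g f) (N + M)"
proof (rule has_conesI)
  fix u :: "bool list" assume u: "length u = N + M"
  obtain v where v: "dyadic_cone f (take N u) v"
    using assms(1) u unfolding has_cones_def by (metis le_add1 length_take min.absorb2 order_refl)
  then have *: "dyadic_cone f (take N u @ drop N u) (v @ drop N u)"
    by (rule dyadic_cone_append)
  moreover have "M \<le> length (v @ drop N u)"
    using u by simp
  then obtain w where "dyadic_cone g (v @ drop N u) w"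
    using assms(2) unfolding has_cones_def by blast
  ultimately show "\<exists>v. dyadic_cone (compose {0..1} g f) u v"
    using dyadic_cone_comp by (metis append_take_drop_id)
qed

lemma unit_homeo_comp:
  assumes f: "unit_homeo f" and g: "unit_homeo g"
  shows "unit_homeo (compose {0..1} g f)"
proof -
  obtain f' g' where "homeomorphism {0..1} {0..1} f f'" "homeomorphism {0..1} {0..1} g g'"
    using f g by (auto simp: unit_homeo_def)
  then have "homeomorphism {0..1} {0..1} (g \<circ> f) (f' \<circ> g')"
    by (rule homeomorphism_compose)
  then have "homeomorphism {0..1} {0..1} (compose {0..1} g f) (f' \<circ> g')"
    by (rule homeomorphism_cong) (auto simp: compose_def)
  moreover have "strict_mono_on {0..1} (compose {0..1} g f)"
    unfolding strict_mono_on_def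
    using unit_homeoD(1,5)[OF f] unit_homeoD(5)[OF g] by (simp add: compose_def)
  moreover have "compose {0..1} g f \<in> extensional {0..1}"
    by (rule compose_extensional)
  ultimately show ?thesis
    unfolding unit_homeo_def by blast
qed

lemma thompson_F_comp:
  assumes "f \<in> thompson_F_maps" "g \<in> thompson_F_maps"
  shows "compose {0..1} g f \<in> thompson_F_maps"
  using assms has_cones_comp unit_homeo_comp unfolding thompson_F_maps_iff by blast

lemma thompson_F_id: "(\<lambda>x\<in>{0..1}. x) \<in> thompson_F_maps"
proof -
  let ?i = "\<lambda>x\<in>{0..1::real}. x"
  have "homeomorphism {0..1} {0..1} ?i id"
    by (rule homeomorphism_cong[OF homeomorphism_ident]) auto
  moreover have "strict_mono_on {0..1} ?i"
    by (simp add: strict_mono_on_def)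
  ultimately have "unit_homeo ?i"
    unfolding unit_homeo_def by blast
  moreover have "dyadic_cone ?i u u" for u
    using point_in_unit by (simp add: dyadic_cone_def)
  then have "has_cones ?i 0"
    unfolding has_cones_def by blast
  ultimately show ?thesis
    unfolding thompson_F_maps_iff by blast
qed

text \<open>\<open>w\<close> being at least as deep as \<open>v\<close>, its midpoint is an interior
  point of the cell of depth \<open>length v\<close> containing it. No other cell of that depth
  contains it, not even as an endpoint.\<close>

lemma nested_dyadic:
  assumes z: "0 \<le> z" "z \<le> 1" and eq: "bmid w = bval v + z / 2 ^ length v" and len: "length v \<le> length w"
  shows "v = take (length v) w"
proof -
  let ?L = "length v"
  let ?u = "take ?L w" and ?t = "drop ?L w"
  have u: "length ?u = ?L" using len by simp
  have "bmid w = bval ?u + bmid ?t / 2 ^ ?L"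
    using bmid_append[of ?u ?t] u by simp
  then have *: "bval v * 2 ^ ?L + z = bval ?u * 2 ^ ?L + bmid ?t"
    using eq by (simp add: field_simps)
  obtain a b :: int where "bval v * 2 ^ ?L = of_int a" "bval ?u * 2 ^ ?L = of_int b"
    using bval_int[of v] bval_int[of ?u] u by metis
  moreover from this have "a = b"
    using * z bmid_bounds[of ?t] by linarith
  ultimately have "bval v * 2 ^ ?L = bval ?u * 2 ^ ?L"
    by metis
  then have "bval v = bval ?u"
    by simp
  then show ?thesis
    using u by (intro bval_inj) simp_all
qed

lemma thompson_F_inverse:
  assumes "f \<in> thompson_F_maps"
  obtains g where "g \<in> thompson_F_maps" "compose {0..1} g f = (\<lambda>x\<in>{0..1}. x)" "compose {0..1} f g = (\<lambda>x\<in>{0..1}. x)"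
proof -
  obtain N where f: "unit_homeo f" "has_cones f N"
    using assms by (auto simp: thompson_F_maps_iff)
  let ?I = "{0..1::real}"
  define g where "g = (\<lambda>x\<in>?I. inv_into ?I f x)"
  note im = unit_homeoD(4)[OF f(1)] and inj = unit_homeoD(6)[OF f(1)]
  have gf: "g (f x) = x" if "0 \<le> x" "x \<le> 1" for x
    using that inj unit_homeoD(1)[OF f(1), of x] by (simp add: g_def)
  have fg: "f (g y) = y" if "0 \<le> y" "y \<le> 1" for y
    using that im f_inv_into_f[of y f ?I] by (simp add: g_def)
  have gI: "0 \<le> g y \<and> g y \<le> 1" if "0 \<le> y" "y \<le> 1" for y
    using that im inv_into_into[of y f ?I] by (simp add: g_def)
  obtain h where h: "homeomorphism ?I ?I f h"
    using f(1) by (auto simp: unit_homeo_def)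
  have gh: "g y = h y" if "y \<in> ?I" for y
    using h that fg[of y] gI[of y] by (metis atLeastAtMost_iff homeomorphism_apply1)
  have "homeomorphism ?I ?I g f"
    by (rule homeomorphism_cong[OF homeomorphism_symD[OF h]]) (simp_all add: gh)
  moreover have "strict_mono_on ?I g"
    unfolding strict_mono_on_def
  proof (intro allI impI)
    fix x y assume xy: "x \<in> ?I \<and> y \<in> ?I \<and> x < y"
    show "g x < g y"
    proof (rule ccontr)
      assume "\<not> ?thesis"
      then consider "g x = g y" | "g y < g x" by linarith
      then show False
        using fg[of x] fg[of y] gI[of x] gI[of y] unit_homeoD(5)[OF f(1), of "g y" "g x"] xy
        by cases auto
    qed
  qed
  moreover have "g \<in> extensional ?I"
    by (simp add: g_def)
  ultimately have "unit_homeo g"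
    unfolding unit_homeo_def by blast
  moreover have "\<exists>M. has_cones g M"
  proof -
    obtain s where s: "\<And>u. length u = N \<Longrightarrow> dyadic_cone f u (s u)"
      using f(2) unfolding has_cones_def by (metis order_refl)
    \<comment> \<open>At least as deep as every leaf \<open>s u\<close> of the second tree, so that
      a word of length \<open>M\<close> extends one of these leaves.\<close>
    define M where "M = Max ((\<lambda>u. length (s u)) ` {u. set u \<subseteq> UNIV \<and> length u = N})"
    have M: "length (s u) \<le> M" if "length u = N" for u
      unfolding M_def using that by (intro Max_ge finite_imageI finite_lists_length_eq) auto
    have "\<exists>v. dyadic_cone g w v" if w: "length w = M" for w
    proof -
      have mb: "0 \<le> bmid w" "bmid w \<le> 1"
        using bmid_bounds[of w] by auto
      \<comment> \<open>The leaf above \<open>w\<close> is found by pulling back the midpoint of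
        \<open>w\<close>. An endpoint could belong to two neighbouring cells, a midpoint
        cannot.\<close>
      obtain u z where u: "length u = N" "0 \<le> z" "z \<le> 1" "g (bmid w) = bval u + z / 2 ^ N"
        using bval_cover[of "g (bmid w)" N] gI[OF mb] by blast
      have "bmid w = bval (s u) + z / 2 ^ length (s u)"
        using dyadic_coneD[OF s[OF u(1)] u(2,3)] u(1,4) fg[OF mb] by simp
      then have "s u = take (length (s u)) w"
        using nested_dyadic[OF u(2,3)] M[OF u(1)] w by simp
      then obtain t where "w = s u @ t"
        by (metis append_take_drop_id)
      moreover have "dyadic_cone g (s u @ t) (u @ t)"
        using dyadic_cone_inverse[OF s[OF u(1)] gf] by (rule dyadic_cone_append)
      ultimately show ?thesis by blast
    qed
    then show ?thesis
      using has_conesI by blast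
  qed
  ultimately have "g \<in> thompson_F_maps"
    by (simp add: thompson_F_maps_iff)
  moreover have "compose ?I g f = (\<lambda>x\<in>?I. x)" "compose ?I f g = (\<lambda>x\<in>?I. x)"
    using gf fg by (auto simp: compose_def fun_eq_iff)
  ultimately show thesis
    by (rule that)
qed

text \<open>Midpoints are used because an interior node of the first tree need not have a cone.
  Below a leaf both descriptions agree, see \<open>mid_map_cone\<close>.\<close>

definition mid_map :: "(real \<Rightarrow> real) \<Rightarrow> bool list \<Rightarrow> bool list" where
  "mid_map f w = (THE v. bmid v = f (bmid w))"

lemma no_True_replicate: "True \<notin> set b \<Longrightarrow> b = replicate (length b) False"
  by (induction b) auto

lemma last_True_split:
  "True \<in> set v \<Longrightarrow> \<exists>a k. v = a @ True # replicate k False"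
proof -
  assume "True \<in> set v"
  then obtain a b where ab: "v = a @ True # b" "True \<notin> set b"
    by (metis split_list_last)
  then have "b = replicate (length b) False"
    by (intro no_True_replicate)
  with ab show ?thesis by metis
qed

text \<open>\<open>bmid w\<close> is the left endpoint of arbitrarily deep cells, hence of one that
  \<open>f\<close> maps onto a cell. The left endpoint of the latter is positive, so its word
  contains \<open>True\<close>; what precedes the last \<open>True\<close> is the image
  node.\<close>

lemma bmid_mid_map:
  assumes "f \<in> thompson_F_maps"
  shows "bmid (mid_map f w) = f (bmid w)"
proof -
  obtain N where f: "unit_homeo f" "has_cones f N"
    using assms by (auto simp: thompson_F_maps_iff)
  let ?u = "w @ True # replicate N False"
  have u: "bval ?u = bmid w"
    by (simp add: bmid_def bval_append)
  have "N \<le> length ?u" by simp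
  from has_conesD[OF f(2) this] obtain v where v: "dyadic_cone f ?u v" ..
  have fv: "f (bmid w) = bval v"
    using dyadic_cone_left[OF v] u by simp
  have "0 < bval v"
    using unit_homeoD(2,5)[OF f(1)] bmid_bounds[of w] fv by (metis less_imp_le order_refl)
  have "True \<in> set v"
  proof (rule ccontr)
    assume "True \<notin> set v"
    then have "v = replicate (length v) False"
      by (rule no_True_replicate)
    then have "bval v = 0"
      by (metis bval_replicate_False)
    with \<open>0 < bval v\<close> show False by simp
  qed
  then obtain a k where "v = a @ True # replicate k False"
    using last_True_split by blast
  then have a: "bmid a = f (bmid w)"
    unfolding fv by (simp add: bmid_def bval_append)
  then have "mid_map f w = a"
    unfolding mid_map_def by (intro the_equality bmid_inj) simp_all
  with a show ?thesis by simp
qed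

lemma mid_map_eqI: "f \<in> thompson_F_maps \<Longrightarrow> bmid v = f (bmid w) \<Longrightarrow> mid_map f w = v"
  using bmid_mid_map bmid_inj by metis

lemma mid_map_comp:
  assumes "f \<in> thompson_F_maps" "g \<in> thompson_F_maps"
  shows "mid_map (compose {0..1} g f) w = mid_map g (mid_map f w)"
  using thompson_F_comp[OF assms] bmid_mid_map[OF assms(1)] bmid_mid_map[OF assms(2)] bmid_bounds[of w]
  by (intro mid_map_eqI) (auto simp: compose_def)

lemma mid_map_id: "mid_map (\<lambda>x\<in>{0..1}. x) w = w"
  using bmid_bounds[of w] by (intro mid_map_eqI thompson_F_id) auto

lemma mid_map_cone:
  assumes "f \<in> thompson_F_maps" "dyadic_cone f u v"
  shows "mid_map f (u @ t) = v @ t"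
  using dyadic_coneD[OF assms(2), of "bmid t"] bmid_bounds[of t]
  by (intro mid_map_eqI assms) (simp add: bmid_append)

text \<open>The action on cones continues the one on nodes: the cell to the right of the midpoint of
  \<open>w\<close> goes to a cell starting at the midpoint of \<open>mid_map f w\<close>. Together
  with its mirror image \<open>cone_before_mid\<close> this keeps adjacent points adjacent.\<close>

lemma cone_after_mid:
  assumes "f \<in> thompson_F_maps" "dyadic_cone f (w @ True # replicate k False) v"
  shows "v \<frown> (\<lambda>_. False) = (mid_map f w @ [True]) \<frown> (\<lambda>_. False)"
proof (rule bval_eq_tail)
  have "bval (w @ True # replicate k False) = bmid w"
    by (simp add: bmid_def bval_append)
  then show "bval v = bval (mid_map f w @ [True])"
    using dyadic_cone_left[OF assms(2)] bmid_mid_map[OF assms(1), of w] by (simp add: bmid_def)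
qed

lemma cone_before_mid:
  assumes "f \<in> thompson_F_maps" "dyadic_cone f (w @ False # replicate k True) v"
  shows "v \<frown> (\<lambda>_. True) = (mid_map f w @ [False]) \<frown> (\<lambda>_. True)"
proof (rule bval_upper_eq_tail)
  let ?u = "w @ False # replicate k True"
  have "bval ?u + 1 / 2 ^ length ?u = bmid w"
    by (simp add: bmid_def bval_append bval_replicate_True field_simps power_add)
  then have "bval v + 1 / 2 ^ length v = bmid (mid_map f w)"
    using dyadic_cone_right[OF assms(2)] bmid_mid_map[OF assms(1), of w] by simp
  then show "bval v + 1 / 2 ^ length v = bval (mid_map f w @ [False]) + 1 / 2 ^ length (mid_map f w @ [False])"
    by (simp add: bmid_alt bval_append)
qed

lemma cone_at_0:
  assumes "f \<in> thompson_F_maps" "dyadic_cone f (replicate k False) v"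
  shows "v \<frown> (\<lambda>_. False) = (\<lambda>_. False)"
proof -
  have "f 0 = 0"
    using assms(1) unit_homeoD(2) by (auto simp: thompson_F_maps_iff)
  then have "v \<frown> (\<lambda>_. False) = [] \<frown> (\<lambda>_. False)"
    using dyadic_cone_left[OF assms(2)] by (intro bval_eq_tail) simp
  then show ?thesis by simp
qed

lemma cone_at_1:
  assumes "f \<in> thompson_F_maps" "dyadic_cone f (replicate k True) v"
  shows "v \<frown> (\<lambda>_. True) = (\<lambda>_. True)"
proof -
  have "f 1 = 1"
    using assms(1) unit_homeoD(3) by (auto simp: thompson_F_maps_iff)
  then have "v \<frown> (\<lambda>_. True) = [] \<frown> (\<lambda>_. True)"
    using dyadic_cone_right[OF assms(2)] by (intro bval_upper_eq_tail) (simp add: bval_replicate_True)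
  then show ?thesis by simp
qed

lemma thompson_F_eqI:
  assumes f: "f \<in> thompson_F_maps" and g: "g \<in> thompson_F_maps"
    and eq: "\<And>u v w. dyadic_cone f u v \<Longrightarrow> dyadic_cone g u w \<Longrightarrow> v = w"
  shows "f = g"
proof -
  obtain N M where N: "unit_homeo f" "has_cones f N" "unit_homeo g" "has_cones g M"
    using f g by (auto simp: thompson_F_maps_iff)
  have "f x = g x" if x: "0 \<le> x" "x \<le> 1" for x
  proof -
    obtain u z where u: "length u = N + M" "0 \<le> z" "z \<le> 1" "x = bval u + z / 2 ^ (N + M)"
      using bval_cover[OF x] by blast
    obtain v w where vw: "dyadic_cone f u v" "dyadic_cone g u w"
      using N(2,4) u(1) unfolding has_cones_def by (metis le_add1 le_add2)
    then have "v = w" by (rule eq)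
    then show ?thesis
      using dyadic_coneD[OF vw(1) u(2,3)] dyadic_coneD[OF vw(2) u(2,3)] u(1,4) by simp
  qed
  moreover have "f \<in> extensional {0..1}" "g \<in> extensional {0..1}"
    using N by (auto simp: unit_homeo_def)
  ultimately show ?thesis
    by (intro extensionalityI) auto
qed

section \<open>Lifting the action of Thompson's group\<close>

locale alphabet =
  fixes n :: nat
  assumes n3: "3 \<le> n"
begin

lemma n2: "2 \<le> n" and n0: "0 < n"
  using n3 by auto

section \<open>Outermost and inner letters\<close>

definition ext_letter :: "bool \<Rightarrow> letter" where
  "ext_letter b = (if b then Plain (n - 1) else Plain 0)"

abbreviation ext_word :: "bool list \<Rightarrow> letter list" where
  "ext_word \<equiv> map ext_letter"

definition inner :: "letter set" where
  "inner = Plain ` {0<..<n - 1}"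

lemma ext_letter_alph [simp]: "ext_letter b \<in> alph n"
  using n3 by (simp add: ext_letter_def)

lemma ext_letter_eq_iff [simp]: "ext_letter a = ext_letter b \<longleftrightarrow> a = b"
  using n3 by (auto simp: ext_letter_def)

lemma inj_ext_letter: "inj ext_letter"
  by (rule injI) simp

lemma ext_letter_not_inner [simp]: "ext_letter b \<notin> inner"
  by (auto simp: ext_letter_def inner_def)

lemma inner_alph: "j \<in> inner \<Longrightarrow> j \<in> alph n"
  by (auto simp: inner_def)

lemma Plain_1_inner: "Plain 1 \<in> inner"
  using n3 by (auto simp: inner_def)

lemma ext_letter_not_1 [simp]: "ext_letter b \<noteq> Plain 1" "ext_letter b \<noteq> Plain (Suc 0)"
  using n3 by (auto simp: ext_letter_def)

lemma ext_word_lists [simp]: "ext_word w \<in> lists (alph n)"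
  by (auto simp: in_lists_conv_set)

lemma ext_letter_comp_cantor [simp]: "ext_letter \<circ> b \<in> cantor n"
  by (auto simp: cantor_def)

lemma alph_cases:
  assumes "i \<in> alph n"
  obtains b where "i = ext_letter b" | "i \<in> inner"
proof -
  obtain j where j: "i = Plain j" "j < n"
    using assms by (auto simp: alph_def)
  consider "j = 0" | "j = n - 1" | "j \<in> {0<..<n - 1}"
    using j(2) by force
  then show thesis
  proof cases
    case 1
    then show thesis using that(1)[of False] j by (simp add: ext_letter_def)
  next
    case 2
    then show thesis using that(1)[of True] j by (simp add: ext_letter_def)
  next
    case 3
    then show thesis using that(2) j by (simp add: inner_def)
  qed
qed

lemma cantor_cases:
  assumes x: "x \<in> cantor n"
  obtains (inner) \<beta> j z where "j \<in> inner" "z \<in> cantor n" "x = ext_word \<beta> \<frown> [j] \<frown> z"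
  | (ext) b where "x = ext_letter \<circ> b"
proof -
  have letters: "\<exists>b. x i = ext_letter b" if "x i \<notin> inner" for i
    using x that alph_cases[of "x i"] unfolding cantor_def by blast
  show thesis
  proof (cases "\<exists>p. x p \<in> inner")
    case True
    define p where "p = (LEAST p. x p \<in> inner)"
    have p: "x p \<in> inner" "\<And>i. i < p \<Longrightarrow> x i \<notin> inner"
      unfolding p_def using True by (auto intro: LeastI_ex dest: not_less_Least)
    have "\<exists>b. x i = ext_letter b" if "i < p" for i
      using p(2)[OF that] letters by blast
    then obtain b where b: "\<And>i. i < p \<Longrightarrow> x i = ext_letter (b i)"
      by metis
    have "prefix p x = ext_word (map b [0..<p])"
      by (rule nth_equalityI) (auto simp: b)
    moreover have "suffix p x = [x p] \<frown> suffix (Suc p) x"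
      using conc_head_tail[of "suffix p x"] by simp
    ultimately have "x = ext_word (map b [0..<p]) \<frown> [x p] \<frown> suffix (Suc p) x"
      by (metis prefix_suffix)
    then show thesis
      using inner p(1) x by (metis suffix_in_cantor)
  next
    case False
    then have "\<exists>b. x i = ext_letter b" for i
      using letters by blast
    then obtain b where "\<And>i. x i = ext_letter (b i)"
      by metis
    then have "x = ext_letter \<circ> b"
      by auto
    then show thesis by (rule ext)
  qed
qed

lemma inner_decomp_nth:
  "i < length \<beta> \<Longrightarrow> (ext_word \<beta> \<frown> [j] \<frown> z) i = ext_letter (\<beta> ! i)"
  "(ext_word \<beta> \<frown> [j] \<frown> z) (length \<beta>) = j"
  by (simp_all add: conc_def nth_append)

lemma inner_decomp_unique:
  assumes "ext_word \<beta> \<frown> [j] \<frown> z = ext_word \<gamma> \<frown> [k] \<frown> y" "j \<in> inner" "k \<in> inner"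
  shows "\<beta> = \<gamma>" "j = k" "z = y"
proof -
  have lt: "\<not> length a < length b"
    if "ext_word a \<frown> [i] \<frown> z = ext_word b \<frown> [l] \<frown> y" "i \<in> inner" for a b i l z y
    using fun_cong[OF that(1), of "length a"] that(2) inner_decomp_nth(1)[of "length a" b l y]
      inner_decomp_nth(2)[of a i z] by auto
  have "length \<beta> = length \<gamma>"
    using lt[OF assms(1,2)] lt[OF assms(1)[symmetric] assms(3)] by simp
  then show "\<beta> = \<gamma>" "j = k" "z = y"
    using assms(1) inj_ext_letter by (simp_all add: inj_map_eq_map)
qed

lemma inner_decomp_not_ext:
  assumes "j \<in> inner"
  shows "ext_word \<beta> \<frown> [j] \<frown> z \<noteq> ext_letter \<circ> b"
proof
  assume "ext_word \<beta> \<frown> [j] \<frown> z = ext_letter \<circ> b"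
  then have "j = ext_letter (b (length \<beta>))"
    using inner_decomp_nth(2)[of \<beta> j z] by simp
  then show False using assms by simp
qed

lemma ext_comp_eq_iff: "ext_letter \<circ> a = ext_letter \<circ> b \<longleftrightarrow> a = b"
  by (auto simp: fun_eq_iff)

text \<open>The action of \<open>F\<close> on the Cantor space by \<open>n\<close>-ary tree pairs in which only the outermost
  children are subdivided, the binary letters being identified with \<open>0\<close> and \<open>n - 1\<close>. The \<open>i\<close>-th
  interior node of the first tree goes to the \<open>i\<close>-th interior node of the second one; on dyadic
  midpoints this is \<open>mid_map\<close>.\<close>

definition act_rel :: "(real \<Rightarrow> real) \<Rightarrow> letter word \<Rightarrow> letter word \<Rightarrow> bool" where
  "act_rel f x y \<longleftrightarrow>
     (\<exists>\<beta> j z. j \<in> inner \<and> x = ext_word \<beta> \<frown> [j] \<frown> z \<and> y = ext_word (mid_map f \<beta>) \<frown> [j] \<frown> z) \<or>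
     (\<exists>u v z. dyadic_cone f u v \<and> x = ext_letter \<circ> (u \<frown> z) \<and> y = ext_letter \<circ> (v \<frown> z))"

definition act :: "(real \<Rightarrow> real) \<Rightarrow> letter word \<Rightarrow> letter word" where
  "act f x = (THE y. act_rel f x y)"

section \<open>The action is well defined, multiplicative and faithful\<close>

lemma cone_tail_unique:
  assumes "dyadic_cone f u v" "dyadic_cone f u' v'" "u \<frown> z = u' \<frown> z'" "length u \<le> length u'"
  shows "v \<frown> z = v' \<frown> z'"
proof (rule conc_compare[OF assms(3,4)])
  fix t assume t: "u' = u @ t" "z = t \<frown> z'"
  then have "v' = v @ t"
    using dyadic_cone_unique[OF assms(2)] dyadic_cone_append[OF assms(1), of t] by simp
  then show ?thesis using t by simp
qed

lemma act_rel_unique: "act_rel f x y \<Longrightarrow> act_rel f x y' \<Longrightarrow> y = y'"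
  unfolding act_rel_def
proof (elim disjE exE conjE)
  fix \<beta> j z \<beta>' j' z'
  assume "j \<in> inner" "x = ext_word \<beta> \<frown> [j] \<frown> z" "y = ext_word (mid_map f \<beta>) \<frown> [j] \<frown> z"
    "j' \<in> inner" "x = ext_word \<beta>' \<frown> [j'] \<frown> z'" "y' = ext_word (mid_map f \<beta>') \<frown> [j'] \<frown> z'"
  then show "y = y'"
    using inner_decomp_unique[of \<beta> j z \<beta>' j' z'] by metis
next
  fix u v z u' v' z'
  assume *: "dyadic_cone f u v" "x = ext_letter \<circ> (u \<frown> z)" "y = ext_letter \<circ> (v \<frown> z)"
    "dyadic_cone f u' v'" "x = ext_letter \<circ> (u' \<frown> z')" "y' = ext_letter \<circ> (v' \<frown> z')"
  then have "u \<frown> z = u' \<frown> z'"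
    using ext_comp_eq_iff by metis
  then have "v \<frown> z = v' \<frown> z'"
    using cone_tail_unique[OF *(1,4)] cone_tail_unique[OF *(4,1)] by (metis nle_le)
  then show "y = y'" using * by simp
qed (metis inner_decomp_not_ext)+

lemma act_eqI: "act_rel f x y \<Longrightarrow> act f x = y"
  unfolding act_def by (intro the_equality) (auto intro: act_rel_unique)

lemma act_inner: "j \<in> inner \<Longrightarrow> act f (ext_word \<beta> \<frown> [j] \<frown> z) = ext_word (mid_map f \<beta>) \<frown> [j] \<frown> z"
  by (rule act_eqI) (unfold act_rel_def, blast)

lemma act_ext: "dyadic_cone f u v \<Longrightarrow> act f (ext_letter \<circ> (u \<frown> z)) = ext_letter \<circ> (v \<frown> z)"
  by (rule act_eqI) (unfold act_rel_def, blast)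

text \<open>By \<open>mid_map_cone\<close> the clause for nodes replaces \<open>u\<close> by
  \<open>v\<close> as well when the node lies below \<open>u\<close>. Below a cone,
  \<open>act f\<close> is thus the prefix replacement of the tree pair.\<close>

lemma act_cone:
  assumes f: "f \<in> thompson_F_maps" and c: "dyadic_cone f u v" and x: "x \<in> cantor n"
  shows "act f (ext_word u \<frown> x) = ext_word v \<frown> x"
  using x
proof (cases rule: cantor_cases)
  case (inner \<beta> j z)
  have "ext_word u \<frown> x = ext_word (u @ \<beta>) \<frown> [j] \<frown> z"
    by (simp add: inner)
  then show ?thesis
    using act_inner[OF inner(1), of f "u @ \<beta>" z] mid_map_cone[OF f c, of \<beta>] by (simp add: inner)
next
  case (ext b)
  then show ?thesis
    using act_ext[OF c, of b] by simp
qed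

lemma ext_cases:
  assumes "f \<in> thompson_F_maps"
  obtains u v z where "dyadic_cone f u v" "b = u \<frown> z"
proof -
  obtain N where "has_cones f N"
    using assms by (auto simp: thompson_F_maps_iff)
  then obtain v where "dyadic_cone f (prefix N b) v"
    using has_conesD[of f N "prefix N b"] by auto
  then show thesis
    using that[of "prefix N b" v "suffix N b"] by simp
qed

lemma act_in_cantor:
  assumes "f \<in> thompson_F_maps" "x \<in> cantor n"
  shows "act f x \<in> cantor n"
  using assms(2)
proof (cases rule: cantor_cases)
  case (inner \<beta> j z)
  then show ?thesis
    using act_inner[OF inner(1)] inner_alph by simp
next
  case (ext b)
  obtain u v z where "dyadic_cone f u v" "b = u \<frown> z"
    using ext_cases[OF assms(1)] by blast
  then have "act f x = ext_letter \<circ> (v \<frown> z)"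
    using act_ext ext by metis
  then show ?thesis by (simp del: comp_concat)
qed

lemma act_comp:
  assumes f: "f \<in> thompson_F_maps" and g: "g \<in> thompson_F_maps" and x: "x \<in> cantor n"
  shows "act (compose {0..1} g f) x = act g (act f x)"
  using x
proof (cases rule: cantor_cases)
  case (inner \<beta> j z)
  then show ?thesis
    by (simp only: act_inner[OF inner(1)] mid_map_comp[OF f g])
next
  case (ext b)
  obtain N M where N: "has_cones f N" "has_cones g M"
    using f g by (auto simp: thompson_F_maps_iff)
  let ?u = "prefix N b"
  obtain v where "dyadic_cone f ?u v"
    using has_conesD[OF N(1), of ?u] by auto
  \<comment> \<open>The cone of \<open>f\<close> is narrowed by \<open>M\<close> more letters, so
    that its image word is long enough to be a cone of \<open>g\<close>.\<close>
  then have v: "dyadic_cone f (prefix N b @ prefix M (suffix N b)) (v @ prefix M (suffix N b))"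
    by (rule dyadic_cone_append)
  let ?z = "suffix M (suffix N b)"
  obtain w where w: "dyadic_cone g (v @ prefix M (suffix N b)) w"
    using has_conesD[OF N(2), of "v @ prefix M (suffix N b)"] by auto
  have b: "b = (prefix N b @ prefix M (suffix N b)) \<frown> ?z"
    by (metis conc_conc prefix_suffix)
  have "act f x = ext_letter \<circ> ((v @ prefix M (suffix N b)) \<frown> ?z)"
    using act_ext[OF v, of ?z] b ext by metis
  then have "act g (act f x) = ext_letter \<circ> (w \<frown> ?z)"
    using act_ext[OF w, of ?z] by metis
  moreover have "act (compose {0..1} g f) x = ext_letter \<circ> (w \<frown> ?z)"
    using act_ext[OF dyadic_cone_comp[OF v w], of ?z] b ext by metis
  ultimately show ?thesis by simp
qed

lemma act_id:
  assumes "x \<in> cantor n"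
  shows "act (\<lambda>x\<in>{0..1}. x) x = x"
  using assms
proof (cases rule: cantor_cases)
  case (inner \<beta> j z)
  then show ?thesis
    by (simp only: act_inner[OF inner(1)] mid_map_id)
next
  case (ext b)
  have "dyadic_cone (\<lambda>x\<in>{0..1}. x) [] []"
    by (simp add: dyadic_cone_def)
  then show ?thesis
    using act_ext[of _ "[]" "[]" b] ext by simp
qed

text \<open>In the point \<open>ext_word u\<close> followed by the letter \<open>1\<close> forever,
  the first inner letter stands right after \<open>u\<close>. The target \<open>v\<close> of the
  cone can therefore be read off the image.\<close>

lemma act_faithful:
  assumes f: "f \<in> thompson_F_maps" and g: "g \<in> thompson_F_maps"
    and eq: "\<And>x. x \<in> cantor n \<Longrightarrow> act f x = act g x"
  shows "f = g"
proof (rule thompson_F_eqI[OF f g])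
  fix u v w assume uv: "dyadic_cone f u v" and uw: "dyadic_cone g u w"
  let ?z = "\<lambda>_::nat. Plain 1"
  have z: "?z \<in> cantor n" "?z = [Plain 1] \<frown> ?z"
    using n3 by (auto simp: conc_def)
  have "ext_word v \<frown> [Plain 1] \<frown> ?z = ext_word w \<frown> [Plain 1] \<frown> ?z"
    using act_cone[OF f uv z(1)] act_cone[OF g uw z(1)] eq[of "ext_word u \<frown> ?z"] z by simp
  then show "v = w"
    using inner_decomp_unique(1) Plain_1_inner by metis
qed

text \<open>The transducer of the map \<open>h\<close> with \<open>h (j x) = j (h x)\<close> for \<open>j \<noteq> 1\<close> and
  \<open>h (1 x) = 1 (act f (h x))\<close>: after a letter \<open>1\<close> it accumulates a word of outermost letters until
  the image of the corresponding cone under \<open>f\<close> is known.\<close>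

definition lift_transducer :: "(real \<Rightarrow> real) \<Rightarrow> nat \<Rightarrow> bool list option transducer" where
  "lift_transducer f N = \<lparr>
     tstates = insert None (Some ` {\<beta>. length \<beta> < N}),
     ttrans = (\<lambda>l q. if l = Plain 1 then Some [] else
        (case q of None \<Rightarrow> None | Some \<beta> \<Rightarrow>
          if l \<in> inner \<or> N \<le> Suc (length \<beta>) then None else Some (\<beta> @ [l \<noteq> Plain 0]))),
     tout = (\<lambda>l q. case q of None \<Rightarrow> [l] | Some \<beta> \<Rightarrow>
        if l \<in> inner then ext_word (mid_map f \<beta>) @ [l]
        else if N \<le> Suc (length \<beta>) then ext_word (SOME v. dyadic_cone f (\<beta> @ [l \<noteq> Plain 0]) v)
        else [])\<rparr>"

lemma ext_letter_neq_0 [simp]: "ext_letter b \<noteq> Plain 0 \<longleftrightarrow> b"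
  using n3 by (simp add: ext_letter_def)

section \<open>Delay and synchronization of the transducer\<close>

context
  fixes f :: "real \<Rightarrow> real" and N :: nat
  assumes f: "f \<in> thompson_F_maps" and N: "0 < N" and cones: "has_cones f N"
begin

abbreviation T :: "bool list option transducer" where
  "T \<equiv> lift_transducer f N"

lemma T_None:
  "ttrans T l None = (if l = Plain 1 then Some [] else None)" "tout T l None = [l]"
  by (simp_all add: lift_transducer_def)

lemma T_inner:
  assumes "l \<in> inner"
  shows "ttrans T l (Some \<beta>) = (if l = Plain 1 then Some [] else None)" "tout T l (Some \<beta>) = ext_word (mid_map f \<beta>) @ [l]"
  using assms by (simp_all add: lift_transducer_def split: option.split)

lemma T_ext:
  "ttrans T (ext_letter b) (Some \<beta>) = (if N \<le> Suc (length \<beta>) then None else Some (\<beta> @ [b]))"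
  "tout T (ext_letter b) (Some \<beta>) =
     (if N \<le> Suc (length \<beta>) then ext_word (SOME v. dyadic_cone f (\<beta> @ [b]) v) else [])"
  by (simp_all add: lift_transducer_def)

lemma T_states: "tstates T = insert None (Some ` {\<beta>. length \<beta> < N})"
  by (simp add: lift_transducer_def)

lemma T_closed:
  assumes q: "q \<in> tstates T" and i: "i \<in> alph n"
  shows "ttrans T i q \<in> tstates T" "tout T i q \<in> lists (alph n)"
proof -
  show "ttrans T i q \<in> tstates T"
    using N q by (auto simp: lift_transducer_def split: option.split)
  show "tout T i q \<in> lists (alph n)"
    using i by (auto simp: lift_transducer_def split: option.split)
qed

text \<open>A potential that bounds the delay of output. A letter read without output raises it by
  one, and it never exceeds \<open>N + 1\<close>, so one emitted letter pays for the letter read and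
  any drop: whence the factor \<open>N + 2\<close>. \<open>None\<close> gets the greatest value,
  which covers the step from a completed word to \<open>None\<close> whatever the length of its
  output.\<close>

definition wait :: "bool list option \<Rightarrow> nat" where
  "wait q = (case q of None \<Rightarrow> Suc N | Some \<beta> \<Rightarrow> Suc (length \<beta>))"

lemma T_output_length:
  assumes "q \<in> tstates T" "w \<in> lists (alph n)"
  shows "length w + wait q \<le> (N + 2) * length (out_word T w q) + wait (trans_word T w q)"
  using assms
proof (induction w arbitrary: q)
  case (Cons i w)
  have i: "i \<in> alph n" using Cons.prems by simp
  have "1 + wait q \<le> (N + 2) * length (tout T i q) + wait (ttrans T i q)"
  proof (cases q)
    case None
    then show ?thesis by (simp add: T_None wait_def)
  next
    case (Some \<beta>)
    then have "length \<beta> < N"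
      using Cons.prems by (auto simp: T_states)
    with i show ?thesis
      by (cases rule: alph_cases) (auto simp: Some T_inner T_ext wait_def)
  qed
  moreover have "length w + wait (ttrans T i q) \<le> (N + 2) * length (out_word T w (ttrans T i q))
      + wait (trans_word T w (ttrans T i q))"
    using Cons T_closed(1)[of q i] by simp
  ultimately show ?case
    by (simp add: algebra_simps)
qed simp

lemma T_output_long:
  assumes "q \<in> tstates T" "w \<in> lists (alph n)" "length w = (N + 2) * m + N"
  shows "m \<le> length (out_word T w q)"
proof -
  have "trans_word T w q \<in> tstates T"
    using assms(2,1) T_closed(1) by (induction w arbitrary: q) auto
  then have "wait (trans_word T w q) \<le> Suc N"
    by (auto simp: T_states wait_def)
  moreover have "1 \<le> wait q"
    by (auto simp: wait_def split: option.split)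
  ultimately have "(N + 2) * m \<le> (N + 2) * length (out_word T w q)"
    using T_output_length[OF assms(1,2)] assms(3) by linarith
  then show ?thesis
    unfolding mult_le_cancel1 by simp
qed

lemma T_transducer: "closed_states n T (tstates T)"
  unfolding closed_states_def
proof (intro conjI ballI)
  fix q \<delta> assume "q \<in> tstates T" "\<delta> \<in> cantor n"
  then show "infinite_output T q \<delta>"
    unfolding infinite_output_def using T_output_long[of q "prefix _ \<delta>"]
    by (metis prefix_in_lists_alph subsequence_length minus_nat.diff_0)
qed (use T_closed in auto)

text \<open>Outermost letters leave \<open>None\<close> unchanged and take
  \<open>Some \<beta>\<close> to \<open>None\<close> after \<open>N - length \<beta>\<close> of
  them, while an inner letter takes both to the same state. The run forgets \<open>\<beta>\<close>
  at whichever comes first.\<close>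

lemma T_sync:
  "length \<beta> < N \<Longrightarrow> w \<in> lists (alph n) \<Longrightarrow> N \<le> length w + length \<beta> \<Longrightarrow>
    trans_word T w (Some \<beta>) = trans_word T w None"
proof (induction w arbitrary: \<beta>)
  case (Cons i w)
  have "i \<in> alph n" using Cons.prems by simp
  then show ?case
  proof (cases rule: alph_cases)
    case (1 b)
    then show ?thesis
      using Cons.IH[of "\<beta> @ [b]"] Cons.prems by (auto simp: T_ext T_None)
  next
    case 2
    then show ?thesis by (simp add: T_inner T_None)
  qed
qed simp

lemma T_sync_state:
  assumes "q \<in> tstates T" "w \<in> lists (alph n)" "length w = N"
  shows "trans_word T w q = trans_word T w None"
proof (cases q)
  case (Some \<beta>)
  then have "length \<beta> < N"
    using assms(1) by (auto simp: T_states)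
  then show ?thesis
    using T_sync assms(2,3) Some by simp
qed simp

section \<open>The lifted map and its functional equation\<close>

definition lift_map :: "letter word \<Rightarrow> letter word" where
  "lift_map = state_map T None"

lemma None_state: "None \<in> tstates T"
  by (simp add: T_states)

lemma lift_map_in_cantor: "x \<in> cantor n \<Longrightarrow> lift_map x \<in> cantor n"
  unfolding lift_map_def by (rule state_map_in_cantor[OF T_transducer None_state])

lemma lift_map_step: "l \<in> alph n \<Longrightarrow> x \<in> cantor n \<Longrightarrow> lift_map ([l] \<frown> x) = [l] \<frown> state_map T (ttrans T l None) x"
  unfolding lift_map_def using state_map_conc_closed[OF T_transducer None_state, of "[l]" x] by (simp add: T_None)

lemma some_cone: "length u = N \<Longrightarrow> dyadic_cone f u (SOME v. dyadic_cone f u v)"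
  by (rule someI_ex[of "dyadic_cone f u"]) (simp add: has_conesD[OF cones])

text \<open>In \<open>Some \<beta>\<close> an application of \<open>act f\<close> is pending, and
  the outermost letters \<open>\<beta>\<close> of its argument are known already, because the lift
  copies outermost letters. The induction counts the letters missing to a cone.\<close>

lemma state_map_Some:
  "length \<beta> < N \<Longrightarrow> x \<in> cantor n \<Longrightarrow> state_map T (Some \<beta>) x = act f (ext_word \<beta> \<frown> lift_map x)"
proof (induction "N - length \<beta>" arbitrary: \<beta> x rule: less_induct)
  case less
  have st: "Some \<beta> \<in> tstates T"
    using less.prems by (auto simp: T_states)
  obtain l y where x: "x = [l] \<frown> y" "l \<in> alph n" "y \<in> cantor n"
    using conc_head_tail[of x] less.prems(2) suffix_in_cantor[OF less.prems(2), of 1]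
    by (metis Cons_in_lists_iff conc_in_cantor_iff)
  have step: "state_map T (Some \<beta>) x = tout T l (Some \<beta>) \<frown> state_map T (ttrans T l (Some \<beta>)) y"
    using state_map_conc_closed[OF T_transducer st, of "[l]" y] x by simp
  show ?case
    using x(2)
  proof (cases rule: alph_cases)
    case (1 b)
    have hx: "lift_map x = [l] \<frown> lift_map y"
      using lift_map_step[OF x(2,3)] x 1 by (simp add: T_None lift_map_def)
    then have eq: "ext_word \<beta> \<frown> lift_map x = ext_word (\<beta> @ [b]) \<frown> lift_map y"
      using 1 by simp
    show ?thesis
    proof (cases "N \<le> Suc (length \<beta>)")
      case True
      then have "dyadic_cone f (\<beta> @ [b]) (SOME v. dyadic_cone f (\<beta> @ [b]) v)"
        using less.prems by (intro some_cone) simp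
      from act_cone[OF f this lift_map_in_cantor[OF x(3)]] show ?thesis
        unfolding step eq using True 1 by (simp add: T_ext lift_map_def)
    next
      case False
      then show ?thesis
        unfolding step eq using less.hyps[of "\<beta> @ [b]" y] less.prems x 1 by (simp add: T_ext)
    qed
  next
    case 2
    have "ext_word \<beta> \<frown> lift_map x = ext_word \<beta> \<frown> [l] \<frown> state_map T (ttrans T l None) y"
      using lift_map_step[OF x(2,3)] x by simp
    then show ?thesis
      unfolding step using act_inner[OF 2] by (simp add: T_inner T_None 2)
  qed
qed

lemma lift_map_ext: "l \<in> alph n \<Longrightarrow> l \<noteq> Plain 1 \<Longrightarrow> x \<in> cantor n \<Longrightarrow> lift_map ([l] \<frown> x) = [l] \<frown> lift_map x"
  using lift_map_step[of l x] by (simp add: T_None flip: lift_map_def)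

lemma lift_map_1: "x \<in> cantor n \<Longrightarrow> lift_map ([Plain 1] \<frown> x) = [Plain 1] \<frown> act f (lift_map x)"
  using lift_map_step[of "Plain 1" x] state_map_Some[of "[]" x] N n3 by (simp add: T_None)

text \<open>\<open>K\<close> assigns to each state the map it has to induce if \<open>k\<close> is
  the lift. It satisfies the step equation of \<open>T\<close>, so every output of \<open>T\<close>
  is a prefix of \<open>k x\<close>; the output being infinite, only one word has this
  property.\<close>

lemma lift_map_unique:
  assumes k: "\<And>x. x \<in> cantor n \<Longrightarrow> k x \<in> cantor n"
    "\<And>l x. l \<in> alph n \<Longrightarrow> l \<noteq> Plain 1 \<Longrightarrow> x \<in> cantor n \<Longrightarrow> k ([l] \<frown> x) = [l] \<frown> k x"
    "\<And>x. x \<in> cantor n \<Longrightarrow> k ([Plain 1] \<frown> x) = [Plain 1] \<frown> act f (k x)"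
    and x: "x \<in> cantor n"
  shows "k x = lift_map x"
proof -
  define K where "K q x = (case q of None \<Rightarrow> k x | Some \<beta> \<Rightarrow> act f (ext_word \<beta> \<frown> k x))" for q x
  have kstep: "k ([l] \<frown> x) = [l] \<frown> K (ttrans T l None) x" if "l \<in> alph n" "x \<in> cantor n" for l x
    using k(2,3) that by (simp add: T_None K_def)
  have step: "K q ([l] \<frown> x) = tout T l q \<frown> K (ttrans T l q) x"
    if q: "q \<in> tstates T" and l: "l \<in> alph n" and x: "x \<in> cantor n" for q l x
  proof (cases q)
    case None
    then show ?thesis
      using kstep[OF l x] by (simp add: K_def T_None(2))
  next
    case (Some \<beta>)
    then have len: "length \<beta> < N"
      using q by (auto simp: T_states)
    show ?thesis
      using l
    proof (cases rule: alph_cases)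
      case (1 b)
      have eq: "ext_word \<beta> \<frown> k ([l] \<frown> x) = ext_word (\<beta> @ [b]) \<frown> k x"
        using k(2)[OF l _ x] 1 by simp
      have "K q ([l] \<frown> x) = act f (ext_word (\<beta> @ [b]) \<frown> k x)"
        unfolding eq[symmetric] by (simp add: K_def Some)
      moreover have "act f (ext_word (\<beta> @ [b]) \<frown> k x) = tout T l q \<frown> K (ttrans T l q) x"
      proof (cases "N \<le> Suc (length \<beta>)")
        case True
        then have "dyadic_cone f (\<beta> @ [b]) (SOME v. dyadic_cone f (\<beta> @ [b]) v)"
          using len by (intro some_cone) simp
        from act_cone[OF f this k(1)[OF x]] show ?thesis
          using True 1 by (simp add: T_ext K_def Some)
      qed (simp add: T_ext K_def Some 1)
      ultimately show ?thesis by simp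
    next
      case 2
      have "K q ([l] \<frown> x) = act f (ext_word \<beta> \<frown> [l] \<frown> K (ttrans T l None) x)"
        using kstep[OF l x] by (simp add: K_def Some)
      then show ?thesis
        using act_inner[OF 2] by (simp add: T_inner T_None 2 Some)
    qed
  qed
  have word: "K q (w \<frown> x) = out_word T w q \<frown> K (trans_word T w q) x"
    if "q \<in> tstates T" "w \<in> lists (alph n)" "x \<in> cantor n" for q w x
    using that
  proof (induction w arbitrary: q)
    case (Cons i w)
    have "K q ((i # w) \<frown> x) = K q ([i] \<frown> (w \<frown> x))"
      by simp
    also have "\<dots> = tout T i q \<frown> K (ttrans T i q) (w \<frown> x)"
      using Cons.prems by (intro step) simp_all
    also have "\<dots> = tout T i q \<frown> out_word T w (ttrans T i q) \<frown> K (trans_word T w (ttrans T i q)) x"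
      using Cons.prems Cons.IH[of "ttrans T i q"] T_closed(1)[of q i] by simp
    finally show ?case by simp
  qed simp
  have "is_prefix (out_word T (prefix m x) None) (K None x)" for m
    using word[OF None_state prefix_in_lists_alph[OF x] suffix_in_cantor[OF x], of m m] by simp
  then have "state_map T None x = K None x"
    by (rule state_map_eqI[OF closed_statesD(1)[OF T_transducer None_state x]])
  then show ?thesis by (simp add: lift_map_def K_def)
qed

lemma lift_map_unif_continuous: "cantor_unif_continuous n lift_map"
proof (rule cantor_unif_continuousI)
  fix m
  let ?k = "(N + 2) * m + N"
  have "prefix m (lift_map x) = prefix m (lift_map y)" if xy: "x \<in> cantor n" "y \<in> cantor n" "prefix ?k x = prefix ?k y" for x y
  proof (rule prefix_eqI)
    fix i assume i: "i < m"
    let ?o = "out_word T (prefix ?k x) None"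
    have "m \<le> length ?o"
      using T_output_long[OF None_state prefix_in_lists_alph[OF xy(1)], of ?k m] by simp
    moreover have "is_prefix ?o (lift_map x)"
      unfolding lift_map_def by (rule is_prefix_state_map[OF closed_statesD(1)[OF T_transducer None_state xy(1)]])
    moreover have "is_prefix ?o (lift_map y)"
      unfolding lift_map_def xy(3) by (rule is_prefix_state_map[OF closed_statesD(1)[OF T_transducer None_state xy(2)]])
    ultimately show "lift_map x i = lift_map y i"
      using i is_prefix_nth[of ?o "lift_map x" i] is_prefix_nth[of ?o "lift_map y" i] by simp
  qed
  then show "\<exists>k. \<forall>x\<in>cantor n. \<forall>y\<in>cantor n. prefix k x = prefix k y \<longrightarrow> prefix m (lift_map x) = prefix m (lift_map y)"
    by blast
qed

lemma lift_map_forced: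
  assumes "u \<in> lists (alph n)" "w \<in> lists (alph n)" "length w = N" "x \<in> cantor n"
  shows "lift_map (u \<frown> w \<frown> x) = out_word T (u @ w) None \<frown> state_map T (trans_word T w None) x"
proof -
  have "trans_word T u None \<in> tstates T"
    by (rule trans_word_closed[OF T_transducer None_state assms(1)])
  then have "trans_word T (u @ w) None = trans_word T w None"
    using T_sync_state assms(2,3) by simp
  then show ?thesis
    unfolding lift_map_def using state_map_conc_closed[OF T_transducer None_state, of "u @ w" x] assms by simp
qed

text \<open>Injectivity is a hypothesis here because it comes from the lift of the inverse element,
  once lifts are known to compose.\<close>

lemma lift_map_core_map:
  assumes inj: "inj_on lift_map (cantor n)"
  shows "core_map n lift_map"
  unfolding core_map_def
proof (intro conjI ballI)
  show "sync_map n lift_map"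
  proof (rule sync_mapI[OF n2 inj lift_map_in_cantor lift_map_unif_continuous N])
    fix w assume w: "w \<in> lists (alph n)" "length w = N"
    have "forced_map n lift_map w (state_map T (trans_word T w None))"
      unfolding forced_map_def using lift_map_forced[OF _ w] by blast
    then show "\<exists>\<psi>. forced_map n lift_map w \<psi>" by blast
  qed
  show "no_common_prefix n lift_map"
    unfolding no_common_prefix_def
  proof (intro allI impI)
    fix v assume v: "\<forall>x\<in>cantor n. is_prefix v (lift_map x)"
    let ?z = "\<lambda>_::nat. Plain 0"
    have z: "?z \<in> cantor n" using n0 by simp
    show "v = []"
    proof (rule ccontr)
      assume "v \<noteq> []"
      have "lift_map ([l] \<frown> ?z) 0 = v ! 0" if "l \<in> alph n" for l
        using v is_prefix_nth[of v "lift_map ([l] \<frown> ?z)" 0] \<open>v \<noteq> []\<close> that z by simp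
      \<comment> \<open>\<open>0\<close> and \<open>2\<close> are letters other than
        \<open>1\<close>, hence copied by the lift, so that its values have no first letter in
        common.\<close>
      moreover have "lift_map ([Plain 0] \<frown> ?z) 0 = Plain 0" "lift_map ([Plain 2] \<frown> ?z) 0 = Plain 2"
        using lift_map_ext[OF _ _ z, of "Plain 0"] lift_map_ext[OF _ _ z, of "Plain 2"] n3 by simp_all
      ultimately have "Plain 0 = Plain 2"
        using n3 by simp
      then show False by simp
    qed
  qed
  show "lift_map ([Plain 0] \<frown> x) = [Plain 0] \<frown> lift_map x" if "x \<in> cantor n" for x
    using lift_map_ext[OF _ _ that, of "Plain 0"] n0 by simp
  have "trans_word T (replicate k (Plain 0)) None = None" for k
    by (induction k) (simp_all add: T_None)
  then have "lift_map (u \<frown> replicate N (Plain 0) \<frown> x) = out_word T (u @ replicate N (Plain 0)) None \<frown> lift_map x"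
    if "u \<in> lists (alph n)" "x \<in> cantor n" for u x
    using lift_map_forced[OF that(1) replicate_in_lists[OF n0] _ that(2)] by (simp add: lift_map_def)
  then show "\<exists>k. \<forall>u\<in>lists (alph n). \<exists>v. \<forall>x\<in>cantor n. lift_map (u \<frown> replicate k (Plain 0) \<frown> x) = v \<frown> lift_map x"
    by blast
qed

end

end

section \<open>The lift preserves the circle\<close>

context alphabet
begin

text \<open>The level is an arbitrary choice; by \<open>lift_map_unique\<close> the map does not
  depend on it on the Cantor space.\<close>

definition F_lift :: "(real \<Rightarrow> real) \<Rightarrow> letter word \<Rightarrow> letter word" where
  "F_lift f = lift_map f (SOME N. 0 < N \<and> has_cones f N)"

lemma F_level:
  assumes "f \<in> thompson_F_maps"
  obtains N where "0 < N" "has_cones f N" "F_lift f = lift_map f N"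
proof -
  obtain N where "has_cones f N"
    using assms by (auto simp: thompson_F_maps_iff)
  then have "0 < Suc N \<and> has_cones f (Suc N)"
    by (auto simp: has_cones_def)
  then have "0 < (SOME N. 0 < N \<and> has_cones f N) \<and> has_cones f (SOME N. 0 < N \<and> has_cones f N)"
    by (rule someI)
  then show thesis
    using that by (auto simp: F_lift_def)
qed

lemma F_lift_in_cantor: "f \<in> thompson_F_maps \<Longrightarrow> x \<in> cantor n \<Longrightarrow> F_lift f x \<in> cantor n"
  by (metis F_level lift_map_in_cantor)

lemma F_lift_step:
  "f \<in> thompson_F_maps \<Longrightarrow> l \<in> alph n \<Longrightarrow> l \<noteq> Plain 1 \<Longrightarrow> x \<in> cantor n \<Longrightarrow> F_lift f ([l] \<frown> x) = [l] \<frown> F_lift f x"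
  by (metis F_level lift_map_ext)

lemma F_lift_1: "f \<in> thompson_F_maps \<Longrightarrow> x \<in> cantor n \<Longrightarrow> F_lift f ([Plain 1] \<frown> x) = [Plain 1] \<frown> act f (F_lift f x)"
  by (metis F_level lift_map_1)

lemma F_lift_unique:
  assumes f: "f \<in> thompson_F_maps"
    and k: "\<And>x. x \<in> cantor n \<Longrightarrow> k x \<in> cantor n"
    "\<And>l x. l \<in> alph n \<Longrightarrow> l \<noteq> Plain 1 \<Longrightarrow> x \<in> cantor n \<Longrightarrow> k ([l] \<frown> x) = [l] \<frown> k x"
    "\<And>x. x \<in> cantor n \<Longrightarrow> k ([Plain 1] \<frown> x) = [Plain 1] \<frown> act f (k x)"
    and x: "x \<in> cantor n"
  shows "F_lift f x = k x"
proof -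
  obtain N where N: "0 < N" "has_cones f N" "F_lift f = lift_map f N"
    using F_level[OF f] by blast
  show ?thesis
    using lift_map_unique[OF f N(1,2) k x] N(3) by simp
qed

lemma F_lift_unif_continuous:
  assumes "f \<in> thompson_F_maps"
  shows "cantor_unif_continuous n (F_lift f)"
proof -
  obtain N where N: "0 < N" "has_cones f N" "F_lift f = lift_map f N"
    using F_level[OF assms] by blast
  show ?thesis
    using lift_map_unif_continuous[OF assms N(1,2)] N(3) by simp
qed

lemma F_lift_ext_word:
  "f \<in> thompson_F_maps \<Longrightarrow> x \<in> cantor n \<Longrightarrow> F_lift f (ext_word w \<frown> x) = ext_word w \<frown> F_lift f x"
proof (induction w)
  case (Cons b w)
  have "F_lift f (ext_word (b # w) \<frown> x) = F_lift f ([ext_letter b] \<frown> ext_word w \<frown> x)"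
    by simp
  also have "\<dots> = [ext_letter b] \<frown> F_lift f (ext_word w \<frown> x)"
    using Cons.prems by (intro F_lift_step) simp_all
  finally show ?case
    using Cons by simp
qed simp

lemma F_lift_ext:
  assumes "f \<in> thompson_F_maps"
  shows "F_lift f (ext_letter \<circ> b) = ext_letter \<circ> b"
proof
  fix i
  let ?w = "prefix (Suc i) b"
  have "ext_letter \<circ> b = ext_word ?w \<frown> (ext_letter \<circ> suffix (Suc i) b)"
    by (metis comp_concat prefix_suffix)
  then have "F_lift f (ext_letter \<circ> b) = ext_word ?w \<frown> F_lift f (ext_letter \<circ> suffix (Suc i) b)"
    using F_lift_ext_word[OF assms, of "ext_letter \<circ> suffix (Suc i) b" ?w] by simp
  then show "F_lift f (ext_letter \<circ> b) i = (ext_letter \<circ> b) i"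
    by (simp add: subsequence_def del: upt_Suc)
qed

text \<open>The point is that one \<open>y\<close> serves all \<open>\<beta>\<close>. As
  \<open>act\<close> exchanges \<open>\<beta>\<close> only, the commutation in
  \<open>act_F_lift\<close> follows on points with an inner letter.\<close>

lemma F_lift_inner:
  assumes "f \<in> thompson_F_maps" "j \<in> inner" "z \<in> cantor n"
  obtains y where "y \<in> cantor n" "\<And>\<beta>. F_lift f (ext_word \<beta> \<frown> [j] \<frown> z) = ext_word \<beta> \<frown> [j] \<frown> y"
proof -
  have j: "j \<in> alph n" using assms(2) by (rule inner_alph)
  let ?y = "if j = Plain 1 then act f (F_lift f z) else F_lift f z"
  have "F_lift f ([j] \<frown> z) = [j] \<frown> ?y"
    using F_lift_1[OF assms(1,3)] F_lift_step[OF assms(1) j _ assms(3)] by simp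
  moreover have "[j] \<frown> z \<in> cantor n"
    using j assms(3) by simp
  moreover have "?y \<in> cantor n"
    using act_in_cantor F_lift_in_cantor assms by simp
  ultimately show thesis
    using F_lift_ext_word[OF assms(1), of "[j] \<frown> z"] that[of ?y] by simp
qed

lemma act_F_lift:
  assumes f: "f \<in> thompson_F_maps" and g: "g \<in> thompson_F_maps" and x: "x \<in> cantor n"
  shows "act f (F_lift g x) = F_lift g (act f x)"
  using x
proof (cases rule: cantor_cases)
  case (inner \<beta> j z)
  obtain y where y: "\<And>\<beta>. F_lift g (ext_word \<beta> \<frown> [j] \<frown> z) = ext_word \<beta> \<frown> [j] \<frown> y"
    using F_lift_inner[OF g inner(1,2)] by blast
  show ?thesis
    unfolding inner(3) y act_inner[OF inner(1)] ..
next
  case (ext b)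
  obtain u v z where "dyadic_cone f u v" "b = u \<frown> z"
    using ext_cases[OF f] by blast
  then have "act f x = ext_letter \<circ> (v \<frown> z)"
    using act_ext ext by metis
  then show ?thesis
    using F_lift_ext[OF g] ext by metis
qed

lemma F_lift_comp:
  assumes f: "f \<in> thompson_F_maps" and g: "g \<in> thompson_F_maps" and x: "x \<in> cantor n"
  shows "F_lift (compose {0..1} g f) x = F_lift g (F_lift f x)"
proof (rule F_lift_unique[OF thompson_F_comp[OF f g] _ _ _ x])
  fix y assume y: "y \<in> cantor n"
  note fy = F_lift_in_cantor[OF f y]
  note gfy = F_lift_in_cantor[OF g fy]
  show "F_lift g (F_lift f y) \<in> cantor n" by (rule gfy)
  show "F_lift g (F_lift f ([l] \<frown> y)) = [l] \<frown> F_lift g (F_lift f y)" if "l \<in> alph n" "l \<noteq> Plain 1" for l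
    using F_lift_step[OF f that y] F_lift_step[OF g that fy] by simp
  \<comment> \<open>The next equation exchanges \<open>F_lift g\<close> with \<open>act f\<close>,
    so that the two actions combine into that of \<open>compose {0..1} g f\<close>.\<close>
  have "F_lift g (F_lift f ([Plain 1] \<frown> y)) = [Plain 1] \<frown> act g (F_lift g (act f (F_lift f y)))"
    using F_lift_1[OF f y] F_lift_1[OF g act_in_cantor[OF f fy]] by simp
  also have "\<dots> = [Plain 1] \<frown> act (compose {0..1} g f) (F_lift g (F_lift f y))"
    using act_F_lift[OF f g fy] act_comp[OF f g gfy] by simp
  finally show "F_lift g (F_lift f ([Plain 1] \<frown> y)) = [Plain 1] \<frown> act (compose {0..1} g f) (F_lift g (F_lift f y))" .
qed

lemma F_lift_id: "x \<in> cantor n \<Longrightarrow> F_lift (\<lambda>x\<in>{0..1}. x) x = x"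
  by (rule F_lift_unique[OF thompson_F_id]) (simp_all add: act_id)

lemma F_lift_inverse:
  assumes "f \<in> thompson_F_maps"
  shows "\<exists>g\<in>thompson_F_maps. compose {0..1} g f = (\<lambda>x\<in>{0..1}. x) \<and> compose {0..1} f g = (\<lambda>x\<in>{0..1}. x) \<and>
    (\<forall>x\<in>cantor n. F_lift g (F_lift f x) = x) \<and> (\<forall>x\<in>cantor n. F_lift f (F_lift g x) = x)"
proof -
  obtain g where g: "g \<in> thompson_F_maps"
    "compose {0..1} g f = (\<lambda>x\<in>{0..1}. x)" "compose {0..1} f g = (\<lambda>x\<in>{0..1}. x)"
    using thompson_F_inverse[OF assms] by blast
  moreover have "\<forall>x\<in>cantor n. F_lift g (F_lift f x) = x" "\<forall>x\<in>cantor n. F_lift f (F_lift g x) = x"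
    using F_lift_comp[OF assms g(1)] F_lift_comp[OF g(1) assms] F_lift_id g(2,3) by simp_all
  ultimately show ?thesis by blast
qed

lemma F_lift_core_map:
  assumes f: "f \<in> thompson_F_maps"
  shows "core_map n (F_lift f)"
proof -
  obtain g where g: "\<forall>x\<in>cantor n. F_lift g (F_lift f x) = x"
    using F_lift_inverse[OF f] by blast
  have "inj_on (F_lift f) (cantor n)"
    by (rule inj_on_inverseI[where g = "F_lift g"]) (rule bspec[OF g])
  moreover obtain N where "0 < N" "has_cones f N" "F_lift f = lift_map f N"
    using F_level[OF f] by blast
  ultimately show ?thesis
    using lift_map_core_map[OF f] by simp
qed

text \<open>Each \<open>y\<close> is pulled back to a point which both lifts send to
  \<open>y\<close>. Behind the letter \<open>1\<close> the lifts then show \<open>act f y\<close>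
  and \<open>act g y\<close>.\<close>

lemma F_lift_faithful:
  assumes f: "f \<in> thompson_F_maps" and g: "g \<in> thompson_F_maps"
    and eq: "\<And>x. x \<in> cantor n \<Longrightarrow> F_lift f x = F_lift g x"
  shows "f = g"
proof (rule act_faithful[OF f g])
  fix y assume y: "y \<in> cantor n"
  obtain f' where f': "f' \<in> thompson_F_maps" "\<forall>x\<in>cantor n. F_lift f (F_lift f' x) = x"
    using F_lift_inverse[OF f] by blast
  let ?x = "F_lift f' y"
  have x: "?x \<in> cantor n" "F_lift f ?x = y"
    using F_lift_in_cantor[OF f'(1) y] bspec[OF f'(2) y] .
  then have gx: "F_lift g ?x = y"
    using eq[OF x(1)] by simp
  have "[Plain 1] \<frown> ?x \<in> cantor n"
    using x n3 by simp
  then have "F_lift f ([Plain 1] \<frown> ?x) = F_lift g ([Plain 1] \<frown> ?x)"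
    by (rule eq)
  then show "act f y = act g y"
    using F_lift_1[OF f x(1)] F_lift_1[OF g x(1)] x(2) gx by simp
qed

text \<open>An oriented version of \<open>circ_eq\<close> for distinct points behind a common root
  letter. The remaining pairs have constant tails \<open>0\<close> and \<open>n - 1\<close>, which
  the lift fixes.\<close>

definition adjacent :: "letter word \<Rightarrow> letter word \<Rightarrow> bool" where
  "adjacent x y \<longleftrightarrow> (\<exists>w\<in>lists (alph n). \<exists>i. 0 < i \<and> i < n \<and>
     x = w \<frown> [Plain i] \<frown> (\<lambda>_. Plain 0) \<and> y = w \<frown> [Plain (i - 1)] \<frown> (\<lambda>_. Plain (n - 1)))"

lemma adjacentI:
  "w \<in> lists (alph n) \<Longrightarrow> 0 < i \<Longrightarrow> i < n \<Longrightarrow>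
    adjacent (w \<frown> [Plain i] \<frown> (\<lambda>_. Plain 0)) (w \<frown> [Plain (i - 1)] \<frown> (\<lambda>_. Plain (n - 1)))"
  unfolding adjacent_def by blast

lemma adjacent_conc:
  assumes "adjacent x y" "u \<in> lists (alph n)"
  shows "adjacent (u \<frown> x) (u \<frown> y)"
proof -
  obtain w i where w: "w \<in> lists (alph n)" "0 < i" "i < n"
    "x = w \<frown> [Plain i] \<frown> (\<lambda>_. Plain 0)" "y = w \<frown> [Plain (i - 1)] \<frown> (\<lambda>_. Plain (n - 1))"
    using assms(1) unfolding adjacent_def by blast
  then show ?thesis
    using adjacentI[of "u @ w" i] assms(2) by simp
qed

lemma ext_const: "ext_letter \<circ> (\<lambda>_. False) = (\<lambda>_. Plain 0)" "ext_letter \<circ> (\<lambda>_. True) = (\<lambda>_. Plain (n - 1))"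
  by (auto simp: ext_letter_def)

lemma act_const:
  assumes f: "f \<in> thompson_F_maps"
  shows "act f (\<lambda>_. Plain 0) = (\<lambda>_. Plain 0)" "act f (\<lambda>_. Plain (n - 1)) = (\<lambda>_. Plain (n - 1))"
proof -
  obtain N where N: "has_cones f N"
    using f by (auto simp: thompson_F_maps_iff)
  obtain v where v: "dyadic_cone f (replicate N False) v"
    using has_conesD[OF N, of "replicate N False"] by auto
  show "act f (\<lambda>_. Plain 0) = (\<lambda>_. Plain 0)"
    using act_ext[OF v, of "\<lambda>_. False"] unfolding replicate_conc_const cone_at_0[OF f v] ext_const .
  obtain w where w: "dyadic_cone f (replicate N True) w"
    using has_conesD[OF N, of "replicate N True"] by auto
  show "act f (\<lambda>_. Plain (n - 1)) = (\<lambda>_. Plain (n - 1))"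
    using act_ext[OF w, of "\<lambda>_. True"] unfolding replicate_conc_const cone_at_1[OF f w] ext_const .
qed

text \<open>Points with outermost letters only are moved through cones, points with an inner letter
  right after \<open>\<beta>\<close> through the node \<open>\<beta>\<close>. Neighbours of
  different kind stay together because both ways lead below the same image node.\<close>

lemma act_around_mid:
  assumes f: "f \<in> thompson_F_maps"
  shows "act f (ext_word \<beta> \<frown> [Plain (n - 1)] \<frown> (\<lambda>_. Plain 0)) = ext_word (mid_map f \<beta>) \<frown> [Plain (n - 1)] \<frown> (\<lambda>_. Plain 0)"
    and "act f (ext_word \<beta> \<frown> [Plain 0] \<frown> (\<lambda>_. Plain (n - 1))) = ext_word (mid_map f \<beta>) \<frown> [Plain 0] \<frown> (\<lambda>_. Plain (n - 1))"
proof -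
  obtain N where N: "has_cones f N"
    using f by (auto simp: thompson_F_maps_iff)
  have word: "ext_letter \<circ> ((w @ [True]) \<frown> (\<lambda>_. False)) = ext_word w \<frown> [Plain (n - 1)] \<frown> (\<lambda>_. Plain 0)"
    "ext_letter \<circ> ((w @ [False]) \<frown> (\<lambda>_. True)) = ext_word w \<frown> [Plain 0] \<frown> (\<lambda>_. Plain (n - 1))" for w
    unfolding comp_concat ext_const by (simp_all add: ext_letter_def)
  let ?u = "\<beta> @ True # replicate N False"
  obtain v where v: "dyadic_cone f ?u v"
    using has_conesD[OF N, of ?u] by auto
  have u: "?u \<frown> (\<lambda>_. False) = (\<beta> @ [True]) \<frown> (\<lambda>_. False)"
    using conc_conc[of "\<beta> @ [True]" "replicate N False" "\<lambda>_. False"] by simp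
  have "act f (ext_letter \<circ> ((\<beta> @ [True]) \<frown> (\<lambda>_. False))) = ext_letter \<circ> ((mid_map f \<beta> @ [True]) \<frown> (\<lambda>_. False))"
    using act_ext[OF v, of "\<lambda>_. False"] unfolding u cone_after_mid[OF f v] .
  then show "act f (ext_word \<beta> \<frown> [Plain (n - 1)] \<frown> (\<lambda>_. Plain 0)) = ext_word (mid_map f \<beta>) \<frown> [Plain (n - 1)] \<frown> (\<lambda>_. Plain 0)"
    unfolding word .
  let ?u = "\<beta> @ False # replicate N True"
  obtain v where v: "dyadic_cone f ?u v"
    using has_conesD[OF N, of ?u] by auto
  have u: "?u \<frown> (\<lambda>_. True) = (\<beta> @ [False]) \<frown> (\<lambda>_. True)"
    using conc_conc[of "\<beta> @ [False]" "replicate N True" "\<lambda>_. True"] by simp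
  have "act f (ext_letter \<circ> ((\<beta> @ [False]) \<frown> (\<lambda>_. True))) = ext_letter \<circ> ((mid_map f \<beta> @ [False]) \<frown> (\<lambda>_. True))"
    using act_ext[OF v, of "\<lambda>_. True"] unfolding u cone_before_mid[OF f v] .
  then show "act f (ext_word \<beta> \<frown> [Plain 0] \<frown> (\<lambda>_. Plain (n - 1))) = ext_word (mid_map f \<beta>) \<frown> [Plain 0] \<frown> (\<lambda>_. Plain (n - 1))"
    unfolding word .
qed

lemma word_cases:
  assumes "w \<in> lists (alph n)"
  obtains (inner) \<beta> j u where "j \<in> inner" "u \<in> lists (alph n)" "w = ext_word \<beta> @ [j] @ u"
  | (ext) \<beta> where "w = ext_word \<beta>"
proof -
  have "(\<exists>\<beta> j u. j \<in> inner \<and> u \<in> lists (alph n) \<and> w = ext_word \<beta> @ [j] @ u) \<or> (\<exists>\<beta>. w = ext_word \<beta>)"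
    using assms
  proof (induction w rule: list.induct)
    case (Cons i w)
    have "i \<in> alph n" "w \<in> lists (alph n)"
      using Cons.prems by simp_all
    from this(1) show ?case
    proof (cases rule: alph_cases)
      case (1 b)
      from Cons.IH[OF \<open>w \<in> lists (alph n)\<close>] show ?thesis
      proof (elim disjE exE conjE)
        fix \<beta> j u assume "j \<in> inner" "u \<in> lists (alph n)" "w = ext_word \<beta> @ [j] @ u"
        then show ?thesis
          using 1 by (intro disjI1 exI[of _ "b # \<beta>"] exI[of _ j] exI[of _ u]) simp
      next
        fix \<beta> assume "w = ext_word \<beta>"
        then show ?thesis
          using 1 by (intro disjI2 exI[of _ "b # \<beta>"]) simp
      qed
    next
      case 2
      then show ?thesis
        using \<open>w \<in> lists (alph n)\<close> by (intro disjI1 exI[of _ "[]"] exI[of _ i] exI[of _ w]) simp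
    qed
  qed (auto intro: exI[of _ "[]"])
  then show thesis
    using inner ext by blast
qed

lemma act_adjacent:
  assumes f: "f \<in> thompson_F_maps" and xy: "adjacent x y"
  shows "adjacent (act f x) (act f y)"
proof -
  obtain w i where w: "w \<in> lists (alph n)" and i: "0 < i" "i < n"
    and x: "x = w \<frown> [Plain i] \<frown> (\<lambda>_. Plain 0)" and y: "y = w \<frown> [Plain (i - 1)] \<frown> (\<lambda>_. Plain (n - 1))"
    using xy unfolding adjacent_def by blast
  show ?thesis
    using w
  proof (cases rule: word_cases)
    case (inner \<beta> j u)
    let ?x = "[Plain i] \<frown> (\<lambda>_. Plain 0)" and ?y = "[Plain (i - 1)] \<frown> (\<lambda>_. Plain (n - 1))"
    have "w \<frown> z = ext_word \<beta> \<frown> [j] \<frown> (u \<frown> z)" for z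
      unfolding inner by simp
    then have "act f x = ext_word (mid_map f \<beta>) \<frown> [j] \<frown> (u \<frown> ?x)"
      "act f y = ext_word (mid_map f \<beta>) \<frown> [j] \<frown> (u \<frown> ?y)"
      unfolding x y by (simp_all only: act_inner[OF inner(1)])
    moreover have "ext_word (mid_map f \<beta>) \<frown> [j] \<frown> (u \<frown> z) = (ext_word (mid_map f \<beta>) @ [j] @ u) \<frown> z" for z
      by simp
    moreover have "ext_word (mid_map f \<beta>) @ [j] @ u \<in> lists (alph n)"
      using inner inner_alph by simp
    ultimately show ?thesis
      using adjacentI[of "ext_word (mid_map f \<beta>) @ [j] @ u" i] i by metis
  next
    case (ext \<beta>)
    have "act f x = ext_word (mid_map f \<beta>) \<frown> [Plain i] \<frown> (\<lambda>_. Plain 0)"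
    proof (cases "i = n - 1")
      case True
      then show ?thesis
        unfolding x ext using act_around_mid(1)[OF f] by metis
    next
      case False
      then have "Plain i \<in> inner"
        using i by (auto simp: inner_def)
      then show ?thesis
        unfolding x ext by (rule act_inner)
    qed
    moreover have "act f y = ext_word (mid_map f \<beta>) \<frown> [Plain (i - 1)] \<frown> (\<lambda>_. Plain (n - 1))"
    proof (cases "i - 1 = 0")
      case True
      then show ?thesis
        unfolding y ext using act_around_mid(2)[OF f] by metis
    next
      case False
      then have "Plain (i - 1) \<in> inner"
        using i by (auto simp: inner_def)
      then show ?thesis
        unfolding y ext by (rule act_inner)
    qed
    ultimately show ?thesis
      using adjacentI[of "ext_word (mid_map f \<beta>)" i] i by simp
  qed
qed

lemma F_lift_const:
  assumes f: "f \<in> thompson_F_maps"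
  shows "F_lift f (\<lambda>_. Plain 0) = (\<lambda>_. Plain 0)" "F_lift f (\<lambda>_. Plain (n - 1)) = (\<lambda>_. Plain (n - 1))"
  using F_lift_ext[OF f, of "\<lambda>_. False"] F_lift_ext[OF f, of "\<lambda>_. True"] unfolding ext_const .

text \<open>The letter \<open>1\<close> makes no exception, since \<open>act f\<close> fixes both
  constant words.\<close>

lemma F_lift_letter_const:
  assumes f: "f \<in> thompson_F_maps" and i: "i < n"
  shows "F_lift f ([Plain i] \<frown> (\<lambda>_. Plain 0)) = [Plain i] \<frown> (\<lambda>_. Plain 0)"
    and "F_lift f ([Plain i] \<frown> (\<lambda>_. Plain (n - 1))) = [Plain i] \<frown> (\<lambda>_. Plain (n - 1))"
proof -
  have c: "(\<lambda>_. Plain 0) \<in> cantor n" "(\<lambda>_. Plain (n - 1)) \<in> cantor n"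
    using n0 by simp_all
  show "F_lift f ([Plain i] \<frown> (\<lambda>_. Plain 0)) = [Plain i] \<frown> (\<lambda>_. Plain 0)"
    using F_lift_1[OF f c(1)] F_lift_step[OF f _ _ c(1), of "Plain i"] i
    by (cases "i = 1") (simp_all add: F_lift_const[OF f] act_const[OF f])
  show "F_lift f ([Plain i] \<frown> (\<lambda>_. Plain (n - 1))) = [Plain i] \<frown> (\<lambda>_. Plain (n - 1))"
    using F_lift_1[OF f c(2)] F_lift_step[OF f _ _ c(2), of "Plain i"] i
    by (cases "i = 1") (simp_all only: F_lift_const[OF f] act_const[OF f] Plain_in_alph_iff letter.inject simp_thms)
qed

lemma F_lift_adjacent:
  assumes f: "f \<in> thompson_F_maps" and xy: "adjacent x y"
  shows "adjacent (F_lift f x) (F_lift f y)"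
proof -
  obtain w i where w: "w \<in> lists (alph n)" and i: "0 < i" "i < n"
    and x: "x = w \<frown> [Plain i] \<frown> (\<lambda>_. Plain 0)" and y: "y = w \<frown> [Plain (i - 1)] \<frown> (\<lambda>_. Plain (n - 1))"
    using xy unfolding adjacent_def by blast
  let ?x = "[Plain i] \<frown> (\<lambda>_. Plain 0)" and ?y = "[Plain (i - 1)] \<frown> (\<lambda>_. Plain (n - 1))"
  have c: "?x \<in> cantor n" "?y \<in> cantor n"
    using i n0 by simp_all
  have "adjacent (F_lift f (w \<frown> ?x)) (F_lift f (w \<frown> ?y))"
    using w
  proof (induction w rule: list.induct)
    case Nil
    have "F_lift f ?x = ?x" "F_lift f ?y = ?y"
      using F_lift_letter_const(1)[OF f i(2)] F_lift_letter_const(2)[OF f, of "i - 1"] i by simp_all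
    then show ?case
      using adjacentI[of "[]" i] i by simp
  next
    case (Cons l w)
    have l: "l \<in> alph n" "[l] \<in> lists (alph n)" and IH: "adjacent (F_lift f (w \<frown> ?x)) (F_lift f (w \<frown> ?y))"
      and wc: "w \<frown> ?x \<in> cantor n" "w \<frown> ?y \<in> cantor n"
      using Cons c by simp_all
    have eq: "(l # w) \<frown> z = [l] \<frown> (w \<frown> z)" for z
      by simp
    show ?case
    proof (cases "l = Plain 1")
      case True
      then show ?thesis
        unfolding eq using F_lift_1[OF f wc(1)] F_lift_1[OF f wc(2)]
          adjacent_conc[OF act_adjacent[OF f IH] l(2)] by metis
    next
      case False
      then show ?thesis
        unfolding eq using F_lift_step[OF f l(1) False wc(1)] F_lift_step[OF f l(1) False wc(2)]
          adjacent_conc[OF IH l(2)] by metis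
    qed
  qed
  then show ?thesis
    using x y by simp
qed

section \<open>Acting below each root letter\<close>

definition rooted :: "(letter word \<Rightarrow> letter word) \<Rightarrow> letter word \<Rightarrow> letter word" where
  "rooted \<phi> y = [y 0] \<frown> \<phi> (suffix 1 y)"

lemma rooted_conc [simp]: "rooted \<phi> ([a] \<frown> x) = [a] \<frown> \<phi> x"
  by (simp add: rooted_def)

lemma rooted_lift_rooted: "rooted_lift n r \<phi> (rooted \<phi>)"
  by (simp add: rooted_lift_def)

lemma circ_eq_adjacent:
  assumes "adjacent x y" "a \<in> dots r"
  shows "circ_eq n r ([a] \<frown> x) ([a] \<frown> y)"
proof -
  obtain w i where w: "w \<in> lists (alph n)" and i: "0 < i" "i < n"
    and x: "x = w \<frown> [Plain i] \<frown> (\<lambda>_. Plain 0)" and y: "y = w \<frown> [Plain (i - 1)] \<frown> (\<lambda>_. Plain (n - 1))"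
    using assms(1) unfolding adjacent_def by blast
  have aw: "a # w \<in> rooted_words n r"
    using w assms(2) by simp
  have eq: "[a] \<frown> x = (a # w @ [Plain i]) \<frown> (\<lambda>_. Plain 0)"
      "[a] \<frown> y = (a # w @ [Plain (i - 1)]) \<frown> (\<lambda>_. Plain (n - 1))"
    unfolding x y by simp_all
  have "[a] \<frown> x \<in> rooted_cantor n r" "[a] \<frown> y \<in> rooted_cantor n r"
    unfolding eq using aw i n0 by (intro conc_in_rooted_cantor; simp)+
  moreover have "\<exists>w i. w \<in> rooted_words n r \<and> 0 < i \<and> i \<le> n - 1 \<and>
      {[a] \<frown> x, [a] \<frown> y} = {(w @ [Plain i]) \<frown> (\<lambda>_. Plain 0), (w @ [Plain (i - 1)]) \<frown> (\<lambda>_. Plain (n - 1))}"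
    unfolding eq using aw i by (intro exI[of _ "a # w"] exI[of _ i]) simp
  ultimately show ?thesis
    unfolding circ_eq_def by blast
qed

lemma circ_eq_sym: "circ_eq n r x y \<longleftrightarrow> circ_eq n r y x"
  unfolding circ_eq_def insert_commute[of x y "{}"] eq_commute[of x y] by (simp only: conj_left_commute)

lemma circ_eq_rooted:
  assumes f: "f \<in> thompson_F_maps" and xy: "circ_eq n r x y"
  shows "circ_eq n r (rooted (F_lift f) x) (rooted (F_lift f) y)"
proof -
  let ?h = "rooted (F_lift f)"
  have mem: "x \<in> rooted_cantor n r" "y \<in> rooted_cantor n r"
    using xy by (simp_all add: circ_eq_def)
  have hmem: "?h z \<in> rooted_cantor n r" if z: "z \<in> rooted_cantor n r" for z
  proof -
    obtain a u where "z = [a] \<frown> u" "a \<in> dots r" "u \<in> cantor n"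
      using z by (auto simp: rooted_cantor_def)
    then show ?thesis
      using F_lift_in_cantor[OF f] conc_in_rooted_cantor[of "[a]" n r "F_lift f u"] by simp
  qed
  have const: "?h ([a] \<frown> (\<lambda>_. Plain 0)) = [a] \<frown> (\<lambda>_. Plain 0)"
    "?h ([a] \<frown> (\<lambda>_. Plain (n - 1))) = [a] \<frown> (\<lambda>_. Plain (n - 1))" for a
    by (simp_all only: rooted_conc F_lift_const[OF f])
  \<comment> \<open>This covers neighbouring root letters as well as the pair that closes the
    circle: both points are constant behind the root letter, hence fixed.\<close>
  have fix_pair: "circ_eq n r (?h x) (?h y)"
    if "{x, y} = {[a] \<frown> (\<lambda>_. Plain 0), [b] \<frown> (\<lambda>_. Plain (n - 1))}" for a b
  proof -
    have "?h x = x" "?h y = y"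
      using that const unfolding doubleton_eq_iff by metis+
    then show ?thesis using xy by simp
  qed
  have adj: "circ_eq n r (?h x') (?h y')"
    if w: "w \<in> rooted_words n r" and i: "0 < i" "i \<le> n - 1"
      and x': "x' = (w @ [Plain i]) \<frown> (\<lambda>_. Plain 0)" and y': "y' = (w @ [Plain (i - 1)]) \<frown> (\<lambda>_. Plain (n - 1))"
    for w i x' y'
  proof -
    obtain a u where u: "w = a # u" "a \<in> dots r" "u \<in> lists (alph n)"
      using w unfolding rooted_words_def by blast
    let ?x = "u \<frown> [Plain i] \<frown> (\<lambda>_. Plain 0)" and ?y = "u \<frown> [Plain (i - 1)] \<frown> (\<lambda>_. Plain (n - 1))"
    have "x' = [a] \<frown> ?x" "y' = [a] \<frown> ?y"
      unfolding x' y' u by simp_all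
    moreover have "adjacent ?x ?y"
      using u(3) i by (intro adjacentI) auto
    ultimately show ?thesis
      using circ_eq_adjacent[OF F_lift_adjacent[OF f] u(2)] by (simp only: rooted_conc)
  qed
  consider "x = y"
    | w i where "w \<in> rooted_words n r" "0 < i" "i \<le> n - 1"
      "{x, y} = {(w @ [Plain i]) \<frown> (\<lambda>_. Plain 0), (w @ [Plain (i - 1)]) \<frown> (\<lambda>_. Plain (n - 1))}"
    | a b where "{x, y} = {[a] \<frown> (\<lambda>_. Plain 0), [b] \<frown> (\<lambda>_. Plain (n - 1))}"
    using xy unfolding circ_eq_def by blast
  then show ?thesis
  proof cases
    case 1
    then show ?thesis
      using hmem mem by (simp add: circ_eq_def)
  next
    case (2 w i)
    from 2(4) show ?thesis
      unfolding doubleton_eq_iff using adj[OF 2(1-3)] circ_eq_sym by blast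
  next
    case (3 a b)
    then show ?thesis by (rule fix_pair)
  qed
qed

lemma topspace_rooted: "topspace (rooted_cantor_top n r) = rooted_cantor n r"
  by (simp add: rooted_cantor_top_def)

lemma openin_cylinder: "openin (rooted_cantor_top n r) {y \<in> rooted_cantor n r. prefix k y = prefix k x}"
proof -
  let ?C = "PiE UNIV (\<lambda>i. if i < k then {x i} else UNIV)"
  have "{i. (if i < k then {x i} else UNIV) \<noteq> UNIV} \<subseteq> {..<k}"
    by auto
  then have "openin (product_topology (\<lambda>_. discrete_topology UNIV) UNIV) ?C"
    by (subst openin_PiE_gen) (auto intro: finite_subset)
  then have "openin (rooted_cantor_top n r) (?C \<inter> rooted_cantor n r)"
    unfolding rooted_cantor_top_def openin_subtopology by blast
  moreover have "?C \<inter> rooted_cantor n r = {y \<in> rooted_cantor n r. prefix k y = prefix k x}"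
  proof -
    have "y \<in> ?C \<longleftrightarrow> prefix k y = prefix k x" for y
    proof
      assume y: "y \<in> ?C"
      show "prefix k y = prefix k x"
      proof (rule prefix_eqI)
        fix i assume "i < k"
        then show "y i = x i"
          using y by (auto simp: PiE_iff dest: spec[of _ i])
      qed
    next
      assume "prefix k y = prefix k x"
      then show "y \<in> ?C"
        using prefix_eqD[of y k x] by (auto simp: PiE_iff)
    qed
    then show ?thesis by auto
  qed
  ultimately show ?thesis by simp
qed

text \<open>In the product of discrete spaces continuity is checked coordinatewise, and each
  coordinate of the value is locally constant, being settled by finitely many letters.\<close>

lemma continuous_rooted:
  assumes cont: "cantor_unif_continuous n \<phi>" and ran: "\<And>x. x \<in> cantor n \<Longrightarrow> \<phi> x \<in> cantor n"
  shows "continuous_map (rooted_cantor_top n r) (rooted_cantor_top n r) (rooted \<phi>)"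
proof -
  let ?X = "rooted_cantor_top n r"
  have loc: "\<exists>k. \<forall>y\<in>rooted_cantor n r. prefix k y = prefix k x \<longrightarrow> rooted \<phi> y m = rooted \<phi> x m"
    if x: "x \<in> rooted_cantor n r" for x m
  proof -
    obtain k where k: "\<And>x y. x \<in> cantor n \<Longrightarrow> y \<in> cantor n \<Longrightarrow> prefix k x = prefix k y \<Longrightarrow> prefix m (\<phi> x) = prefix m (\<phi> y)"
      using cantor_unif_continuousD[OF cont] by blast
    have "rooted \<phi> y m = rooted \<phi> x m" if y: "y \<in> rooted_cantor n r" "prefix (Suc k) y = prefix (Suc k) x" for y
    proof (cases m)
      case 0
      then show ?thesis
        using prefix_eqD[OF y(2), of 0] by (simp add: rooted_def)
    next
      case (Suc m')
      have "prefix k (suffix 1 y) = prefix k (suffix 1 x)"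
        using prefix_eqD[OF y(2)] by (intro prefix_eqI) simp
      then have "prefix m (\<phi> (suffix 1 y)) = prefix m (\<phi> (suffix 1 x))"
        using x y(1) by (intro k) (simp_all add: rooted_cantor_iff)
      then have "\<phi> (suffix 1 y) m' = \<phi> (suffix 1 x) m'"
        by (rule prefix_eqD) (simp add: Suc)
      then show ?thesis
        by (simp add: rooted_def Suc)
    qed
    then show ?thesis by blast
  qed
  have "continuous_map ?X (discrete_topology UNIV) (\<lambda>x. rooted \<phi> x m)" for m
    unfolding continuous_map_def
  proof (intro conjI allI impI)
    fix U :: "letter set"
    show "openin ?X {x \<in> topspace ?X. rooted \<phi> x m \<in> U}"
    proof (subst openin_subopen, intro ballI)
      fix x assume x: "x \<in> {x \<in> topspace ?X. rooted \<phi> x m \<in> U}"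
      then have "x \<in> rooted_cantor n r"
        by (simp add: topspace_rooted)
      then obtain k where k: "\<forall>y\<in>rooted_cantor n r. prefix k y = prefix k x \<longrightarrow> rooted \<phi> y m = rooted \<phi> x m"
        using loc by blast
      show "\<exists>T. openin ?X T \<and> x \<in> T \<and> T \<subseteq> {x \<in> topspace ?X. rooted \<phi> x m \<in> U}"
      proof (intro exI conjI)
        show "openin ?X {y \<in> rooted_cantor n r. prefix k y = prefix k x}"
          by (rule openin_cylinder)
      qed (use x k in \<open>auto simp: topspace_rooted\<close>)
    qed
  qed simp
  then have "continuous_map ?X (product_topology (\<lambda>_. discrete_topology UNIV) UNIV) (rooted \<phi>)"
    by (simp add: continuous_map_componentwise_UNIV)
  moreover have "rooted \<phi> \<in> topspace ?X \<rightarrow> rooted_cantor n r"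
    using ran by (auto simp: topspace_rooted rooted_cantor_iff rooted_def)
  ultimately show ?thesis
    by (subst (2) rooted_cantor_top_def) (simp add: continuous_map_in_subtopology)
qed

lemma rooted_F_lift_TB_maps:
  assumes f: "f \<in> thompson_F_maps" and r: "0 < r"
  shows "rooted (F_lift f) \<in> TB_maps n r"
proof -
  let ?X = "rooted_cantor_top n r" and ?h = "rooted (F_lift f)"
  obtain g where g: "g \<in> thompson_F_maps"
    "\<forall>x\<in>cantor n. F_lift g (F_lift f x) = x" "\<forall>x\<in>cantor n. F_lift f (F_lift g x) = x"
    using F_lift_inverse[OF f] by blast
  note gf = bspec[OF g(2)] and fg = bspec[OF g(3)]
  let ?k = "rooted (F_lift g)"
  have kh: "?k (?h y) = y" and hk: "?h (?k y) = y" if y: "y \<in> rooted_cantor n r" for y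
  proof -
    obtain a x where "y = [a] \<frown> x" "x \<in> cantor n"
      using y by (auto simp: rooted_cantor_def)
    then show "?k (?h y) = y" "?h (?k y) = y"
      using gf fg by (simp_all only: rooted_conc)
  qed
  have "homeomorphic_maps ?X ?X ?h ?k"
    unfolding homeomorphic_maps_def
    using continuous_rooted[OF F_lift_unif_continuous[OF f] F_lift_in_cantor[OF f]]
      continuous_rooted[OF F_lift_unif_continuous[OF g(1)] F_lift_in_cantor[OF g(1)]] kh hk
    by (simp add: topspace_rooted)
  then have hom: "homeomorphic_map ?X ?X ?h"
    by (rule homeomorphic_maps_imp_map)
  have inj: "inj_on ?h (rooted_cantor n r)"
    by (rule inj_on_inverseI[where g = ?k]) (rule kh)
  have kin: "[a] \<frown> F_lift g x \<in> rooted_cantor n r" if "a \<in> dots r" "x \<in> cantor n" for a x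
    using that F_lift_in_cantor[OF g(1)] by simp
  have "inv_into (rooted_cantor n r) ?h ([a] \<frown> x) = [a] \<frown> F_lift g x" if ax: "a \<in> dots r" "x \<in> cantor n" for a x
    using fg[OF ax(2)] by (intro inv_into_f_eq[OF inj kin[OF ax]]) simp
  then have "rooted_lift n r (F_lift g) (inv_into (rooted_cantor n r) ?h)"
    unfolding rooted_lift_def by blast
  then have fin: "finite_sync n r ?h" "finite_sync n r (inv_into (rooted_cantor n r) ?h)"
    using core_map_finite_sync[OF n2 r F_lift_core_map[OF f] rooted_lift_rooted]
      core_map_finite_sync[OF n2 r F_lift_core_map[OF g(1)]] by blast+
  \<comment> \<open>The converse implication is the direct one for the inverse
    \<open>?k\<close>.\<close>
  have "circ_eq n r x y \<longleftrightarrow> circ_eq n r (?h x) (?h y)" if "x \<in> rooted_cantor n r" "y \<in> rooted_cantor n r" for x y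
    using circ_eq_rooted[OF f, of r x y] circ_eq_rooted[OF g(1), of r "?h x" "?h y"] kh[OF that(1)] kh[OF that(2)]
    by metis
  then show ?thesis
    unfolding TB_maps_def B_maps_def using hom fin by blast
qed

lemma Core_rooted: "f \<in> thompson_F_maps \<Longrightarrow> 0 < r \<Longrightarrow> Core n r (rooted (F_lift f)) = core_class n (F_lift f)"
  by (rule core_map_Core[OF n2 _ F_lift_core_map rooted_lift_rooted])

end

section \<open>The subgroup\<close>

lemma core_class_cong:
  assumes "\<And>x. x \<in> cantor n \<Longrightarrow> \<phi> x = \<psi> x"
  shows "core_class n \<phi> = core_class n \<psi>"
  using assms by (auto simp: core_class_def)

context alphabet
begin

abbreviation F_core :: "(real \<Rightarrow> real) \<Rightarrow> nat transducer set" where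
  "F_core f \<equiv> core_class n (F_lift f)"

lemma F_core_nonempty:
  assumes "f \<in> thompson_F_maps"
  shows "F_core f \<noteq> {}"
proof -
  \<comment> \<open>Any size of the root alphabet would do, as the class does not depend on
    it.\<close>
  have "F_core f = Core n 1 (rooted (F_lift f))"
    using Core_rooted[OF assms, of 1] by simp
  then show ?thesis
    using transducer_class_self unfolding Core_def by blast
qed

lemma F_core_mult:
  assumes f: "f \<in> thompson_F_maps" and g: "g \<in> thompson_F_maps"
  shows "core_mult n (F_core f) (F_core g) = F_core (compose {0..1} g f)"
proof -
  note fg = thompson_F_comp[OF f g]
  have eq: "F_lift g (F_lift f x) = F_lift (compose {0..1} g f) x" if "x \<in> cantor n" for x
    using F_lift_comp[OF f g that] by simp
  have "no_common_prefix n (F_lift (compose {0..1} g f))"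
    using F_lift_core_map[OF fg] by (simp add: core_map_def)
  then have "no_common_prefix n (\<lambda>x. F_lift g (F_lift f x))"
    using eq by (simp add: no_common_prefix_def)
  then have "core_mult n (F_core f) (F_core g) = core_class n (\<lambda>x. F_lift g (F_lift f x))"
    by (rule core_mult_core_class[OF n2 F_lift_core_map[OF f] F_lift_core_map[OF g] _
          F_core_nonempty[OF f] F_core_nonempty[OF g]])
  also have "\<dots> = F_core (compose {0..1} g f)"
    using eq by (rule core_class_cong)
  finally show ?thesis .
qed

lemma F_core_one: "0 < r \<Longrightarrow> Core n r (\<lambda>x. x) = F_core (\<lambda>x\<in>{0..1}. x)"
  by (rule core_map_Core[OF n2 _ F_lift_core_map[OF thompson_F_id]])
    (simp_all add: rooted_lift_def F_lift_id)

lemma F_core_inj: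
  assumes f: "f \<in> thompson_F_maps" and g: "g \<in> thompson_F_maps" and eq: "F_core f = F_core g"
  shows "f = g"
proof -
  obtain D where D: "D \<in> F_core f" "D \<in> F_core g"
    using F_core_nonempty[OF f] eq by blast
  show ?thesis
    by (rule F_lift_faithful[OF f g]) (rule core_class_inj[OF n0 F_lift_core_map[OF f] F_lift_core_map[OF g] D])
qed

text \<open>Both groups are instances, with \<open>TB_maps n r\<close> and \<open>B_maps n r\<close>
  as \<open>B\<close>. The lower bound puts the lifts into the carrier, the upper bound makes every
  element of the carrier the class of a core. As no group law is available for \<open>G\<close>,
  closure under \<open>m_inv\<close> means evaluating its definite description.\<close>

lemma thompson_F_subgroup:
  fixes G :: "nat transducer set monoid"
  assumes r: "0 < r" and B: "TB_maps n r \<subseteq> B" "B \<subseteq> B_maps n r"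
    and G: "carrier G = Core n r ` B" "mult G = core_mult n" "one G = Core n r (\<lambda>x. x)"
  shows "\<exists>H. subgroup H G \<and> G\<lparr>carrier := H\<rparr> \<cong> thompson_F"
proof -
  let ?H = "F_core ` thompson_F_maps"
  have sub: "?H \<subseteq> carrier G"
  proof
    fix y assume "y \<in> ?H"
    then obtain f where f: "f \<in> thompson_F_maps" "y = F_core f" by blast
    then have "y = Core n r (rooted (F_lift f))"
      using Core_rooted[OF f(1) r] by simp
    then show "y \<in> carrier G"
      using rooted_F_lift_TB_maps[OF f(1) r] B(1) G(1) by blast
  qed
  have one: "one G = F_core (\<lambda>x\<in>{0..1}. x)"
    unfolding G(3) by (rule F_core_one[OF r])
  have inv: "\<exists>g\<in>thompson_F_maps. m_inv G (F_core f) = F_core g" if f: "f \<in> thompson_F_maps" for f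
  proof -
    obtain g where g: "g \<in> thompson_F_maps"
      "compose {0..1} g f = (\<lambda>x\<in>{0..1}. x)" "compose {0..1} f g = (\<lambda>x\<in>{0..1}. x)"
      "\<forall>x\<in>cantor n. F_lift f (F_lift g x) = x"
      using F_lift_inverse[OF f] by blast
    have "m_inv G (F_core f) = F_core g"
      unfolding m_inv_def
    proof (rule the_equality)
      show "F_core g \<in> carrier G \<and> F_core f \<otimes>\<^bsub>G\<^esub> F_core g = \<one>\<^bsub>G\<^esub> \<and> F_core g \<otimes>\<^bsub>G\<^esub> F_core f = \<one>\<^bsub>G\<^esub>"
        using sub f g F_core_mult[OF f g(1)] F_core_mult[OF g(1) f] by (auto simp: G(2) one)
    next
      \<comment> \<open>A competing inverse is the class of a core, and the equation with
        \<open>F_core f\<close> on the left forces it to be \<open>F_core g\<close>.\<close>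
      fix y assume y: "y \<in> carrier G \<and> F_core f \<otimes>\<^bsub>G\<^esub> y = \<one>\<^bsub>G\<^esub> \<and> y \<otimes>\<^bsub>G\<^esub> F_core f = \<one>\<^bsub>G\<^esub>"
      then obtain k where k: "k \<in> B_maps n r" "y = Core n r k"
        using B(2) G(1) by auto
      obtain Y where Y: "y = transducer_class n Y"
        using k(2) unfolding Core_def by blast
      have ct: "core_transducer n Y"
        using Core_core_transducer[OF k(1) n0 r, of Y] transducer_class_self[of Y n] k(2) Y by simp
      have "core_mult n (F_core f) (transducer_class n Y) = F_core (\<lambda>x\<in>{0..1}. x)"
        using y G(2) one Y by simp
      also have "\<dots> = core_class n (\<lambda>x. x)"
        by (rule core_class_cong) (rule F_lift_id)
      finally show "y = F_core g"
        unfolding Y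
        using core_mult_right_inverse[OF n2 F_lift_core_map[OF f] F_lift_core_map[OF g(1)] _ F_core_nonempty[OF f] ct]
          g(4) by simp
    qed
    with g(1) show ?thesis by blast
  qed
  have "subgroup ?H G"
  proof
    show "?H \<subseteq> carrier G" by (rule sub)
    show "x \<otimes>\<^bsub>G\<^esub> y \<in> ?H" if "x \<in> ?H" "y \<in> ?H" for x y
      using that F_core_mult thompson_F_comp by (auto simp: G(2))
    show "\<one>\<^bsub>G\<^esub> \<in> ?H"
      unfolding one using thompson_F_id by blast
    show "inv\<^bsub>G\<^esub> x \<in> ?H" if "x \<in> ?H" for x
      using that inv by auto
  qed
  moreover have "inv_into thompson_F_maps F_core \<in> iso (G\<lparr>carrier := ?H\<rparr>) thompson_F"
  proof (rule isoI)
    have inj: "inj_on F_core thompson_F_maps"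
      by (rule inj_onI) (rule F_core_inj)
    let ?\<theta> = "inv_into thompson_F_maps F_core"
    have \<theta>: "?\<theta> (F_core f) = f" if "f \<in> thompson_F_maps" for f
      by (rule inv_into_f_f[OF inj that])
    show "?\<theta> \<in> hom (G\<lparr>carrier := ?H\<rparr>) thompson_F"
    proof (rule homI)
      show "?\<theta> x \<in> carrier thompson_F" if "x \<in> carrier (G\<lparr>carrier := ?H\<rparr>)" for x
        using that \<theta> by (auto simp: thompson_F_def)
      show "?\<theta> (x \<otimes>\<^bsub>G\<lparr>carrier := ?H\<rparr>\<^esub> y) = ?\<theta> x \<otimes>\<^bsub>thompson_F\<^esub> ?\<theta> y"
        if "x \<in> carrier (G\<lparr>carrier := ?H\<rparr>)" "y \<in> carrier (G\<lparr>carrier := ?H\<rparr>)" for x y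
        using that \<theta> F_core_mult thompson_F_comp by (auto simp: thompson_F_def G(2))
    qed
    show "bij_betw ?\<theta> (carrier (G\<lparr>carrier := ?H\<rparr>)) (carrier thompson_F)"
      using bij_betw_inv_into[OF inj_on_imp_bij_betw[OF inj]] by (simp add: thompson_F_def)
  qed
  ultimately show ?thesis
    by (auto simp: is_iso_def)
qed

end

theorem corollary1p8:
  fixes n r :: nat
  assumes "3 \<le> n" and "1 \<le> r" and "r \<le> n - 1"
  shows "(\<exists>H. subgroup H (TO_group n r) \<and> (TO_group n r)\<lparr>carrier := H\<rparr> \<cong> thompson_F) \<and>
         (\<exists>H. subgroup H (O_group n r) \<and> (O_group n r)\<lparr>carrier := H\<rparr> \<cong> thompson_F)"
proof -
  interpret alphabet n
    by unfold_locales (rule assms(1))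
  have TB: "TB_maps n r \<subseteq> B_maps n r"
    by (auto simp: TB_maps_def)
  show ?thesis
  proof
    show "\<exists>H. subgroup H (TO_group n r) \<and> (TO_group n r)\<lparr>carrier := H\<rparr> \<cong> thompson_F"
      by (rule thompson_F_subgroup[OF _ order_refl TB]) (use assms(2) in \<open>simp_all add: TO_group_def\<close>)
    show "\<exists>H. subgroup H (O_group n r) \<and> (O_group n r)\<lparr>carrier := H\<rparr> \<cong> thompson_F"
      by (rule thompson_F_subgroup[OF _ TB order_refl]) (use assms(2) in \<open>simp_all add: O_group_def\<close>)
  qed
qed

end
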